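(* Let $\alpha\ge1$ and let $U$ be an open subset of $D(0,(2/\alpha)^{1/\alpha})$ satisfying the following exterior ball condition: there exists $\epsilon>0$ such that for every $z\in\partial U$ there exists $\eta\in U^c$ with $B(\eta,\epsilon)\subset U^c$ and $|z-\eta|=\epsilon$. Then $$\lim_{n\to\infty}\frac1{n^2}\log\mathbf P\big[\mathcal X_n^{(\alpha)}(n^{1/\alpha}U)=0\big]=R_\emptyset^{(\alpha)}-R_U^{(\alpha)}.$$
   Context: $m$ is Lebesgue measure on $\mathbb C$; $D(0,t)$ is the disk of radius $t$ centred at $0$; $B(\eta,\epsilon)$ is the ball of radius $\epsilon$ centred at $\eta$; $sU=\{sz: z\in U\}$; $U^c=\mathbb C\setminus U$; $\emptyset$ is the empty set. For $\alpha>0$, $\mathcal X_n^{(\alpha)}$ is the determinantal point process of $n$ points in $\mathbb C$ with kernel $\mathbb K_n^{(\alpha)}(z,w)=\frac\alpha{2\pi}\sum_{k=0}^{n-1}\frac{(z\bar w)^k}{\Gamma(\frac2\alpha(k+1))}e^{-\frac{|z|^\alpha}2-\frac{|w|^\alpha}2}$ with respect to $m$; equivalently, the vector of its points in uniform random order has density $\frac{\alpha^n}{n!(2\pi)^n\prod_{k=0}^{n-1}\Gamma(\frac2\alpha(k+1))}e^{-\sum_{k=1}^n|z_k|^\alpha}\prod_{i<j}|z_i-z_j|^2$ with respect to Lebesgue measure on $\mathbb C^n$. $\mathcal X_n^{(\alpha)}(\Omega)$ is the number of its points falling in $\Omega$. $\mathcal P(E)$ is the set of compactly supported probability measures with support in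 $E$. For $\mu\in\mathcal P(\mathbb C)$, $R_{\mu}^{(\alpha)}=\iint\log\frac1{|z-w|}d\mu(z)d\mu(w)+\int|z|^\alpha d\mu(z)$, and $R_U^{(\alpha)}=\inf\{R_{\mu}^{(\alpha)}:\mu\in\mathcal P(U^c)\}$. *)

theory Defs
  imports "HOL-Probability.Probability" "Jordan_Normal_Form.Determinant"
begin

section \<open>Point processes in the plane\<close>

text \<open>
  A simple point process on the complex plane is a random locally finite subset of it, defined on a
  probability space \<open>M\<close>.
\<close>

definition num_points :: "('a \<Rightarrow> complex set) \<Rightarrow> complex set \<Rightarrow> 'a \<Rightarrow> nat" where
  "num_points X B \<omega> = card (X \<omega> \<inter> B)"

definition point_process :: "'a measure \<Rightarrow> ('a \<Rightarrow> complex set) \<Rightarrow> bool" where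
  "point_process M X \<longleftrightarrow> prob_space M \<and>
     (\<forall>B \<in> sets borel. bounded B \<longrightarrow>
        (\<forall>\<omega> \<in> space M. finite (X \<omega> \<inter> B)) \<and>
        num_points X B \<in> measurable M (count_space UNIV))"

text \<open>
  \<open>\<rho>\<close> is the \<open>k\<close>-th joint intensity with respect to Lebesgue measure if it is the density of the
  \<open>k\<close>-th factorial moment measure, which sends \<open>A\<close> to the expected number of \<open>k\<close>-tuples of pairwise
  distinct points of the process that lie in \<open>A\<close>. The counting measure is used instead of
  \<open>card\<close> because that number may be infinite.
\<close>

definition joint_intensity ::
    "'a measure \<Rightarrow> ('a \<Rightarrow> complex set) \<Rightarrow> nat \<Rightarrow> ((nat \<Rightarrow> complex) \<Rightarrow> real) \<Rightarrow> bool" where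
  "joint_intensity M X k \<rho> \<longleftrightarrow>
     \<rho> \<in> borel_measurable (\<Pi>\<^sub>M i\<in>{..<k}. lborel) \<and>
     (\<forall>x \<in> {..<k} \<rightarrow>\<^sub>E UNIV. 0 \<le> \<rho> x) \<and>
     (\<forall>A \<in> sets (\<Pi>\<^sub>M i\<in>{..<k}. lborel).
        (\<integral>\<^sup>+\<omega>. emeasure (count_space UNIV) {x \<in> A. inj_on x {..<k} \<and> x ` {..<k} \<subseteq> X \<omega>} \<partial>M) =
        (\<integral>\<^sup>+x\<in>A. ennreal (\<rho> x) \<partial>(\<Pi>\<^sub>M i\<in>{..<k}. lborel)))"

definition determinantal_process ::
    "'a measure \<Rightarrow> ('a \<Rightarrow> complex set) \<Rightarrow> (complex \<Rightarrow> complex \<Rightarrow> complex) \<Rightarrow> bool" where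
  "determinantal_process M X K \<longleftrightarrow> point_process M X \<and>
     (\<exists>\<rho>. \<forall>k. joint_intensity M X k (\<rho> k) \<and>
        (\<forall>x \<in> {..<k} \<rightarrow>\<^sub>E UNIV. complex_of_real (\<rho> k x) =
           Determinant.det (Matrix.mat k k (\<lambda>(i, j). K (x i) (x j)))))"

definition kernel_alpha :: "real \<Rightarrow> nat \<Rightarrow> complex \<Rightarrow> complex \<Rightarrow> complex" where
  "kernel_alpha \<alpha> n z w =
     of_real (\<alpha> / (2 * pi)) *
     (\<Sum>k<n. (z * cnj w) ^ k / of_real (Gamma (2 / \<alpha> * (real k + 1)))) *
     of_real (exp (- (norm z powr \<alpha>) / 2 - (norm w powr \<alpha>) / 2))"

definition alpha_process :: "real \<Rightarrow> nat \<Rightarrow> 'a measure \<Rightarrow> ('a \<Rightarrow> complex set) \<Rightarrow> bool" where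
  "alpha_process \<alpha> n M X \<longleftrightarrow>
     determinantal_process M X (kernel_alpha \<alpha> n) \<and> (AE \<omega> in M. finite (X \<omega>) \<and> card (X \<omega>) = n)"

section \<open>Weighted logarithmic energy\<close>

definition supp :: "complex measure \<Rightarrow> complex set" where
  "supp \<mu> = {z. \<forall>V. open V \<and> z \<in> V \<longrightarrow> emeasure \<mu> V > 0}"

definition compact_probs :: "complex set \<Rightarrow> complex measure set" where
  "compact_probs E = {\<mu>. prob_space \<mu> \<and> sets \<mu> = sets borel \<and> compact (supp \<mu>) \<and> supp \<mu> \<subseteq> E}"

text \<open>
  The logarithm with \<open>log 0 = -\<infinity>\<close>, whereas \<open>ln 0 = 0\<close> in the library. In particular
  \<open>- elog \<bar>z - w\<bar>\<close> is \<open>log (1 / \<bar>z - w\<bar>)\<close>, with value \<open>\<infinity>\<close> on the diagonal.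
\<close>

definition elog :: "real \<Rightarrow> ereal" where
  "elog x = (if x \<le> 0 then -\<infinity> else ereal (ln x))"

text \<open>
  Integral of an extended real valued function. It is only meaningful when the positive or the
  negative part has a finite integral, as is the case for the logarithmic kernel and a compactly
  supported probability measure: the kernel is then bounded below almost everywhere.
\<close>

definition ereal_integral :: "'a measure \<Rightarrow> ('a \<Rightarrow> ereal) \<Rightarrow> ereal" where
  "ereal_integral M f =
     enn2ereal (\<integral>\<^sup>+x. e2ennreal (f x) \<partial>M) - enn2ereal (\<integral>\<^sup>+x. e2ennreal (- f x) \<partial>M)"

definition energy :: "real \<Rightarrow> complex measure \<Rightarrow> ereal" where
  "energy \<alpha> \<mu> =
     ereal_integral (\<mu> \<Otimes>\<^sub>M \<mu>) (\<lambda>(z, w). - elog (norm (z - w))) +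
     ereal_integral \<mu> (\<lambda>z. ereal (norm z powr \<alpha>))"

definition min_energy :: "real \<Rightarrow> complex set \<Rightarrow> ereal" where
  "min_energy \<alpha> U = (INF \<mu> \<in> compact_probs (- U). energy \<alpha> \<mu>)"

section \<open>Exterior ball condition\<close>

definition exterior_ball_condition :: "complex set \<Rightarrow> bool" where
  "exterior_ball_condition U \<longleftrightarrow>
     (\<exists>\<epsilon>>0. \<forall>z \<in> frontier U. \<exists>\<eta> \<in> - U. ball \<eta> \<epsilon> \<subseteq> - U \<and> norm (z - \<eta>) = \<epsilon>)"

end

theory Submission
  imports Defs "HOL-Real_Asymp.Real_Asymp"
begin

text \<open>
  The process has exactly \<open>n\<close> points almost surely, so its \<open>n\<close>-th joint intensity determines the
  probability that a set contains no point. The determinant of the kernel is, up to explicit factors,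
  a product of two Vandermonde determinants, and after rescaling by \<open>n^(1/\<alpha>)\<close> the probability that \<open>n^(1/\<alpha>) U\<close> is
  empty is \<open>Z_n(U) / Z_n(\<emptyset>)\<close> (\<open>void_probability\<close>), where \<open>Z_n(U)\<close> is the integral of
  \<open>\<Prod>_(i<j) \<bar>w_i - w_j\<bar>^2 e^(-n \<Sum>_i \<bar>w_i\<bar>^\<alpha>)\<close> over the configurations of \<open>n\<close> points in the complement
  of \<open>U\<close>. It suffices to show that \<open>log Z_n(U) / n^2\<close> tends to minus the minimal energy
  (\<open>partfun_limit\<close>), for \<open>U\<close> and for the empty set, which trivially satisfies the exterior ball
  condition.

  Both bounds rest on one estimate (\<open>smoothing\<close>), which takes the place of weak compactness. By the
  exterior ball condition each point \<open>z\<close> outside \<open>U\<close> has a disk of a given small radius \<open>\<delta>\<close>, with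
  centre at distance at most \<open>4 \<delta>\<close> from \<open>z\<close>, that misses \<open>U\<close>; the centre \<open>p z\<close> can be chosen constant
  on the cells of a grid. Replacing the unit mass at each \<open>z\<close> by the uniform measure on the disk
  around \<open>p z\<close> turns any compactly supported probability measure \<open>\<mu>\<close> on the complement of \<open>U\<close>, atomic
  ones included, into one with bounded density. Its energy exceeds the energy of \<open>\<mu>\<close> for the kernel
  truncated at height \<open>log (1/\<delta>)\<close> by an arbitrarily small relative and absolute error: two points at
  distance at least \<open>\<surd>\<delta>\<close> contribute an error \<open>O(\<surd>\<delta>)\<close>, and two closer points a bounded error,
  which is small compared with their interaction, at least \<open>log (1/\<delta>) / 2\<close>; the change of the
  potential is controlled by convexity.

  For the upper bound, \<open>smoothing\<close> is applied to the empirical measure of a configuration: the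
  truncated diagonal terms cost only \<open>n log (1/\<delta>)\<close>, so every configuration of \<open>n\<close> points outside \<open>U\<close>
  has energy at least \<open>n^2\<close> times the minimal one, up to lower order terms
  (\<open>conf_energy_lower_bound\<close>). For the lower bound, it is applied to an almost minimizing measure. The
  resulting measure \<open>\<nu>\<close> is at most \<open>D\<close> times Lebesgue measure, so that \<open>Z_n(U)\<close> is at least \<open>D^(-n)\<close>
  times the integral of the weight against the \<open>n\<close>-fold product of \<open>\<nu>\<close>, and Jensen's inequality
  applies (\<open>partfun_ge\<close>).
\<close>

section \<open>The logarithmic kernel with the confining potential\<close>

text \<open>
  The truncated kernel \<open>min (log (1/\<bar>z - w\<bar>)) (log (1/\<delta>)) + (\<bar>z\<bar>^\<alpha> + \<bar>w\<bar>^\<alpha>) / 2 + 4\<close>. The potential is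
  split evenly between the two points. The constant 4 makes the kernel nonnegative for \<open>\<alpha> \<ge> 1\<close> and
  \<open>0 < \<delta> \<le> 1\<close>.
\<close>

definition trunc_kernel :: "real \<Rightarrow> real \<Rightarrow> complex \<Rightarrow> complex \<Rightarrow> real" where
  "trunc_kernel \<alpha> \<delta> z w = - ln (max (norm (z - w)) \<delta>) + (norm z powr \<alpha> + norm w powr \<alpha>) / 2 + 4"

text \<open>
  The kernel without truncation, with values in \<open>[0, \<infinity>]\<close> and infinite on the diagonal.
\<close>

definition pos_kernel :: "real \<Rightarrow> complex \<Rightarrow> complex \<Rightarrow> ennreal" where
  "pos_kernel \<alpha> z w = (if z = w then \<infinity> else
     ennreal (- ln (norm (z - w)) + (norm z powr \<alpha> + norm w powr \<alpha>) / 2 + 4))"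

lemma ln_add_one_le:
  fixes \<alpha> t :: real
  assumes "\<alpha> \<ge> 1" "t \<ge> 0"
  shows "ln (1 + t) \<le> t powr \<alpha> / 4 + 2"
proof -
  have "ln ((1 + t) / 4) \<le> (1 + t) / 4 - 1"
    using assms by (intro ln_le_minus_one) auto
  then have 1: "ln (1 + t) \<le> ln 4 + (1 + t) / 4 - 1"
    using assms by (simp add: ln_div)
  have "ln (4::real) = 2 * ln 2" using ln_realpow[of "2::real" 2] by simp
  also have "\<dots> \<le> 2 * 25 / 36" using ln2_le_25_over_36 by simp
  finally have 2: "ln (4::real) \<le> 2" by simp
  have "t \<le> 1 + t powr \<alpha>"
  proof (cases "t \<le> 1")
    case False
    then have "t powr 1 \<le> t powr \<alpha>" using assms by (intro powr_mono) auto
    then show ?thesis using assms by simp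
  qed (simp add: add_increasing2)
  with 1 2 show ?thesis by (simp add: field_simps)
qed

lemma ln_dist_le:
  fixes z w :: complex
  assumes "\<alpha> \<ge> 1" "0 < m" "m \<le> (1 + norm z) * (1 + norm w)"
  shows "ln m \<le> (norm z powr \<alpha> + norm w powr \<alpha>) / 4 + 4"
proof -
  have "ln m \<le> ln ((1 + norm z) * (1 + norm w))"
    using assms by simp
  also have "\<dots> = ln (1 + norm z) + ln (1 + norm w)"
    by (intro ln_mult_pos) (auto simp: add_pos_nonneg)
  also have "\<dots> \<le> (norm z powr \<alpha> / 4 + 2) + (norm w powr \<alpha> / 4 + 2)"
    by (intro add_mono ln_add_one_le assms) auto
  finally show ?thesis by (simp add: field_simps)
qed

lemma norm_diff_le_prod: "norm (z - w) \<le> (1 + norm z) * (1 + norm (w :: complex))"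
  by (rule order_trans[OF norm_triangle_ineq4]) (simp add: algebra_simps)

lemma pos_kernel_real_ge:
  fixes z w :: complex
  assumes "\<alpha> \<ge> 1" "z \<noteq> w"
  shows "- ln (norm (z - w)) + (norm z powr \<alpha> + norm w powr \<alpha>) / 2 + 4
         \<ge> (norm z powr \<alpha> + norm w powr \<alpha>) / 4"
  using ln_dist_le[OF assms(1), of "norm (z - w)" z w] norm_diff_le_prod[of z w] assms(2)
  by (simp add: field_simps)

lemma trunc_kernel_ge:
  assumes "\<alpha> \<ge> 1" "0 < \<delta>" "\<delta> \<le> 1"
  shows "trunc_kernel \<alpha> \<delta> z w \<ge> (norm z powr \<alpha> + norm w powr \<alpha>) / 4"
proof -
  have "(1::real) * 1 \<le> (1 + norm z) * (1 + norm w)"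
    by (intro mult_mono) auto
  then have "max (norm (z - w)) \<delta> \<le> (1 + norm z) * (1 + norm w)"
    using norm_diff_le_prod[of z w] assms by auto
  moreover have "0 < max (norm (z - w)) \<delta>" using assms by (simp add: less_max_iff_disj)
  ultimately have "ln (max (norm (z - w)) \<delta>) \<le> (norm z powr \<alpha> + norm w powr \<alpha>) / 4 + 4"
    using ln_dist_le[OF assms(1)] by blast
  then show ?thesis
    by (simp add: field_simps trunc_kernel_def)
qed

lemma trunc_kernel_nonneg:
  assumes "\<alpha> \<ge> 1" "0 < \<delta>" "\<delta> \<le> 1"
  shows "trunc_kernel \<alpha> \<delta> z w \<ge> 0"
  by (rule order_trans[OF _ trunc_kernel_ge[OF assms]]) simp

lemma trunc_kernel_le_pos_kernel:
  assumes "0 < \<delta>"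
  shows "ennreal (trunc_kernel \<alpha> \<delta> z w) \<le> pos_kernel \<alpha> z w"
  using assms by (auto simp: pos_kernel_def trunc_kernel_def intro!: ennreal_leI)

lemma measurable_trunc_kernel [measurable]:
  "(\<lambda>(z, w). trunc_kernel \<alpha> \<delta> z w) \<in> borel_measurable (borel \<Otimes>\<^sub>M borel)"
  unfolding trunc_kernel_def by measurable

lemma measurable_pos_kernel [measurable]:
  "(\<lambda>(z, w). pos_kernel \<alpha> z w) \<in> borel_measurable (borel \<Otimes>\<^sub>M borel)"
  unfolding pos_kernel_def by measurable

lemma pos_kernel_commute: "pos_kernel \<alpha> z w = pos_kernel \<alpha> w z"
  by (simp add: pos_kernel_def norm_minus_commute add.commute)

text \<open>
  By convexity of \<open>x^\<alpha>\<close>, since \<open>t + h\<close> is the convex combination of \<open>t\<close> and \<open>t + 1\<close> with weights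
  \<open>1 - h\<close> and \<open>h\<close>.
\<close>

lemma powr_shift_le:
  fixes \<alpha> t h :: real
  assumes "\<alpha> \<ge> 1" "0 \<le> t" "0 \<le> h" "h \<le> 1"
  shows "(t + h) powr \<alpha> \<le> t powr \<alpha> + 2 powr \<alpha> * h * (1 + t powr \<alpha>)"
proof -
  have *: "(t + 1) powr \<alpha> \<le> 2 powr \<alpha> * (1 + t powr \<alpha>)"
  proof (cases "t \<le> 1")
    case True
    then have "(t + 1) powr \<alpha> \<le> 2 powr \<alpha>" using assms by (intro powr_mono2) auto
    also have "\<dots> \<le> 2 powr \<alpha> * (1 + t powr \<alpha>)" by simp
    finally show ?thesis .
  next
    case False
    then have "(t + 1) powr \<alpha> \<le> (2 * t) powr \<alpha>" using assms by (intro powr_mono2) auto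
    also have "\<dots> = 2 powr \<alpha> * t powr \<alpha>" using False by (simp add: powr_mult)
    also have "\<dots> \<le> 2 powr \<alpha> * (1 + t powr \<alpha>)" by simp
    finally show ?thesis .
  qed
  have **: "(t + h) powr \<alpha> \<le> t powr \<alpha> + h * (t + 1) powr \<alpha>"
  proof (cases "t = 0")
    case True
    have "h powr \<alpha> \<le> h powr 1" using assms by (intro powr_mono') auto
    with True assms show ?thesis by simp
  next
    case False
    have "((1 - h) *\<^sub>R t + h *\<^sub>R (t + 1)) powr \<alpha> \<le> (1 - h) * t powr \<alpha> + h * (t + 1) powr \<alpha>"
      using False assms by (intro convex_onD[OF powr_convex]) auto
    moreover have "(1 - h) *\<^sub>R t + h *\<^sub>R (t + 1) = t + h" by (simp add: algebra_simps)
    moreover have "(1 - h) * t powr \<alpha> \<le> t powr \<alpha>"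
      using assms by (intro mult_left_le_one_le) auto
    ultimately show ?thesis by simp
  qed
  have "h * (t + 1) powr \<alpha> \<le> h * (2 powr \<alpha> * (1 + t powr \<alpha>))"
    using * assms by (intro mult_left_mono) auto
  with ** show ?thesis by (simp add: algebra_simps)
qed

lemma powr_norm_shift_le:
  fixes x z :: complex
  assumes "\<alpha> \<ge> 1" "norm (x - z) \<le> h" "h \<le> 1"
  shows "norm x powr \<alpha> \<le> norm z powr \<alpha> + 2 powr \<alpha> * h * (1 + norm z powr \<alpha>)"
proof -
  have "0 \<le> h" using assms(2) norm_ge_zero order_trans by blast
  have "norm x \<le> norm z + h"
    using norm_triangle_ineq[of "x - z" z] assms by simp
  then have "norm x powr \<alpha> \<le> (norm z + h) powr \<alpha>"
    using assms by (intro powr_mono2) auto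
  also have "\<dots> \<le> norm z powr \<alpha> + 2 powr \<alpha> * h * (1 + norm z powr \<alpha>)"
    using assms \<open>0 \<le> h\<close> by (intro powr_shift_le) auto
  finally show ?thesis .
qed

section \<open>Uniform measures on small disks\<close>

text \<open>The uniform probability measure on the disk of radius \<open>\<delta>\<close> around 0.\<close>

definition disk_unif :: "real \<Rightarrow> complex measure" where
  "disk_unif \<delta> = uniform_measure lborel (ball 0 \<delta>)"

lemma emeasure_disk:
  "r \<ge> 0 \<Longrightarrow> emeasure lborel (ball (c::complex) r) = ennreal (pi * r\<^sup>2)"
  by (subst emeasure_ball) (simp_all add: unit_ball_vol_2)

lemma sets_disk_unif [measurable_cong, simp]: "sets (disk_unif \<delta>) = sets borel"
  by (simp add: disk_unif_def)

lemma space_disk_unif [simp]: "space (disk_unif \<delta>) = UNIV"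
  by (simp add: disk_unif_def)

lemma prob_space_disk_unif:
  assumes "\<delta> > 0"
  shows "prob_space (disk_unif \<delta>)"
  unfolding disk_unif_def using assms
  by (intro prob_space_uniform_measure) (auto simp: emeasure_disk)

lemma AE_disk_unif:
  assumes "\<delta> > 0"
  shows "AE u in disk_unif \<delta>. norm u < \<delta>"
  unfolding disk_unif_def using assms
  by (intro AE_uniform_measureI) auto

lemma emeasure_disk_unif_le:
  assumes "A \<in> sets borel" "\<delta> > 0"
  shows "emeasure (disk_unif \<delta>) A \<le> emeasure lborel A / ennreal (pi * \<delta>\<^sup>2)"
  unfolding disk_unif_def using assms
  by (subst emeasure_uniform_measure)
     (auto simp: emeasure_disk intro!: divide_right_mono_ennreal emeasure_mono)

text \<open>
  The logarithm is dominated by the number of scales \<open>\<delta> e^(-k)\<close> that exceed \<open>\<bar>y\<bar>\<close>. Integrated over a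
  disk, this bounds the logarithmic potential of the uniform measure by a geometric series.
\<close>

lemma ennreal_ln_le_suminf_indicator:
  fixes y :: complex
  assumes "\<delta> > 0" "y \<noteq> 0"
  shows "ennreal (ln (\<delta> / norm y)) \<le> (\<Sum>k. indicator (ball 0 (\<delta> * exp (- real k))) y)"
proof -
  define t where "t = ln (\<delta> / norm y)"
  define N where "N = nat \<lceil>t\<rceil>"
  have "ennreal t \<le> ennreal (real N)"
    unfolding N_def by (intro ennreal_leI) (simp add: real_nat_ceiling_ge)
  also have "\<dots> = (\<Sum>k<N. 1)" by (simp add: ennreal_of_nat_eq_real_of_nat)
  also have "\<dots> = (\<Sum>k<N. indicator (ball 0 (\<delta> * exp (- real k))) y)"
  proof (intro sum.cong refl)
    fix k assume "k \<in> {..<N}"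
    then have "real k < t" unfolding N_def by (simp add: less_ceiling_iff nat_less_iff zless_nat_eq_int_zless)
    then have "exp (real k) < \<delta> / norm y"
      unfolding t_def using assms by (metis divide_pos_pos exp_less_cancel_iff exp_ln zero_less_norm_iff)
    then have "norm y < \<delta> * exp (- real k)"
      using assms by (simp add: exp_minus field_simps)
    then show "(1::ennreal) = indicator (ball 0 (\<delta> * exp (- real k))) y" by simp
  qed
  also have "\<dots> \<le> (\<Sum>k. indicator (ball 0 (\<delta> * exp (- real k))) y)"
    by (intro sum_le_suminf) auto
  finally show ?thesis unfolding t_def .
qed

lemma nn_integral_ln_disk_unif_le:
  assumes "\<delta> > 0"
  shows "(\<integral>\<^sup>+u. (if a + u = 0 then \<infinity> else ennreal (ln (\<delta> / norm (a + u)))) \<partial>disk_unif \<delta>) \<le> 2"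
    (is "?I \<le> 2")
proof -
  have N: "AE u in disk_unif \<delta>. a + u \<noteq> 0"
  proof -
    have "emeasure (disk_unif \<delta>) {-a} \<le> emeasure lborel {-a} / ennreal (pi * \<delta>\<^sup>2)"
      using assms by (intro emeasure_disk_unif_le) auto
    also have "\<dots> = 0" by simp
    finally have "{-a} \<in> null_sets (disk_unif \<delta>)" by (auto simp: null_sets_def)
    from AE_not_in[OF this] show ?thesis by (rule eventually_mono) (auto simp: add_eq_0_iff)
  qed
  have "?I \<le> (\<integral>\<^sup>+u. (\<Sum>k. indicator (ball 0 (\<delta> * exp (- real k))) (a + u)) \<partial>disk_unif \<delta>)"
    using N by (intro nn_integral_mono_AE, eventually_elim)
      (simp add: ennreal_ln_le_suminf_indicator assms)
  also have "\<dots> = (\<Sum>k. \<integral>\<^sup>+u. indicator (ball 0 (\<delta> * exp (- real k))) (a + u) \<partial>disk_unif \<delta>)"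
  proof (intro nn_integral_suminf)
    fix k
    have "(\<lambda>u. a + u) \<in> borel_measurable (disk_unif \<delta>)" by measurable
    from measurable_compose[OF this borel_measurable_indicator[of "ball 0 (\<delta> * exp (- real k))"]]
    show "(\<lambda>u. indicator (ball 0 (\<delta> * exp (- real k))) (a + u)) \<in> borel_measurable (disk_unif \<delta>)"
      by simp
  qed
  also have "\<dots> \<le> (\<Sum>k. ennreal ((1/2) ^ k))"
  proof (intro suminf_le)
    fix k
    have "(\<integral>\<^sup>+u. indicator (ball 0 (\<delta> * exp (- real k))) (a + u) \<partial>disk_unif \<delta>) =
          (\<integral>\<^sup>+u. indicator (ball (-a) (\<delta> * exp (- real k))) u \<partial>disk_unif \<delta>)"
      by (intro nn_integral_cong) (auto simp: indicator_def dist_norm norm_minus_commute algebra_simps)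
    also have "\<dots> = emeasure (disk_unif \<delta>) (ball (-a) (\<delta> * exp (- real k)))"
      by simp
    also have "\<dots> \<le> emeasure lborel (ball (-a) (\<delta> * exp (- real k))) / ennreal (pi * \<delta>\<^sup>2)"
      using assms by (intro emeasure_disk_unif_le) auto
    also have "\<dots> = ennreal (pi * (\<delta> * exp (- real k))\<^sup>2 / (pi * \<delta>\<^sup>2))"
      using assms by (simp add: emeasure_disk divide_ennreal)
    also have "pi * (\<delta> * exp (- real k))\<^sup>2 / (pi * \<delta>\<^sup>2) = exp (-1) ^ k * exp (-1) ^ k"
      using assms by (simp add: power_mult_distrib power2_eq_square exp_of_nat_mult[symmetric])
    also have "\<dots> \<le> (1/2) ^ k * 1"
    proof (intro mult_mono power_mono)
      have "(2::real) \<le> exp 1" using exp_ge_add_one_self[of "1::real"] by simp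
      then show "exp (-1) \<le> (1/2::real)" by (simp add: exp_minus field_simps)
      show "exp (-1) ^ k \<le> (1::real)" by (intro power_le_one) auto
    qed auto
    finally show "(\<integral>\<^sup>+u. indicator (ball 0 (\<delta> * exp (- real k))) (a + u) \<partial>disk_unif \<delta>) \<le> ennreal ((1/2) ^ k)"
      by (simp add: ennreal_leI)
  qed auto
  also have "\<dots> = ennreal (\<Sum>k. (1/2) ^ k)"
    by (intro suminf_ennreal2) auto
  also have "(\<Sum>k. (1/2::real) ^ k) = 2" using suminf_geometric[of "1/2::real"] by simp
  finally show ?thesis by simp
qed

lemma trunc_kernel_commute: "trunc_kernel \<alpha> \<delta> z w = trunc_kernel \<alpha> \<delta> w z"
  by (simp add: trunc_kernel_def norm_minus_commute add.commute)

text \<open>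
  The comparison of kernels behind the smoothing estimate, for disks around \<open>x\<close> and \<open>y\<close> that replace
  unit masses at \<open>z\<close> and \<open>w\<close>. The point \<open>y + v\<close> of the second disk is kept fixed.
\<close>

lemma nn_integral_pos_kernel_disk_le:
  fixes \<alpha> \<delta> :: real and x y z w v :: complex
  assumes "\<alpha> \<ge> 1" "0 < \<delta>" "\<delta> \<le> 1 / 400"
    and "norm (x - z) \<le> 4 * \<delta>" "norm (y - w) \<le> 4 * \<delta>" "norm v < \<delta>"
  defines "\<omega> \<equiv> 2 powr \<alpha> * (5 * \<delta>)"
  shows "(\<integral>\<^sup>+u. pos_kernel \<alpha> (x + u) (y + v) \<partial>disk_unif \<delta>) \<le>
    ennreal ((1 + (2 * \<omega> + 42 / (- ln \<delta>))) * trunc_kernel \<alpha> \<delta> z w + (20 * sqrt \<delta> + \<omega>))"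
proof -
  define h where "h = trunc_kernel \<alpha> \<delta> z w"
  define a where "a = x - (y + v)"
  define k where "k = - ln (max (norm (z - w)) \<delta>)"
  define L where "L = - ln \<delta>"
  define E where "E = (norm z powr \<alpha> + norm w powr \<alpha>) / 2 + 4"
  have h: "h = k + E" by (simp add: h_def trunc_kernel_def k_def E_def)
  have "L > 0" using assms by (simp add: L_def)
  have "\<omega> \<ge> 0" using assms by (simp add: \<omega>_def)
  have hQ: "E - 4 \<le> 2 * h"
    using trunc_kernel_ge[of \<alpha> \<delta> z w] assms by (simp add: h_def E_def)
  have "h \<ge> 0" unfolding h_def using assms by (intro trunc_kernel_nonneg) auto
  interpret prob_space "disk_unif \<delta>" using assms by (intro prob_space_disk_unif)
  have AE: "AE u in disk_unif \<delta>. norm u < \<delta>" using assms by (intro AE_disk_unif)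
  have Q: "(norm (x + u) powr \<alpha> + norm (y + v) powr \<alpha>) / 2 + 4 \<le> E + \<omega> + 2 * \<omega> * h"
    if "norm u < \<delta>" for u
  proof -
    have 1: "norm (x + u) powr \<alpha> \<le> norm z powr \<alpha> + \<omega> * (1 + norm z powr \<alpha>)"
      unfolding \<omega>_def
    proof (intro powr_norm_shift_le)
      show "norm (x + u - z) \<le> 5 * \<delta>"
        using norm_triangle_ineq[of "x - z" u] assms that by (simp add: algebra_simps)
    qed (use assms in auto)
    have 2: "norm (y + v) powr \<alpha> \<le> norm w powr \<alpha> + \<omega> * (1 + norm w powr \<alpha>)"
      unfolding \<omega>_def
    proof (intro powr_norm_shift_le)
      show "norm (y + v - w) \<le> 5 * \<delta>"
        using norm_triangle_ineq[of "y - w" v] assms by (simp add: algebra_simps)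
    qed (use assms in auto)
    have "\<omega> * (E - 4) \<le> \<omega> * (2 * h)" using hQ \<open>\<omega> \<ge> 0\<close> by (intro mult_left_mono)
    with 1 2 show ?thesis by (simp add: E_def field_simps)
  qed
  have dist: "norm (a + u) \<ge> norm (z - w) - 10 * \<delta>" if "norm u < \<delta>" for u
  proof -
    have "z - w = (a + u) + ((z - x) - (w - y) + (v - u))" by (simp add: a_def)
    then have "norm (z - w) \<le> norm (a + u) + norm ((z - x) - (w - y) + (v - u))"
      by (metis norm_triangle_ineq)
    moreover have "norm ((z - x) - (w - y) + (v - u)) \<le> norm (z - x) + norm (w - y) + (norm v + norm u)"
      by (intro order_trans[OF norm_triangle_ineq] add_mono norm_triangle_ineq4)
    ultimately show ?thesis using assms that by (simp add: norm_minus_commute)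
  qed
  have g: "pos_kernel \<alpha> (x + u) (y + v) = (if a + u = 0 then \<infinity> else
     ennreal (- ln (norm (a + u)) + ((norm (x + u) powr \<alpha> + norm (y + v) powr \<alpha>) / 2 + 4)))" for u
    by (simp add: pos_kernel_def a_def algebra_simps)
  show ?thesis
  \<comment> \<open>distant points: minus the logarithm grows by at most \<open>20 \<surd>\<delta>\<close>, because all distances change by at
    most \<open>10 \<delta>\<close>\<close>
  proof (cases "norm (z - w) \<ge> sqrt \<delta>")
    case True
    define r where "r = norm (z - w)"
    have sd: "sqrt \<delta> * sqrt \<delta> = \<delta>" using assms by simp
    have sd20: "sqrt \<delta> \<le> 1 / 20" using assms real_sqrt_le_mono[of \<delta> "1/400"]
      by (simp add: real_sqrt_divide)
    have "sqrt \<delta> > 0" using assms by simp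
    have "r > 0" using True assms less_le_trans[of 0 "sqrt \<delta>" r] by (simp add: r_def)
    have "sqrt \<delta> * sqrt \<delta> \<le> r * sqrt \<delta>" using True assms by (intro mult_right_mono) (auto simp: r_def)
    then have dr: "\<delta> \<le> r * sqrt \<delta>" using sd by simp
    have "r * sqrt \<delta> \<le> r * (1/20)" using sd20 \<open>r > 0\<close> by (intro mult_left_mono) auto
    then have "\<delta> \<le> r" using dr \<open>r > 0\<close> by linarith
    then have "max r \<delta> = r" by (rule max_absorb1)
    then have k: "k = - ln r" by (simp add: k_def r_def)
    have "(\<integral>\<^sup>+u. pos_kernel \<alpha> (x + u) (y + v) \<partial>disk_unif \<delta>) \<le>
          (\<integral>\<^sup>+u. ennreal ((1 + 2 * \<omega>) * h + (20 * sqrt \<delta> + \<omega>)) \<partial>disk_unif \<delta>)"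
      using AE
    proof (intro nn_integral_mono_AE, eventually_elim)
      case (elim u)
      have "norm (a + u) \<ge> r - 10 * (r * sqrt \<delta>)"
        using dist[OF elim(2)] dr by (simp add: r_def)
      then have 1: "norm (a + u) \<ge> r * (1 - 10 * sqrt \<delta>)" by (simp add: algebra_simps)
      have 2: "1 - 10 * sqrt \<delta> > 0" using sd20 by simp
      then have pos: "norm (a + u) > 0" using 1 \<open>r > 0\<close>
        by (meson less_le_trans mult_pos_pos)
      have "ln (norm (a + u)) \<ge> ln (r * (1 - 10 * sqrt \<delta>))"
        using 1 mult_pos_pos[OF \<open>r > 0\<close> 2] by (intro ln_mono)
      also have "ln (r * (1 - 10 * sqrt \<delta>)) = ln r + ln (1 - 10 * sqrt \<delta>)"
        using 2 \<open>r > 0\<close> by (simp add: ln_mult)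
      finally have 3: "- ln (norm (a + u)) \<le> - ln r - ln (1 - 10 * sqrt \<delta>)" by simp
      have "- ln (1 - 10 * sqrt \<delta>) = ln (1 / (1 - 10 * sqrt \<delta>))" using 2 by (simp add: ln_div)
      also have "\<dots> \<le> 1 / (1 - 10 * sqrt \<delta>) - 1" using 2 by (intro ln_le_minus_one) auto
      also have "\<dots> = 10 * sqrt \<delta> / (1 - 10 * sqrt \<delta>)" using 2 by (simp add: field_simps)
      also have "\<dots> \<le> 10 * sqrt \<delta> / (1 / 2)" using sd20 \<open>sqrt \<delta> > 0\<close>
        by (intro divide_left_mono) auto
      finally have "- ln (norm (a + u)) \<le> k + 20 * sqrt \<delta>" using 3 k by simp
      then have "- ln (norm (a + u)) + ((norm (x + u) powr \<alpha> + norm (y + v) powr \<alpha>) / 2 + 4)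
        \<le> (1 + 2 * \<omega>) * h + (20 * sqrt \<delta> + \<omega>)" using Q[OF elim(2)] h by (simp add: algebra_simps)
      then show ?case using pos by (auto simp: g intro: ennreal_leI)
    qed
    also have "\<dots> = ennreal ((1 + 2 * \<omega>) * h + (20 * sqrt \<delta> + \<omega>))"
      by (simp add: emeasure_space_1[simplified])
    also have "\<dots> \<le> ennreal ((1 + (2 * \<omega> + 42 / L)) * h + (20 * sqrt \<delta> + \<omega>))"
      using \<open>h \<ge> 0\<close> \<open>L > 0\<close> by (intro ennreal_leI add_mono mult_right_mono order_refl) auto
    finally show ?thesis by (simp add: h_def L_def)
  next
    case False
    have "sqrt \<delta> \<le> 1" using assms real_sqrt_le_mono[of \<delta> 1] by simp
    then have "sqrt \<delta> * sqrt \<delta> \<le> 1 * sqrt \<delta>" using assms by (intro mult_right_mono) auto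
    then have "\<delta> \<le> sqrt \<delta>" using assms by simp
    with False have "max (norm (z - w)) \<delta> \<le> sqrt \<delta>" by simp
    moreover have "0 < max (norm (z - w)) \<delta>" using assms by (simp add: less_max_iff_disj)
    ultimately have "ln (max (norm (z - w)) \<delta>) \<le> ln (sqrt \<delta>)" by (rule ln_mono)
    also have "\<dots> = ln \<delta> / 2" using assms by (simp add: ln_sqrt)
    finally have "k \<ge> L / 2" by (simp add: k_def L_def)
    moreover have "E \<ge> 0" by (simp add: E_def)
    \<comment> \<open>close points: minus the logarithm grows by at most 21 on average, and \<open>h\<close> is at least \<open>L / 2\<close>\<close>
    ultimately have hL: "21 \<le> 42 / L * h" using \<open>L > 0\<close> h by (simp add: field_simps)
    have "(\<integral>\<^sup>+u. pos_kernel \<alpha> (x + u) (y + v) \<partial>disk_unif \<delta>) \<le>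
          (\<integral>\<^sup>+u. ennreal ((1 + 2 * \<omega>) * h + \<omega> + 19) + 
             (if a + u = 0 then \<infinity> else ennreal (ln (\<delta> / norm (a + u)))) \<partial>disk_unif \<delta>)"
      using AE
    proof (intro nn_integral_mono_AE, eventually_elim)
      case (elim u)
      show ?case
      proof (cases "a + u = 0")
        case False
        then have pos: "norm (a + u) > 0" by simp
        have "- ln (norm (a + u)) \<le> k + 19 + max 0 (ln (\<delta> / norm (a + u)))"
        proof (cases "norm (z - w) \<le> 20 * \<delta>")
          case True
          then have "max (norm (z - w)) \<delta> \<le> 20 * \<delta>" using assms by simp
          then have "ln (max (norm (z - w)) \<delta>) \<le> ln (20 * \<delta>)"
            using assms by (intro ln_mono) (simp_all add: less_max_iff_disj)
          also have "\<dots> = ln 20 + ln \<delta>" using assms by (simp add: ln_mult)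
          also have "\<dots> \<le> 19 + ln \<delta>" using ln_le_minus_one[of 20] by simp
          finally have "- ln \<delta> \<le> k + 19" by (simp add: k_def)
          moreover have "ln (\<delta> / norm (a + u)) = ln \<delta> - ln (norm (a + u))"
            using assms pos by (simp add: ln_div)
          ultimately show ?thesis by linarith
        next
          case False
          then have "norm (a + u) \<ge> norm (z - w) / 2" using dist[OF elim(2)] by simp
          then have "ln (norm (a + u)) \<ge> ln (norm (z - w) / 2)"
            using False assms by (intro ln_mono) auto
          also have "ln (norm (z - w) / 2) = ln (norm (z - w)) - ln 2"
            using False assms by (subst ln_div) auto
          finally have "- ln (norm (a + u)) \<le> - ln (norm (z - w)) + ln 2" by simp
          also have "\<dots> \<le> k + 19" using False assms ln_le_minus_one[of "2::real"]
            by (simp add: k_def max_def)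
          finally show ?thesis by linarith
        qed
        then have "- ln (norm (a + u)) + ((norm (x + u) powr \<alpha> + norm (y + v) powr \<alpha>) / 2 + 4)
          \<le> ((1 + 2 * \<omega>) * h + \<omega> + 19) + max 0 (ln (\<delta> / norm (a + u)))"
          using Q[OF elim(2)] h unfolding distrib_right by linarith
        then have "pos_kernel \<alpha> (x + u) (y + v) \<le>
           ennreal (((1 + 2 * \<omega>) * h + \<omega> + 19) + max 0 (ln (\<delta> / norm (a + u))))"
          using False by (auto simp: g intro: ennreal_leI)
        also have "\<dots> = ennreal ((1 + 2 * \<omega>) * h + \<omega> + 19) + ennreal (max 0 (ln (\<delta> / norm (a + u))))"
          using \<open>\<omega> \<ge> 0\<close> \<open>h \<ge> 0\<close> by (intro ennreal_plus) auto
        finally show ?thesis using False by (simp add: ennreal_def max.assoc[symmetric])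
      qed auto
    qed
    also have "\<dots> = ennreal ((1 + 2 * \<omega>) * h + \<omega> + 19) +
             (\<integral>\<^sup>+u. (if a + u = 0 then \<infinity> else ennreal (ln (\<delta> / norm (a + u)))) \<partial>disk_unif \<delta>)"
      by (subst nn_integral_add) (auto simp: emeasure_space_1[simplified])
    also have "\<dots> \<le> ennreal ((1 + 2 * \<omega>) * h + \<omega> + 19) + 2"
      using assms by (intro add_mono nn_integral_ln_disk_unif_le) auto
    also have "\<dots> = ennreal ((1 + 2 * \<omega>) * h + \<omega> + 21)"
      using \<open>\<omega> \<ge> 0\<close> \<open>h \<ge> 0\<close> by (subst ennreal_numeral[symmetric], subst ennreal_plus[symmetric]) auto
    also have "\<dots> \<le> ennreal ((1 + (2 * \<omega> + 42 / L)) * h + (20 * sqrt \<delta> + \<omega>))"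
    proof (rule ennreal_leI)
      have "0 \<le> 20 * sqrt \<delta>" using assms by simp
      with hL show "(1 + 2 * \<omega>) * h + \<omega> + 21 \<le> (1 + (2 * \<omega> + 42 / L)) * h + (20 * sqrt \<delta> + \<omega>)"
        unfolding distrib_right by linarith
    qed
    finally show ?thesis by (simp add: h_def L_def)
  qed
qed

lemma eventually_nn_integral_pos_kernel_disk_le:
  fixes \<alpha> \<kappa> :: real
  assumes "\<alpha> \<ge> 1" "\<kappa> > 0"
  shows "\<forall>\<^sub>F \<delta> in at_right 0. \<forall>x y z w. norm (x - z) \<le> 4 * \<delta> \<longrightarrow> norm (y - w) \<le> 4 * \<delta> \<longrightarrow>
    (\<integral>\<^sup>+v. \<integral>\<^sup>+u. pos_kernel \<alpha> (x + u) (y + v) \<partial>disk_unif \<delta> \<partial>disk_unif \<delta>)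
      \<le> ennreal ((1 + \<kappa>) * trunc_kernel \<alpha> \<delta> z w + \<kappa>)"
proof -
  have ev1: "\<forall>\<^sub>F \<delta> in at_right 0. 2 * (c * (5 * \<delta>)) + 42 / (- ln \<delta>) < \<kappa>" for c :: real
  proof (rule order_tendstoD)
    show "((\<lambda>\<delta>. 2 * (c * (5 * \<delta>)) + 42 / (- ln \<delta>)) \<longlongrightarrow> 0) (at_right 0)" by real_asymp
  qed fact
  have ev2: "\<forall>\<^sub>F \<delta> in at_right 0. 20 * sqrt \<delta> + c * (5 * \<delta>) < \<kappa>" for c :: real
  proof (rule order_tendstoD)
    show "((\<lambda>\<delta>. 20 * sqrt \<delta> + c * (5 * \<delta>)) \<longlongrightarrow> 0) (at_right 0)" by real_asymp
  qed fact
  have ev3: "\<forall>\<^sub>F \<delta> in at_right 0. (0::real) < \<delta> \<and> \<delta> < 1 / 400"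
    using eventually_at_right_real[of 0 "1 / 400 :: real"] by (auto elim: eventually_mono)
  from ev1[of "2 powr \<alpha>"] ev2[of "2 powr \<alpha>"] ev3 show ?thesis
  proof eventually_elim
    case (elim \<delta>)
    interpret prob_space "disk_unif \<delta>" using elim by (intro prob_space_disk_unif) auto
    have AE: "AE u in disk_unif \<delta>. norm u < \<delta>" using elim by (intro AE_disk_unif) auto
    show ?case
    proof (intro allI impI)
      fix x y z w :: complex
      assume xy: "norm (x - z) \<le> 4 * \<delta>" "norm (y - w) \<le> 4 * \<delta>"
      have "trunc_kernel \<alpha> \<delta> z w \<ge> 0" using assms elim by (intro trunc_kernel_nonneg) auto
      have "(\<integral>\<^sup>+v. \<integral>\<^sup>+u. pos_kernel \<alpha> (x + u) (y + v) \<partial>disk_unif \<delta> \<partial>disk_unif \<delta>)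
        \<le> (\<integral>\<^sup>+v. ennreal ((1 + \<kappa>) * trunc_kernel \<alpha> \<delta> z w + \<kappa>) \<partial>disk_unif \<delta>)"
        using AE
      proof (intro nn_integral_mono_AE, eventually_elim)
        case (elim v)
        note d = \<open>2 * (2 powr \<alpha> * (5 * \<delta>)) + 42 / (- ln \<delta>) < \<kappa>\<close> 
          \<open>20 * sqrt \<delta> + 2 powr \<alpha> * (5 * \<delta>) < \<kappa>\<close> \<open>0 < \<delta> \<and> \<delta> < 1 / 400\<close>
        have "(\<integral>\<^sup>+u. pos_kernel \<alpha> (x + u) (y + v) \<partial>disk_unif \<delta>) \<le>
          ennreal ((1 + (2 * (2 powr \<alpha> * (5 * \<delta>)) + 42 / (- ln \<delta>))) * trunc_kernel \<alpha> \<delta> z w + 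
            (20 * sqrt \<delta> + 2 powr \<alpha> * (5 * \<delta>)))"
          using assms d xy elim by (intro nn_integral_pos_kernel_disk_le) auto
        also have "\<dots> \<le> ennreal ((1 + \<kappa>) * trunc_kernel \<alpha> \<delta> z w + \<kappa>)"
          using d \<open>trunc_kernel \<alpha> \<delta> z w \<ge> 0\<close> by (intro ennreal_leI add_mono mult_right_mono) auto
        finally show ?case .
      qed
      then show "(\<integral>\<^sup>+v. \<integral>\<^sup>+u. pos_kernel \<alpha> (x + u) (y + v) \<partial>disk_unif \<delta> \<partial>disk_unif \<delta>)
        \<le> ennreal ((1 + \<kappa>) * trunc_kernel \<alpha> \<delta> z w + \<kappa>)"
        by (simp add: emeasure_space_1[simplified])
    qed
  qed
qed

section \<open>Smoothing a measure inside the complement of \<open>U\<close>\<close>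

lemma borel_measurable_cell:
  fixes q :: "int \<Rightarrow> int \<Rightarrow> complex"
  shows "(\<lambda>z::complex. q \<lfloor>Re z / \<delta>\<rfloor> \<lfloor>Im z / \<delta>\<rfloor>) \<in> borel_measurable borel"
proof -
  have [measurable]: "(\<lambda>z::complex. \<lfloor>Re z / \<delta>\<rfloor>) \<in> measurable borel (count_space UNIV)"
    "(\<lambda>z::complex. \<lfloor>Im z / \<delta>\<rfloor>) \<in> measurable borel (count_space UNIV)"
    by measurable
  have "(\<lambda>z::complex. q i \<lfloor>Im z / \<delta>\<rfloor>) \<in> borel_measurable borel" for i
    by (rule measurable_compose_countable) auto
  then show ?thesis by (rule measurable_compose_countable) auto
qed

lemma norm_diff_le_cell:
  fixes z w :: complex
  assumes "\<delta> > 0" "\<lfloor>Re z / \<delta>\<rfloor> = \<lfloor>Re w / \<delta>\<rfloor>" "\<lfloor>Im z / \<delta>\<rfloor> = \<lfloor>Im w / \<delta>\<rfloor>"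
  shows "norm (z - w) \<le> 2 * \<delta>"
proof -
  have *: "\<bar>x - y\<bar> \<le> \<delta>" if "\<lfloor>x / \<delta>\<rfloor> = \<lfloor>y / \<delta>\<rfloor>" for x y
  proof -
    have "\<bar>x / \<delta> - y / \<delta>\<bar> \<le> 1" using that by linarith
    then have "\<bar>(x - y) / \<delta>\<bar> \<le> 1" by (simp add: diff_divide_distrib)
    then show ?thesis using assms by simp
  qed
  show ?thesis
    using cmod_le[of "z - w"] *[OF assms(2)] *[OF assms(3)] by simp
qed

text \<open>
  If the disk around \<open>z\<close> meets \<open>U\<close>, it contains a boundary point of \<open>U\<close>, and there is room in the
  exterior ball at that point.
\<close>

lemma exterior_ball_shift:
  assumes "open U" "exterior_ball_condition U"
  obtains \<epsilon> where "\<epsilon> > 0"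
    "\<And>\<delta> z. 0 < \<delta> \<Longrightarrow> \<delta> < \<epsilon> \<Longrightarrow> z \<notin> U \<Longrightarrow> \<exists>x. norm (x - z) \<le> 2 * \<delta> \<and> ball x \<delta> \<subseteq> - U"
proof -
  from assms(2) obtain \<epsilon> where \<epsilon>: "\<epsilon> > 0"
    and ball: "\<And>z. z \<in> frontier U \<Longrightarrow> \<exists>\<eta>\<in>-U. ball \<eta> \<epsilon> \<subseteq> - U \<and> norm (z - \<eta>) = \<epsilon>"
    unfolding exterior_ball_condition_def by blast
  show ?thesis
  proof (rule that[OF \<epsilon>])
    fix \<delta> z assume \<delta>: "0 < \<delta>" "\<delta> < \<epsilon>" and z: "z \<notin> U"
    show "\<exists>x. norm (x - z) \<le> 2 * \<delta> \<and> ball x \<delta> \<subseteq> - U"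
    proof (cases "ball z \<delta> \<subseteq> - U")
      case True
      then show ?thesis using \<delta> by (intro exI[of _ z]) auto
    next
      case False
      then have "ball z \<delta> \<inter> U \<noteq> {}" by auto
      moreover have "z \<in> ball z \<delta> - U" using z \<delta> by simp
      ultimately have "ball z \<delta> \<inter> U \<noteq> {}" "ball z \<delta> - U \<noteq> {}" by blast+
      then obtain f where f: "f \<in> ball z \<delta>" "f \<in> frontier U"
        using connected_Int_frontier[of "ball z \<delta>" U] by auto
      from ball[OF f(2)] obtain \<eta> where \<eta>: "ball \<eta> \<epsilon> \<subseteq> - U" "norm (f - \<eta>) = \<epsilon>" by blast
      \<comment> \<open>the disk of radius \<open>\<delta>\<close> inside the exterior ball that touches it at \<open>f\<close>\<close>
      define x where "x = f + (\<delta> / \<epsilon>) *\<^sub>R (\<eta> - f)"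
      have xf: "norm (x - f) = \<delta>"
        using \<eta> \<epsilon> \<delta> by (simp add: x_def norm_minus_commute)
      have "x - \<eta> = (1 - \<delta> / \<epsilon>) *\<^sub>R (f - \<eta>)" by (simp add: x_def algebra_simps)
      then have "norm (x - \<eta>) = (1 - \<delta> / \<epsilon>) * \<epsilon>" using \<delta> \<epsilon> \<eta> by simp
      also have "\<dots> = \<epsilon> - \<delta>" using \<epsilon> by (simp add: field_simps)
      finally have "dist x \<eta> = \<epsilon> - \<delta>" by (simp add: dist_norm)
      have "ball x \<delta> \<subseteq> ball \<eta> \<epsilon>"
      proof
        fix y assume "y \<in> ball x \<delta>"
        then show "y \<in> ball \<eta> \<epsilon>"
          using dist_triangle[of \<eta> y x] \<open>dist x \<eta> = \<epsilon> - \<delta>\<close> by (simp add: dist_commute)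
      qed
      moreover have "norm (x - z) \<le> 2 * \<delta>"
        using norm_triangle_ineq[of "x - f" "f - z"] xf f(1) by (simp add: dist_norm norm_minus_commute)
      ultimately show ?thesis using \<eta> by blast
    qed
  qed
qed

text \<open>
  Choosing one centre for each cell of a square grid of mesh \<open>\<delta>\<close> makes the centre a measurable function
  of the point.
\<close>

lemma exterior_ball_cell_map:
  assumes "open U" "exterior_ball_condition U"
  shows "\<forall>\<^sub>F \<delta> in at_right 0. \<exists>p \<in> borel_measurable borel.
    \<forall>z. z \<notin> U \<longrightarrow> norm (p z - z) \<le> 4 * \<delta> \<and> ball (p z) \<delta> \<subseteq> - U"
proof -
  obtain \<epsilon> where \<epsilon>: "\<epsilon> > 0"
    "\<And>\<delta> z. 0 < \<delta> \<Longrightarrow> \<delta> < \<epsilon> \<Longrightarrow> z \<notin> U \<Longrightarrow> \<exists>x. norm (x - z) \<le> 2 * \<delta> \<and> ball x \<delta> \<subseteq> - U"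
    using exterior_ball_shift[OF assms] by blast
  have "\<exists>p \<in> borel_measurable borel.
    \<forall>z. z \<notin> U \<longrightarrow> norm (p z - z) \<le> 4 * \<delta> \<and> ball (p z) \<delta> \<subseteq> - U" if \<delta>: "0 < \<delta>" "\<delta> < \<epsilon>" for \<delta>
  proof -
    define P where "P i j x \<longleftrightarrow> ball x \<delta> \<subseteq> - U \<and>
      (\<forall>z. \<lfloor>Re z / \<delta>\<rfloor> = i \<longrightarrow> \<lfloor>Im z / \<delta>\<rfloor> = j \<longrightarrow> norm (x - z) \<le> 4 * \<delta>)" for i j x
    define q where "q i j = (SOME x. P i j x)" for i j
    define p where "p = (\<lambda>z. q \<lfloor>Re z / \<delta>\<rfloor> \<lfloor>Im z / \<delta>\<rfloor>)"
    have "P \<lfloor>Re z / \<delta>\<rfloor> \<lfloor>Im z / \<delta>\<rfloor> (p z)" if "z \<notin> U" for z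
    proof -
      obtain x where x: "norm (x - z) \<le> 2 * \<delta>" "ball x \<delta> \<subseteq> - U" using \<epsilon>(2)[OF \<delta> \<open>z \<notin> U\<close>] by blast
      have "norm (x - w) \<le> 4 * \<delta>" if "\<lfloor>Re w / \<delta>\<rfloor> = \<lfloor>Re z / \<delta>\<rfloor>" "\<lfloor>Im w / \<delta>\<rfloor> = \<lfloor>Im z / \<delta>\<rfloor>" for w
        using norm_triangle_ineq[of "x - z" "z - w"] x norm_diff_le_cell[OF \<delta>(1), of z w] that by simp
      with x have "P \<lfloor>Re z / \<delta>\<rfloor> \<lfloor>Im z / \<delta>\<rfloor> x" unfolding P_def by blast
      then show ?thesis unfolding p_def q_def by (rule someI)
    qed
    then show ?thesis unfolding P_def p_def
      by (intro bexI[of _ p] borel_measurable_cell) (auto simp: p_def borel_measurable_cell)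
  qed
  then show ?thesis
    using eventually_at_right_real[OF \<epsilon>(1)] by (auto elim!: eventually_mono)
qed

text \<open>
  The weighted logarithmic energy shifted by 4, with values in \<open>[0, \<infinity>]\<close>; see \<open>energy_eq_pos_energy\<close>.
\<close>

definition pos_energy :: "real \<Rightarrow> complex measure \<Rightarrow> ennreal" where
  "pos_energy \<alpha> \<mu> = (\<integral>\<^sup>+z. \<integral>\<^sup>+w. pos_kernel \<alpha> z w \<partial>\<mu> \<partial>\<mu>)"

text \<open>
  The distribution of \<open>p z + u\<close>, where \<open>z\<close> has distribution \<open>\<mu>\<close> and \<open>u\<close> is independent and uniform on
  the disk of radius \<open>\<delta>\<close> around 0.
\<close>

definition smear :: "(complex \<Rightarrow> complex) \<Rightarrow> real \<Rightarrow> complex measure \<Rightarrow> complex measure" where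
  "smear p \<delta> \<mu> = distr (\<mu> \<Otimes>\<^sub>M disk_unif \<delta>) borel (\<lambda>(z, u). p z + u)"

context
  fixes p :: "complex \<Rightarrow> complex" and \<delta> :: real and \<mu> :: "complex measure"
  assumes p [measurable]: "p \<in> borel_measurable borel"
    and \<delta>: "\<delta> > 0"
    and prob: "prob_space \<mu>" and sets_mu [simp, measurable_cong]: "sets \<mu> = sets borel"
begin

interpretation M: prob_space \<mu> by (rule prob)
interpretation D: prob_space "disk_unif \<delta>" using \<delta> by (rule prob_space_disk_unif)
interpretation P: pair_prob_space \<mu> "disk_unif \<delta>" ..

lemma sets_smear [simp, measurable_cong]: "sets (smear p \<delta> \<mu>) = sets borel"
  by (simp add: smear_def)

lemma prob_space_smear: "prob_space (smear p \<delta> \<mu>)"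
  unfolding smear_def by (rule P.prob_space_distr) measurable

lemma nn_integral_smear:
  assumes [measurable]: "f \<in> borel_measurable borel"
  shows "(\<integral>\<^sup>+x. f x \<partial>smear p \<delta> \<mu>) = (\<integral>\<^sup>+z. \<integral>\<^sup>+u. f (p z + u) \<partial>disk_unif \<delta> \<partial>\<mu>)"
proof -
  have "(\<integral>\<^sup>+x. f x \<partial>smear p \<delta> \<mu>) = (\<integral>\<^sup>+x. f (p (fst x) + snd x) \<partial>(\<mu> \<Otimes>\<^sub>M disk_unif \<delta>))"
    unfolding smear_def by (subst nn_integral_distr) (simp_all add: case_prod_beta)
  also have "\<dots> = (\<integral>\<^sup>+z. \<integral>\<^sup>+u. f (p z + u) \<partial>disk_unif \<delta> \<partial>\<mu>)"
    by (subst D.nn_integral_fst[symmetric]) simp_all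
  finally show ?thesis .
qed

lemma nn_integral_smear_le:
  assumes [measurable]: "f \<in> borel_measurable borel"
  shows "(\<integral>\<^sup>+x. f x \<partial>smear p \<delta> \<mu>) \<le> ennreal (1 / (pi * \<delta>\<^sup>2)) * (\<integral>\<^sup>+x. f x \<partial>lborel)"
proof -
  have "(\<integral>\<^sup>+u. f (x + u) \<partial>disk_unif \<delta>) \<le> (\<integral>\<^sup>+x. f x \<partial>lborel) / ennreal (pi * \<delta>\<^sup>2)" for x
  proof -
    have "(\<integral>\<^sup>+u. f (x + u) \<partial>disk_unif \<delta>)
        = (\<integral>\<^sup>+u. f (x + u) * indicator (ball 0 \<delta>) u \<partial>lborel) / ennreal (pi * \<delta>\<^sup>2)"
      using \<delta> unfolding disk_unif_def by (subst nn_integral_uniform_measure) (auto simp: emeasure_disk)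
    also have "\<dots> \<le> (\<integral>\<^sup>+u. f (x + u) \<partial>lborel) / ennreal (pi * \<delta>\<^sup>2)"
      by (intro divide_right_mono_ennreal nn_integral_mono) (auto simp: indicator_def)
    also have "(\<integral>\<^sup>+u. f (x + u) \<partial>lborel) = (\<integral>\<^sup>+u. f u \<partial>lborel)"
      by (subst lborel_distr_plus[of x, symmetric]) (simp add: nn_integral_distr)
    finally show ?thesis .
  qed
  then have "(\<integral>\<^sup>+x. f x \<partial>smear p \<delta> \<mu>) \<le> (\<integral>\<^sup>+z. (\<integral>\<^sup>+x. f x \<partial>lborel) / ennreal (pi * \<delta>\<^sup>2) \<partial>\<mu>)"
    unfolding nn_integral_smear[OF assms] by (intro nn_integral_mono)
  also have "\<dots> = (\<integral>\<^sup>+x. f x \<partial>lborel) / ennreal (pi * \<delta>\<^sup>2)"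
    by (simp add: M.emeasure_space_1)
  also have "\<dots> = ennreal (1 / (pi * \<delta>\<^sup>2)) * (\<integral>\<^sup>+x. f x \<partial>lborel)"
    using \<delta> by (simp add: divide_ennreal_def inverse_ennreal mult.commute divide_inverse)
  finally show ?thesis .
qed

lemma AE_smear:
  assumes "AE z in \<mu>. P z" "Measurable.pred borel Q"
    and "\<And>z u. P z \<Longrightarrow> norm u < \<delta> \<Longrightarrow> Q (p z + u)"
  shows "AE x in smear p \<delta> \<mu>. Q x"
proof -
  have [measurable]: "Measurable.pred borel Q" by fact
  have "AE z in \<mu>. AE u in disk_unif \<delta>. Q (p z + u)"
    using assms(1) by eventually_elim (use AE_disk_unif[OF \<delta>] assms(3) in \<open>auto elim: eventually_mono\<close>)
  moreover have "{x \<in> space (\<mu> \<Otimes>\<^sub>M disk_unif \<delta>). Q (p (fst x) + snd x)} \<in> sets (\<mu> \<Otimes>\<^sub>M disk_unif \<delta>)"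
    by measurable
  ultimately have "AE x in \<mu> \<Otimes>\<^sub>M disk_unif \<delta>. Q (p (fst x) + snd x)"
    by (simp only: P.AE_pair_iff[of "\<lambda>z u. Q (p z + u)"])
  then show ?thesis
    unfolding smear_def by (subst AE_distr_iff) (auto simp: case_prod_beta pred_def[symmetric])
qed

lemma pos_energy_smear_le:
  assumes \<kappa>: "\<And>x y z w. norm (x - z) \<le> 4 * \<delta> \<Longrightarrow> norm (y - w) \<le> 4 * \<delta> \<Longrightarrow>
    (\<integral>\<^sup>+v. \<integral>\<^sup>+u. pos_kernel \<alpha> (x + u) (y + v) \<partial>disk_unif \<delta> \<partial>disk_unif \<delta>)
      \<le> ennreal ((1 + \<kappa>) * trunc_kernel \<alpha> \<delta> z w + \<kappa>)"
    and pz: "AE z in \<mu>. norm (p z - z) \<le> 4 * \<delta>"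
    and "\<kappa> > 0" "\<delta> \<le> 1" "\<alpha> \<ge> 1"
  shows "pos_energy \<alpha> (smear p \<delta> \<mu>) \<le> ennreal (1 + \<kappa>) * (\<integral>\<^sup>+z. \<integral>\<^sup>+w. ennreal (trunc_kernel \<alpha> \<delta> z w) \<partial>\<mu> \<partial>\<mu>) + ennreal \<kappa>"
proof -
  interpret S: prob_space "smear p \<delta> \<mu>" by (rule prob_space_smear)
  interpret DM: pair_sigma_finite "disk_unif \<delta>" \<mu> ..
  have [measurable]: "(\<lambda>x. pos_kernel \<alpha> x y) \<in> borel_measurable borel"
    "(\<lambda>y. pos_kernel \<alpha> x y) \<in> borel_measurable borel" for x y
    by measurable
  have "pos_energy \<alpha> (smear p \<delta> \<mu>) =
      (\<integral>\<^sup>+z. \<integral>\<^sup>+u. \<integral>\<^sup>+y. pos_kernel \<alpha> (p z + u) y \<partial>smear p \<delta> \<mu> \<partial>disk_unif \<delta> \<partial>\<mu>)"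
    unfolding pos_energy_def by (subst nn_integral_smear) (simp_all)
  also have "\<dots> = (\<integral>\<^sup>+z. \<integral>\<^sup>+u. \<integral>\<^sup>+w. \<integral>\<^sup>+v. pos_kernel \<alpha> (p z + u) (p w + v) \<partial>disk_unif \<delta> \<partial>\<mu> \<partial>disk_unif \<delta> \<partial>\<mu>)"
    by (intro nn_integral_cong nn_integral_smear) simp
  also have "\<dots> = (\<integral>\<^sup>+z. \<integral>\<^sup>+w. \<integral>\<^sup>+u. \<integral>\<^sup>+v. pos_kernel \<alpha> (p z + u) (p w + v) \<partial>disk_unif \<delta> \<partial>disk_unif \<delta> \<partial>\<mu> \<partial>\<mu>)"
    by (intro nn_integral_cong DM.Fubini'[symmetric]) measurable
  also have "\<dots> \<le> (\<integral>\<^sup>+z. \<integral>\<^sup>+w. ennreal ((1 + \<kappa>) * trunc_kernel \<alpha> \<delta> z w + \<kappa>) \<partial>\<mu> \<partial>\<mu>)"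
    using pz
  proof (intro nn_integral_mono_AE, eventually_elim)
    case (elim z)
    from pz show ?case
    proof (intro nn_integral_mono_AE, eventually_elim)
      case (elim w)
      show ?case
        using \<kappa>[of "p w" w "p z" z] elim \<open>cmod (p z - z) \<le> 4 * \<delta>\<close>
        by (simp add: pos_kernel_commute trunc_kernel_commute)
    qed
  qed
  also have "\<dots> = (\<integral>\<^sup>+z. \<integral>\<^sup>+w. ennreal (1 + \<kappa>) * ennreal (trunc_kernel \<alpha> \<delta> z w) + ennreal \<kappa> \<partial>\<mu> \<partial>\<mu>)"
    using trunc_kernel_nonneg[of \<alpha> \<delta>] assms(3-) \<delta>
    by (intro nn_integral_cong, subst ennreal_plus) (simp_all add: ennreal_mult)
  also have "\<dots> = ennreal (1 + \<kappa>) * (\<integral>\<^sup>+z. \<integral>\<^sup>+w. ennreal (trunc_kernel \<alpha> \<delta> z w) \<partial>\<mu> \<partial>\<mu>) + ennreal \<kappa>"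
    by (simp add: nn_integral_add nn_integral_cmult M.emeasure_space_1)
  finally show ?thesis .
qed

end

lemma compact_probsI:
  assumes "prob_space \<nu>" "sets \<nu> = sets borel" "AE z in \<nu>. z \<in> F" "closed F"
    and "AE z in \<nu>. norm z \<le> \<rho>"
  shows "\<nu> \<in> compact_probs F"
proof -
  have *: "supp \<nu> \<subseteq> C" if C: "closed C" "AE z in \<nu>. z \<in> C" for C
  proof
    fix z assume z: "z \<in> supp \<nu>"
    show "z \<in> C"
    proof (rule ccontr)
      assume "z \<notin> C"
      then have "emeasure \<nu> (- C) > 0" using z C by (auto simp: supp_def)
      moreover have "- C \<in> sets \<nu>" using C assms(2) by auto
      moreover have "{x \<in> space \<nu>. x \<notin> C} = - C"
        using sets_eq_imp_space_eq[OF assms(2)] by auto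
      ultimately show False using AE_iff_measurable[of "- C" \<nu> "\<lambda>z. z \<in> C"] C(2) by simp
    qed
  qed
  have "closed (supp \<nu>)"
  proof -
    have "- supp \<nu> = \<Union>{V. open V \<and> emeasure \<nu> V = 0}" by (auto simp: supp_def)
    then have "open (- supp \<nu>)" by auto
    then show ?thesis by (simp add: closed_def)
  qed
  moreover have "bounded (supp \<nu>)"
    using *[of "cball 0 \<rho>"] assms(5) by (intro bounded_subset[OF bounded_cball]) auto
  ultimately show ?thesis
    unfolding compact_probs_def using assms *[of F] by (auto simp: compact_eq_bounded_closed)
qed

text \<open>
  The complement of the support is a null set because it is a countable union of open null sets.
\<close>

lemma compact_probsE:
  assumes "\<mu> \<in> compact_probs F"
  obtains \<rho> where "\<rho> > 0" "prob_space \<mu>" "sets \<mu> = sets borel" "AE z in \<mu>. z \<in> F" "AE z in \<mu>. norm z \<le> \<rho>"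
proof -
  have [measurable_cong]: "sets \<mu> = sets borel" and "prob_space \<mu>" and c: "compact (supp \<mu>)" and "supp \<mu> \<subseteq> F"
    using assms by (auto simp: compact_probs_def)
  define N where "N = {V. open V \<and> emeasure \<mu> V = 0}"
  obtain N' where N': "N' \<subseteq> N" "countable N'" "\<Union>N' = \<Union>N"
    using Lindelof[of N] by (auto simp: N_def)
  have "(\<Union>V\<in>N'. V) \<in> null_sets \<mu>"
    using N' by (intro null_sets_UN') (auto simp: N_def null_sets_def \<open>sets \<mu> = sets borel\<close>)
  then have "\<Union>N' \<in> null_sets \<mu>" by simp
  moreover have "\<Union>N = - supp \<mu>" by (auto simp: N_def supp_def)
  ultimately have "- supp \<mu> \<in> null_sets \<mu>" using N'(3) by simp
  from AE_not_in[OF this] have AE: "AE z in \<mu>. z \<in> supp \<mu>" by simp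
  from c obtain \<rho> where \<rho>: "\<rho> > 0" "\<And>z. z \<in> supp \<mu> \<Longrightarrow> norm z \<le> \<rho>"
    by (meson bounded_pos compact_imp_bounded)
  show ?thesis
    using AE \<open>supp \<mu> \<subseteq> F\<close> by (intro that[OF \<rho>(1)] \<open>prob_space \<mu>\<close> \<open>sets \<mu> = sets borel\<close>)
      (auto elim!: eventually_mono intro: \<rho>(2))
qed

text \<open>
  The smoothing estimate. The radius \<open>\<delta>\<close> and the bound \<open>D\<close> on the density do not depend on \<open>\<mu>\<close>, and
  \<open>\<mu>\<close> need not have finite energy.
\<close>

lemma smoothing:
  assumes "\<alpha> \<ge> 1" "open U" "exterior_ball_condition U" "\<kappa> > 0"
  obtains \<delta> D :: real where "0 < \<delta>" "\<delta> \<le> 1" "0 < D"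
    "\<And>\<mu> \<rho>. prob_space \<mu> \<Longrightarrow> sets \<mu> = sets borel \<Longrightarrow> AE z in \<mu>. z \<in> - U \<Longrightarrow> AE z in \<mu>. norm z \<le> \<rho> \<Longrightarrow>
       \<exists>\<nu> \<in> compact_probs (- U).
         pos_energy \<alpha> \<nu> \<le> ennreal (1 + \<kappa>) * (\<integral>\<^sup>+z. \<integral>\<^sup>+w. ennreal (trunc_kernel \<alpha> \<delta> z w) \<partial>\<mu> \<partial>\<mu>) + ennreal \<kappa> \<and>
         (\<forall>f\<in>borel_measurable borel. (\<integral>\<^sup>+x. f x \<partial>\<nu>) \<le> ennreal D * (\<integral>\<^sup>+x. f x \<partial>lborel))"
proof -
  have "\<forall>\<^sub>F \<delta> in at_right 0. (0::real) < \<delta> \<and> \<delta> < 1"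
    using eventually_at_right_real[of 0 "1 :: real"] by (auto elim: eventually_mono)
  with eventually_nn_integral_pos_kernel_disk_le[OF assms(1,4)] exterior_ball_cell_map[OF assms(2,3)]
  have "\<forall>\<^sub>F \<delta> in at_right 0. (0 < \<delta> \<and> \<delta> < 1) \<and>
    (\<forall>x y z w. norm (x - z) \<le> 4 * \<delta> \<longrightarrow> norm (y - w) \<le> 4 * \<delta> \<longrightarrow>
    (\<integral>\<^sup>+v. \<integral>\<^sup>+u. pos_kernel \<alpha> (x + u) (y + v) \<partial>disk_unif \<delta> \<partial>disk_unif \<delta>)
      \<le> ennreal ((1 + \<kappa>) * trunc_kernel \<alpha> \<delta> z w + \<kappa>)) \<and>
    (\<exists>p \<in> borel_measurable borel.
    \<forall>z. z \<notin> U \<longrightarrow> norm (p z - z) \<le> 4 * \<delta> \<and> ball (p z) \<delta> \<subseteq> - U)"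
    by eventually_elim blast
  then have "\<exists>\<delta>. (0 < \<delta> \<and> \<delta> < 1) \<and>
    (\<forall>x y z w. norm (x - z) \<le> 4 * \<delta> \<longrightarrow> norm (y - w) \<le> 4 * \<delta> \<longrightarrow>
    (\<integral>\<^sup>+v. \<integral>\<^sup>+u. pos_kernel \<alpha> (x + u) (y + v) \<partial>disk_unif \<delta> \<partial>disk_unif \<delta>)
      \<le> ennreal ((1 + \<kappa>) * trunc_kernel \<alpha> \<delta> z w + \<kappa>)) \<and>
    (\<exists>p \<in> borel_measurable borel.
    \<forall>z. z \<notin> U \<longrightarrow> norm (p z - z) \<le> 4 * \<delta> \<and> ball (p z) \<delta> \<subseteq> - U)"
    by (rule eventually_happens'[OF trivial_limit_at_right_real])
  then obtain \<delta> p where \<delta>: "0 < \<delta>" "\<delta> < 1"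
    and g: "\<And>x y z w. norm (x - z) \<le> 4 * \<delta> \<Longrightarrow> norm (y - w) \<le> 4 * \<delta> \<Longrightarrow>
    (\<integral>\<^sup>+v. \<integral>\<^sup>+u. pos_kernel \<alpha> (x + u) (y + v) \<partial>disk_unif \<delta> \<partial>disk_unif \<delta>)
      \<le> ennreal ((1 + \<kappa>) * trunc_kernel \<alpha> \<delta> z w + \<kappa>)"
    and p: "p \<in> borel_measurable borel" 
    and p': "\<And>z. z \<notin> U \<Longrightarrow> norm (p z - z) \<le> 4 * \<delta>" "\<And>z. z \<notin> U \<Longrightarrow> ball (p z) \<delta> \<subseteq> - U"
    by blast
  show ?thesis
  proof (rule that[of \<delta> "1 / (pi * \<delta>\<^sup>2)"], goal_cases)
    case (4 \<mu> \<rho>)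
    note \<mu> = p \<delta>(1) 4(1,2)
    have "open U" by fact
    show ?case
    proof (intro bexI[of _ "smear p \<delta> \<mu>"] conjI ballI)
      show "pos_energy \<alpha> (smear p \<delta> \<mu>) \<le> ennreal (1 + \<kappa>) * (\<integral>\<^sup>+z. \<integral>\<^sup>+w. ennreal (trunc_kernel \<alpha> \<delta> z w) \<partial>\<mu> \<partial>\<mu>) + ennreal \<kappa>"
        using 4(3) p' \<delta> assms by (intro pos_energy_smear_le[OF \<mu>] g) (auto elim!: eventually_mono)
      show "(\<integral>\<^sup>+x. f x \<partial>smear p \<delta> \<mu>) \<le> ennreal (1 / (pi * \<delta>\<^sup>2)) * (\<integral>\<^sup>+x. f x \<partial>lborel)"
        if "f \<in> borel_measurable borel" for f using that by (rule nn_integral_smear_le[OF \<mu>])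
      have AE: "AE z in \<mu>. z \<in> - U \<and> norm z \<le> \<rho>" using 4(3,4) by eventually_elim auto
      show "smear p \<delta> \<mu> \<in> compact_probs (- U)"
      proof (rule compact_probsI)
        show "prob_space (smear p \<delta> \<mu>)" by (rule prob_space_smear[OF \<mu>])
        show "sets (smear p \<delta> \<mu>) = sets borel" by (rule sets_smear[OF \<mu>])
        show "closed (- U)" using \<open>open U\<close> by auto
        show "AE z in smear p \<delta> \<mu>. z \<in> - U"
        proof (rule AE_smear[OF \<mu> AE])
          have [measurable]: "U \<in> sets borel" using \<open>open U\<close> by simp
          show "Measurable.pred borel (\<lambda>a. a \<in> - U)" by simp
          fix z u :: complex assume "z \<in> - U \<and> norm z \<le> \<rho>" "norm u < \<delta>"
          then show "p z + u \<in> - U" using p'(2)[of z] by (auto simp: dist_norm subset_iff)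
        qed
        show "AE z in smear p \<delta> \<mu>. norm z \<le> \<rho> + 5"
        proof (rule AE_smear[OF \<mu> AE])
          show "Measurable.pred borel (\<lambda>z::complex. norm z \<le> \<rho> + 5)" by measurable
          fix z u :: complex assume *: "z \<in> - U \<and> norm z \<le> \<rho>" "norm u < \<delta>"
          have "norm (p z + u) \<le> norm (p z - z) + norm z + norm u"
            using norm_triangle_ineq[of "p z" u] norm_triangle_ineq[of "p z - z" z] by simp
          then show "norm (p z + u) \<le> \<rho> + 5" using * p'(1)[of z] \<delta> by auto
        qed
      qed
    qed
  qed (use \<delta> in auto)
qed

section \<open>Configurations of \<open>n\<close> points\<close>

text \<open>
  The density of the rescaled process, up to normalization.
\<close>

definition weight :: "real \<Rightarrow> nat \<Rightarrow> (nat \<Rightarrow> complex) \<Rightarrow> real" where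
  "weight \<alpha> n w = (\<Prod>i<n. \<Prod>j<i. (norm (w i - w j))\<^sup>2) * exp (- (real n * (\<Sum>i<n. norm (w i) powr \<alpha>)))"

text \<open>
  The partition function of \<open>n\<close> points confined to the complement of \<open>U\<close>.
\<close>

definition partfun :: "real \<Rightarrow> nat \<Rightarrow> complex set \<Rightarrow> ennreal" where
  "partfun \<alpha> n U = (\<integral>\<^sup>+w\<in>({..<n} \<rightarrow>\<^sub>E - U). ennreal (weight \<alpha> n w) \<partial>(\<Pi>\<^sub>M i\<in>{..<n}. lborel))"

text \<open>
  The discrete counterpart of the shifted energy: off-diagonal terms are values of the kernel, and the
  diagonal terms are those of the kernel without the logarithm. With this choice the weight is
  \<open>e^(4 n^2)\<close> times the exponential of minus the energy (\<open>weight_eq_exp\<close>). The value is meaningful only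
  for pairwise distinct points.
\<close>

definition conf_energy :: "real \<Rightarrow> nat \<Rightarrow> (nat \<Rightarrow> complex) \<Rightarrow> real" where
  "conf_energy \<alpha> n w =
     (\<Sum>i<n. (\<Sum>j\<in>{..<n}-{i}. - ln (norm (w i - w j)) + (norm (w i) powr \<alpha> + norm (w j) powr \<alpha>) / 2 + 4)
       + (norm (w i) powr \<alpha> + 4))"

lemma prod_lower_triangle_square:
  fixes f :: "nat \<Rightarrow> nat \<Rightarrow> 'b :: comm_monoid_mult"
  assumes "\<And>i j. f i j = f j i"
  shows "(\<Prod>i<n. \<Prod>j<i. f i j * f i j) = (\<Prod>i<n. \<Prod>j\<in>{..<n}-{i}. f i j)"
proof (induction n)
  case (Suc n)
  have 1: "(\<Prod>j\<in>{..<Suc n}-{n}. f n j) = (\<Prod>j<n. f n j)"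
    by (rule prod.cong) auto
  have 2: "(\<Prod>i<n. \<Prod>j\<in>{..<Suc n}-{i}. f i j) = (\<Prod>i<n. f n i * (\<Prod>j\<in>{..<n}-{i}. f i j))"
  proof (intro prod.cong refl)
    fix i assume "i \<in> {..<n}"
    then have "{..<Suc n}-{i} = insert n ({..<n}-{i})" by auto
    then show "(\<Prod>j\<in>{..<Suc n}-{i}. f i j) = f n i * (\<Prod>j\<in>{..<n}-{i}. f i j)"
      using assms[of i n] by simp
  qed
  have "(\<Prod>i<Suc n. \<Prod>j<i. f i j * f i j) = (\<Prod>i<n. \<Prod>j\<in>{..<n}-{i}. f i j) * (\<Prod>j<n. f n j * f n j)"
    by (simp add: Suc)
  also have "\<dots> = (\<Prod>i<Suc n. \<Prod>j\<in>{..<Suc n}-{i}. f i j)"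
    by (simp add: 1 2 prod.distrib mult_ac)
  finally show ?case .
qed simp

lemma sum_off_diagonal_pair:
  fixes f :: "nat \<Rightarrow> real"
  shows "(\<Sum>i<n. \<Sum>j\<in>{..<n}-{i}. f i + f j) = 2 * (real n - 1) * (\<Sum>i<n. f i)"
proof -
  have "(\<Sum>j\<in>{..<n}-{i}. f i + f j) = (\<Sum>j<n. f i + f j) - (f i + f i)" if "i < n" for i
    using that by (subst sum_diff1) auto
  then have "(\<Sum>i<n. \<Sum>j\<in>{..<n}-{i}. f i + f j) = (\<Sum>i<n. (\<Sum>j<n. f i + f j) - (f i + f i))"
    by (intro sum.cong) auto
  also have "\<dots> = 2 * (real n - 1) * (\<Sum>i<n. f i)"
    by (simp add: sum.distrib sum_subtractf sum_distrib_left[symmetric] sum_distrib_right[symmetric]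
      left_diff_distrib right_diff_distrib)
  finally show ?thesis .
qed

lemma weight_eq_exp:
  assumes "inj_on w {..<n}"
  shows "weight \<alpha> n w = exp (4 * (real n)\<^sup>2 - conf_energy \<alpha> n w)"
proof -
  define P where "P = (\<Sum>i<n. \<Sum>j\<in>{..<n}-{i}. ln (norm (w i - w j)))"
  have "(\<Prod>i<n. \<Prod>j<i. (norm (w i - w j))\<^sup>2) = (\<Prod>i<n. \<Prod>j\<in>{..<n}-{i}. norm (w i - w j))"
    unfolding power2_eq_square by (rule prod_lower_triangle_square) (rule norm_minus_commute)
  also have "\<dots> = (\<Prod>i<n. \<Prod>j\<in>{..<n}-{i}. exp (ln (norm (w i - w j))))"
  proof (intro prod.cong refl)
    fix i j assume "i \<in> {..<n}" "j \<in> {..<n}-{i}"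
    then have "w i \<noteq> w j" using assms by (auto simp: inj_on_def)
    then show "norm (w i - w j) = exp (ln (norm (w i - w j)))" by simp
  qed
  also have "\<dots> = exp P" by (simp add: P_def exp_sum)
  finally have 1: "(\<Prod>i<n. \<Prod>j<i. (norm (w i - w j))\<^sup>2) = exp P" .
  have "conf_energy \<alpha> n w = - P +
     (\<Sum>i<n. \<Sum>j\<in>{..<n}-{i}. norm (w i) powr \<alpha> / 2 + norm (w j) powr \<alpha> / 2) +
     (\<Sum>i<n. \<Sum>j\<in>{..<n}-{i}. 4) + (\<Sum>i<n. norm (w i) powr \<alpha>) + 4 * real n"
    unfolding conf_energy_def P_def
    by (simp add: sum.distrib sum_negf add_divide_distrib sum_subtractf right_diff_distrib)
  also have "(\<Sum>i<n. \<Sum>j\<in>{..<n}-{i}. 4::real) = (\<Sum>i<n. 4 * (real n - 1))"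
    by (intro sum.cong refl) (simp add: of_nat_diff Suc_le_eq)
  also have "\<dots> = 4 * (real n)\<^sup>2 - 4 * real n"
    unfolding sum_constant card_lessThan power2_eq_square by (simp add: right_diff_distrib)
  also have "(\<Sum>i<n. \<Sum>j\<in>{..<n}-{i}. norm (w i) powr \<alpha> / 2 + norm (w j) powr \<alpha> / 2) =
     (real n - 1) * (\<Sum>i<n. norm (w i) powr \<alpha>)"
    by (subst sum_off_diagonal_pair) (simp add: sum_divide_distrib[symmetric])
  finally have "conf_energy \<alpha> n w = - P + real n * (\<Sum>i<n. norm (w i) powr \<alpha>) + 4 * (real n)\<^sup>2"
    by (simp add: algebra_simps)
  then show ?thesis unfolding weight_def 1 by (simp add: exp_add[symmetric])
qed

lemma weight_eq_0:
  assumes "\<not> inj_on w {..<n}"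
  shows "weight \<alpha> n w = 0"
proof -
  from assms obtain i j where "i < n" "j < i" "w i = w j"
    unfolding inj_on_def by (metis lessThan_iff linorder_neqE_nat)
  then have "(\<Prod>j<i. (norm (w i - w j))\<^sup>2) = 0" by auto
  then have "(\<Prod>i<n. \<Prod>j<i. (norm (w i - w j))\<^sup>2) = 0"
    using \<open>i < n\<close> by (intro prod_zero) auto
  then show ?thesis by (simp add: weight_def)
qed

lemma weight_nonneg: "weight \<alpha> n w \<ge> 0"
  unfolding weight_def by (intro mult_nonneg_nonneg prod_nonneg ballI) auto

lemma measurable_weight [measurable]:
  "weight \<alpha> n \<in> borel_measurable (\<Pi>\<^sub>M i\<in>{..<n}. borel)"
proof -
  have [measurable]: "(\<lambda>w. \<Prod>j<i. (norm (w i - w j))\<^sup>2) \<in> borel_measurable (\<Pi>\<^sub>M i\<in>{..<n}. (borel :: complex measure))"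
    if "i < n" for i
    using that by (intro borel_measurable_prod) simp
  have "(\<lambda>w. \<Prod>i<n. \<Prod>j<i. (norm (w i - w j))\<^sup>2) \<in> borel_measurable (\<Pi>\<^sub>M i\<in>{..<n}. (borel :: complex measure))"
    by (intro borel_measurable_prod) simp
  then show ?thesis unfolding weight_def by measurable
qed

lemma conf_energy_ge:
  assumes "\<alpha> \<ge> 1" "inj_on w {..<n}"
  shows "conf_energy \<alpha> n w \<ge> real n / 2 * (\<Sum>i<n. norm (w i) powr \<alpha>)"
proof -
  have "(\<Sum>i<n. (\<Sum>j\<in>{..<n}-{i}. norm (w i) powr \<alpha> / 4 + norm (w j) powr \<alpha> / 4) + norm (w i) powr \<alpha>)
      \<le> conf_energy \<alpha> n w"
    unfolding conf_energy_def
  proof (rule sum_mono, rule add_mono, rule sum_mono)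
    fix i j assume "i \<in> {..<n}" "j \<in> {..<n}-{i}"
    then have "w i \<noteq> w j" using assms by (auto simp: inj_on_def)
    from pos_kernel_real_ge[OF assms(1) this]
    show "norm (w i) powr \<alpha> / 4 + norm (w j) powr \<alpha> / 4
       \<le> - ln (norm (w i - w j)) + (norm (w i) powr \<alpha> + norm (w j) powr \<alpha>) / 2 + 4"
      by (simp add: add_divide_distrib)
  qed auto
  also have "(\<Sum>i<n. (\<Sum>j\<in>{..<n}-{i}. norm (w i) powr \<alpha> / 4 + norm (w j) powr \<alpha> / 4) + norm (w i) powr \<alpha>)
     = (real n + 1) / 2 * (\<Sum>i<n. norm (w i) powr \<alpha>)"
    by (subst sum.distrib, subst sum_off_diagonal_pair) (simp add: sum_divide_distrib[symmetric] field_simps)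
  finally have *: "(real n + 1) / 2 * (\<Sum>i<n. norm (w i) powr \<alpha>) \<le> conf_energy \<alpha> n w" .
  have "real n / 2 * (\<Sum>i<n. norm (w i) powr \<alpha>) \<le> (real n + 1) / 2 * (\<Sum>i<n. norm (w i) powr \<alpha>)"
    by (intro mult_right_mono sum_nonneg) auto
  with * show ?thesis by linarith
qed

section \<open>Upper bound for the partition functions\<close>

text \<open>
  The smoothing lemma applied to the empirical measure of a configuration.
\<close>

lemma conf_energy_lower_bound:
  assumes "\<alpha> \<ge> 1" "open U" "exterior_ball_condition U" "\<kappa> > 0"
    and \<gamma>: "\<And>\<nu>. \<nu> \<in> compact_probs (- U) \<Longrightarrow> ennreal \<gamma> \<le> pos_energy \<alpha> \<nu>"
  obtains L where "\<And>n w. n \<ge> 1 \<Longrightarrow> w ` {..<n} \<subseteq> - U \<Longrightarrow> inj_on w {..<n} \<Longrightarrow>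
     conf_energy \<alpha> n w \<ge> (real n)\<^sup>2 * ((\<gamma> - \<kappa>) / (1 + \<kappa>)) - real n * L"
proof -
  obtain \<delta> D :: real where \<delta>: "0 < \<delta>" "\<delta> \<le> 1"
    and sm: "\<And>\<mu> \<rho>. prob_space \<mu> \<Longrightarrow> sets \<mu> = sets borel \<Longrightarrow> AE z in \<mu>. z \<in> - U \<Longrightarrow> AE z in \<mu>. norm z \<le> \<rho> \<Longrightarrow>
       \<exists>\<nu> \<in> compact_probs (- U).
         pos_energy \<alpha> \<nu> \<le> ennreal (1 + \<kappa>) * (\<integral>\<^sup>+z. \<integral>\<^sup>+w. ennreal (trunc_kernel \<alpha> \<delta> z w) \<partial>\<mu> \<partial>\<mu>) + ennreal \<kappa> \<and>
         (\<forall>f\<in>borel_measurable borel. (\<integral>\<^sup>+x. f x \<partial>\<nu>) \<le> ennreal D * (\<integral>\<^sup>+x. f x \<partial>lborel))"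
    using smoothing[OF assms(1-4)] by metis
  show ?thesis
  proof (rule that[of "- ln \<delta>"])
    fix n :: nat and w :: "nat \<Rightarrow> complex"
    assume n: "n \<ge> 1" and w: "w ` {..<n} \<subseteq> - U" and inj: "inj_on w {..<n}"
    define \<mu> where "\<mu> = distr (measure_pmf (pmf_of_set {..<n})) borel w"
    have fin: "finite {..<n}" "{..<n} \<noteq> {}" using n by (auto simp: lessThan_empty_iff)
    have int: "(\<integral>\<^sup>+z. f z \<partial>\<mu>) = (\<Sum>i<n. f (w i)) / of_nat n" if "f \<in> borel_measurable borel" for f
      unfolding \<mu>_def using that fin
      by (subst nn_integral_distr) (simp_all add: nn_integral_pmf_of_set)
    have AE: "AE z in \<mu>. P z" if "\<And>i. i < n \<Longrightarrow> P (w i)" "{z. P z} \<in> sets borel" for P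
      unfolding \<mu>_def using that fin by (subst AE_distr_iff) (auto simp: AE_measure_pmf_iff)
    define S where "S = conf_energy \<alpha> n w"
    obtain \<nu> where "\<nu> \<in> compact_probs (- U)" and
      \<nu>: "pos_energy \<alpha> \<nu> \<le> ennreal (1 + \<kappa>) * (\<integral>\<^sup>+z. \<integral>\<^sup>+w. ennreal (trunc_kernel \<alpha> \<delta> z w) \<partial>\<mu> \<partial>\<mu>) + ennreal \<kappa>"
    proof -
      have "AE z in \<mu>. z \<in> - U" using w \<open>open U\<close> by (intro AE) (auto simp: Compl_eq[symmetric])
      moreover have "AE z in \<mu>. norm z \<le> Max ((\<lambda>i. norm (w i)) ` {..<n})"
        using fin by (intro AE) auto
      moreover have "prob_space \<mu>" unfolding \<mu>_def
        by (rule measure_pmf.prob_space_distr) simp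
      moreover have "sets \<mu> = sets borel" by (simp add: \<mu>_def)
      ultimately show ?thesis using sm that by metis
    qed
    have h: "trunc_kernel \<alpha> \<delta> z z' \<ge> 0" for z z' using \<delta> assms by (intro trunc_kernel_nonneg)
    have "(\<integral>\<^sup>+z. \<integral>\<^sup>+w. ennreal (trunc_kernel \<alpha> \<delta> z w) \<partial>\<mu> \<partial>\<mu>) =
       (\<integral>\<^sup>+z. (\<Sum>j<n. ennreal (trunc_kernel \<alpha> \<delta> z (w j))) / of_nat n \<partial>\<mu>)"
      by (intro nn_integral_cong int) measurable
    also have "\<dots> = (\<Sum>i<n. (\<Sum>j<n. ennreal (trunc_kernel \<alpha> \<delta> (w i) (w j))) / of_nat n) / of_nat n"
      by (intro int) measurable
    also have "\<dots> = ennreal ((\<Sum>i<n. (\<Sum>j<n. trunc_kernel \<alpha> \<delta> (w i) (w j)) / real n) / real n)"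
      using n h by (simp add: sum_ennreal sum_nonneg divide_ennreal ennreal_of_nat_eq_real_of_nat)
    also have "\<dots> = ennreal ((\<Sum>i<n. \<Sum>j<n. trunc_kernel \<alpha> \<delta> (w i) (w j)) / (real n)\<^sup>2)"
      by (simp add: sum_divide_distrib[symmetric] power2_eq_square)
    also have "\<dots> \<le> ennreal ((S + real n * (- ln \<delta>)) / (real n)\<^sup>2)"
    proof (intro ennreal_leI divide_right_mono)
      have "(\<Sum>i<n. \<Sum>j<n. trunc_kernel \<alpha> \<delta> (w i) (w j)) =
        (\<Sum>i<n. (\<Sum>j\<in>{..<n}-{i}. trunc_kernel \<alpha> \<delta> (w i) (w j)) + trunc_kernel \<alpha> \<delta> (w i) (w i))"
        by (intro sum.cong refl) (simp add: sum.remove[of "{..<n}"] add.commute)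
      also have "\<dots> \<le> (\<Sum>i<n. (\<Sum>j\<in>{..<n}-{i}. - ln (norm (w i - w j)) + (norm (w i) powr \<alpha> + norm (w j) powr \<alpha>) / 2 + 4)
         + (norm (w i) powr \<alpha> + 4 + (- ln \<delta>)))"
      proof (intro sum_mono add_mono)
        fix i j assume "i \<in> {..<n}" "j \<in> {..<n}-{i}"
        then have "w i \<noteq> w j" using inj by (auto simp: inj_on_def)
        then have "0 < norm (w i - w j)" by simp
        then show "trunc_kernel \<alpha> \<delta> (w i) (w j) \<le> - ln (norm (w i - w j)) + (norm (w i) powr \<alpha> + norm (w j) powr \<alpha>) / 2 + 4"
          by (auto simp: trunc_kernel_def intro!: ln_mono)
      qed (use \<delta> in \<open>auto simp: trunc_kernel_def\<close>)
      also have "\<dots> = S + real n * (- ln \<delta>)"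
        unfolding S_def conf_energy_def by (simp add: sum.distrib sum_subtractf)
      finally show "(\<Sum>i<n. \<Sum>j<n. trunc_kernel \<alpha> \<delta> (w i) (w j)) \<le> S + real n * (- ln \<delta>)" .
    qed simp
    finally have I: "(\<integral>\<^sup>+z. \<integral>\<^sup>+w. ennreal (trunc_kernel \<alpha> \<delta> z w) \<partial>\<mu> \<partial>\<mu>) \<le> ennreal ((S + real n * (- ln \<delta>)) / (real n)\<^sup>2)" .
    have "0 \<le> real n / 2 * (\<Sum>i<n. norm (w i) powr \<alpha>)"
      by (intro mult_nonneg_nonneg sum_nonneg) auto
    then have "0 \<le> S" unfolding S_def using conf_energy_ge[OF assms(1) inj] by linarith
    moreover have "ln \<delta> \<le> 0" using \<delta> by simp
    then have "real n * ln \<delta> \<le> 0" by (intro mult_nonneg_nonpos) auto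
    ultimately have pos: "0 \<le> (S + real n * (- ln \<delta>)) / (real n)\<^sup>2"
      by (intro divide_nonneg_nonneg) auto
    have "ennreal \<gamma> \<le> pos_energy \<alpha> \<nu>" by (rule \<gamma>) fact
    also note \<nu>
    also have "ennreal (1 + \<kappa>) * (\<integral>\<^sup>+z. \<integral>\<^sup>+w. ennreal (trunc_kernel \<alpha> \<delta> z w) \<partial>\<mu> \<partial>\<mu>) + ennreal \<kappa>
       \<le> ennreal (1 + \<kappa>) * ennreal ((S + real n * (- ln \<delta>)) / (real n)\<^sup>2) + ennreal \<kappa>"
      by (intro add_mono mult_left_mono I) auto
    also have "\<dots> = ennreal ((1 + \<kappa>) * ((S + real n * (- ln \<delta>)) / (real n)\<^sup>2) + \<kappa>)"
      using pos assms(4) by (subst ennreal_plus) (simp_all add: ennreal_mult del: times_divide_eq_right)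
    finally have "\<gamma> \<le> (1 + \<kappa>) * ((S + real n * (- ln \<delta>)) / (real n)\<^sup>2) + \<kappa>"
      using pos assms(4) by (subst (asm) ennreal_le_iff) (auto simp del: times_divide_eq_right)
    then have "(\<gamma> - \<kappa>) / (1 + \<kappa>) \<le> (S + real n * (- ln \<delta>)) / (real n)\<^sup>2"
      using assms(4) by (simp add: pos_divide_le_eq mult.commute)
    then have "(real n)\<^sup>2 * ((\<gamma> - \<kappa>) / (1 + \<kappa>)) \<le> S + real n * (- ln \<delta>)"
      using n by (simp add: pos_le_divide_eq mult.commute)
    then show "(real n)\<^sup>2 * ((\<gamma> - \<kappa>) / (1 + \<kappa>)) - real n * (- ln \<delta>) \<le> conf_energy \<alpha> n w"
      by (simp add: S_def)
  qed
qed

lemma partfun_le: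
  assumes "\<alpha> \<ge> 1" "n \<ge> 2"
    and X: "\<And>w. w ` {..<n} \<subseteq> - U \<Longrightarrow> inj_on w {..<n} \<Longrightarrow> X \<le> conf_energy \<alpha> n w"
  shows "partfun \<alpha> n U \<le> ennreal (exp (4 * (real n)\<^sup>2 - (1 - 2 / real n) * X)) *
    (\<integral>\<^sup>+z. ennreal (exp (- (norm (z::complex) powr \<alpha>))) \<partial>lborel) ^ n"
proof -
  interpret product_sigma_finite "\<lambda>_::nat. lborel :: complex measure" ..
  let ?c = "exp (4 * (real n)\<^sup>2 - (1 - 2 / real n) * X)"
  have "partfun \<alpha> n U \<le> (\<integral>\<^sup>+w. ennreal ?c * (\<Prod>i<n. ennreal (exp (- (norm (w i) powr \<alpha>))))
      \<partial>(\<Pi>\<^sub>M i\<in>{..<n}. (lborel :: complex measure)))"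
    unfolding partfun_def
  proof (intro nn_integral_mono)
    fix w :: "nat \<Rightarrow> complex"
    let ?S = "conf_energy \<alpha> n w" and ?Q = "\<Sum>i<n. norm (w i) powr \<alpha>"
    show "ennreal (weight \<alpha> n w) * indicator ({..<n} \<rightarrow>\<^sub>E - U) w
      \<le> ennreal ?c * (\<Prod>i<n. ennreal (exp (- (norm (w i) powr \<alpha>))))"
    proof (cases "inj_on w {..<n} \<and> w \<in> ({..<n} \<rightarrow>\<^sub>E - U)")
      case True
      then have "X \<le> ?S" by (intro X) auto
      \<comment> \<open>a fraction \<open>2 / n\<close> of the energy is used to make the integral converge\<close>
      have "?Q = 2 / real n * (real n / 2 * ?Q)" using assms by simp
      also have "\<dots> \<le> 2 / real n * ?S"
        using conf_energy_ge[OF assms(1)] True by (intro mult_left_mono) auto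
      finally have 1: "?Q \<le> 2 / real n * ?S" .
      have "(1 - 2 / real n) * X \<le> (1 - 2 / real n) * ?S"
        using assms \<open>X \<le> ?S\<close> by (intro mult_left_mono) auto
      also have "\<dots> = ?S - 2 / real n * ?S" by (simp add: algebra_simps)
      finally have "4 * (real n)\<^sup>2 - ?S \<le> (4 * (real n)\<^sup>2 - (1 - 2 / real n) * X) + (- ?Q)"
        using 1 by linarith
      then have "weight \<alpha> n w \<le> exp ((4 * (real n)\<^sup>2 - (1 - 2 / real n) * X) + (- ?Q))"
        using True by (simp add: weight_eq_exp)
      also have "\<dots> = ?c * (\<Prod>i<n. exp (- (norm (w i) powr \<alpha>)))"
        by (simp only: exp_add exp_sum[OF finite_lessThan, symmetric] sum_negf)
      finally have "ennreal (weight \<alpha> n w) \<le> ennreal (?c * (\<Prod>i<n. exp (- (norm (w i) powr \<alpha>))))"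
        by (rule ennreal_leI)
      also have "\<dots> = ennreal ?c * (\<Prod>i<n. ennreal (exp (- (norm (w i) powr \<alpha>))))"
        by (subst ennreal_mult) (auto simp: prod_ennreal intro!: prod_nonneg)
      finally show ?thesis by (auto simp: indicator_def)
    next
      case False
      then show ?thesis by (cases "inj_on w {..<n}") (simp_all add: weight_eq_0)
    qed
  qed
  also have "\<dots> = ennreal ?c * (\<integral>\<^sup>+w. (\<Prod>i<n. ennreal (exp (- (norm (w i) powr \<alpha>)))) \<partial>(\<Pi>\<^sub>M i\<in>{..<n}. (lborel :: complex measure)))"
    by (intro nn_integral_cmult) measurable
  also have "\<dots> = ennreal ?c * (\<integral>\<^sup>+z. ennreal (exp (- (norm (z::complex) powr \<alpha>))) \<partial>lborel) ^ n"
    by (subst product_nn_integral_prod) simp_all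
  finally show ?thesis .
qed

section \<open>Lower bound for the partition functions\<close>

text \<open>
  Domination of a measure by a multiple of another one passes to finite products.
\<close>

lemma nn_integral_PiM_le:
  fixes \<nu> L :: "'a measure"
  assumes "sigma_finite_measure \<nu>" "sigma_finite_measure L"
    and sets: "sets \<nu> = sets L"
    and le: "\<And>f. f \<in> borel_measurable L \<Longrightarrow> (\<integral>\<^sup>+x. f x \<partial>\<nu>) \<le> D * (\<integral>\<^sup>+x. f x \<partial>L)"
    and "finite I"
  shows "f \<in> borel_measurable (\<Pi>\<^sub>M i\<in>I. L) \<Longrightarrow>
    (\<integral>\<^sup>+x. f x \<partial>(\<Pi>\<^sub>M i\<in>I. \<nu>)) \<le> D ^ card I * (\<integral>\<^sup>+x. f x \<partial>(\<Pi>\<^sub>M i\<in>I. L))"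
  using \<open>finite I\<close>
proof (induction I arbitrary: f rule: finite_induct)
  case empty
  have "space \<nu> = space L" using sets by (rule sets_eq_imp_space_eq)
  then show ?case by (simp add: PiM_empty)
next
  case (insert i I)
  interpret L: sigma_finite_measure L by fact
  interpret N: sigma_finite_measure \<nu> by fact
  interpret PN: product_sigma_finite "\<lambda>_. \<nu>" ..
  interpret PL: product_sigma_finite "\<lambda>_. L" ..
  have s: "sets (\<Pi>\<^sub>M i\<in>J. \<nu>) = sets (\<Pi>\<^sub>M i\<in>J. L)" for J
    using sets by (intro sets_PiM_cong) auto
  note [measurable] = insert.prems
  have f': "f \<in> borel_measurable (\<Pi>\<^sub>M i\<in>insert i I. \<nu>)"
    using insert.prems measurable_cong_sets[OF s refl] by blast
  have up: "(\<lambda>y. f (x(i := y))) \<in> borel_measurable L" if "x \<in> space (\<Pi>\<^sub>M i\<in>I. L)" for x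
    using measurable_comp[OF measurable_component_update[OF that insert.hyps(2)] insert.prems]
    by (simp add: comp_def)
  have m: "(\<lambda>x. \<integral>\<^sup>+y. f (x(i := y)) \<partial>L) \<in> borel_measurable (\<Pi>\<^sub>M i\<in>I. L)"
    by measurable
  have "(\<integral>\<^sup>+x. f x \<partial>(\<Pi>\<^sub>M i\<in>insert i I. \<nu>)) = (\<integral>\<^sup>+x. \<integral>\<^sup>+y. f (x(i := y)) \<partial>\<nu> \<partial>(\<Pi>\<^sub>M i\<in>I. \<nu>))"
    by (rule PN.product_nn_integral_insert[OF insert.hyps f'])
  also have "\<dots> \<le> (\<integral>\<^sup>+x. D * (\<integral>\<^sup>+y. f (x(i := y)) \<partial>L) \<partial>(\<Pi>\<^sub>M i\<in>I. \<nu>))"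
    using sets_eq_imp_space_eq[OF s] by (intro nn_integral_mono le up) auto
  also have "\<dots> \<le> D ^ card I * (\<integral>\<^sup>+x. D * (\<integral>\<^sup>+y. f (x(i := y)) \<partial>L) \<partial>(\<Pi>\<^sub>M i\<in>I. L))"
    by (intro insert.IH borel_measurable_times_ennreal borel_measurable_const m)
  also have "\<dots> = D ^ card I * (D * (\<integral>\<^sup>+x. \<integral>\<^sup>+y. f (x(i := y)) \<partial>L \<partial>(\<Pi>\<^sub>M i\<in>I. L)))"
    using m by (simp add: nn_integral_cmult)
  also have "(\<integral>\<^sup>+x. \<integral>\<^sup>+y. f (x(i := y)) \<partial>L \<partial>(\<Pi>\<^sub>M i\<in>I. L)) = (\<integral>\<^sup>+x. f x \<partial>(\<Pi>\<^sub>M i\<in>insert i I. L))"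
    by (rule PL.product_nn_integral_insert[OF insert.hyps insert.prems, symmetric])
  finally show ?case using insert.hyps by (simp add: mult_ac)
qed

lemma nn_integral_PiM_component:
  assumes "prob_space \<nu>" "i \<in> I" "f \<in> borel_measurable \<nu>"
  shows "(\<integral>\<^sup>+x. f (x i) \<partial>(\<Pi>\<^sub>M i\<in>I. \<nu>)) = (\<integral>\<^sup>+z. f z \<partial>\<nu>)"
proof -
  have "(\<integral>\<^sup>+z. f z \<partial>\<nu>) = (\<integral>\<^sup>+z. f z \<partial>distr (\<Pi>\<^sub>M i\<in>I. \<nu>) \<nu> (\<lambda>x. x i))"
    using assms by (subst distr_PiM_component[of I "\<lambda>_. \<nu>" i]) auto
  also have "\<dots> = (\<integral>\<^sup>+x. f (x i) \<partial>(\<Pi>\<^sub>M i\<in>I. \<nu>))"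
    using assms by (intro nn_integral_distr) auto
  finally show ?thesis ..
qed

lemma nn_integral_PiM_two_components:
  assumes "prob_space \<nu>" "i \<in> I" "j \<in> I" "i \<noteq> j" "finite I"
    and [measurable]: "(\<lambda>(z, w). f z w) \<in> borel_measurable (\<nu> \<Otimes>\<^sub>M \<nu>)"
  shows "(\<integral>\<^sup>+x. f (x i) (x j) \<partial>(\<Pi>\<^sub>M i\<in>I. \<nu>)) = (\<integral>\<^sup>+z. \<integral>\<^sup>+w. f z w \<partial>\<nu> \<partial>\<nu>)"
proof -
  interpret N: prob_space \<nu> by fact
  interpret product_prob_space "\<lambda>_. \<nu>" I ..
  have m: "(\<lambda>x. f (x i) (x j)) \<in> borel_measurable (\<Pi>\<^sub>M i\<in>{i, j}. \<nu>)"
    by measurable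
  have "(\<integral>\<^sup>+z. \<integral>\<^sup>+w. f z w \<partial>\<nu> \<partial>\<nu>) = (\<integral>\<^sup>+z. f (fst z) (snd z) \<partial>(\<nu> \<Otimes>\<^sub>M \<nu>))"
    by (subst N.nn_integral_fst[symmetric]) simp_all
  also have "\<dots> = (\<integral>\<^sup>+x. f (x i) (x j) \<partial>(\<Pi>\<^sub>M i\<in>{i, j}. \<nu>))"
    using assms by (intro product_nn_integral_pair[symmetric]) auto
  also have "\<dots> = (\<integral>\<^sup>+x. f (x i) (x j) \<partial>distr (\<Pi>\<^sub>M i\<in>I. \<nu>) (\<Pi>\<^sub>M i\<in>{i, j}. \<nu>) (\<lambda>x. restrict x {i, j}))"
    using assms by (subst distr_restrict[of "{i, j}" I]) auto
  also have "\<dots> = (\<integral>\<^sup>+x. f (restrict x {i, j} i) (restrict x {i, j} j) \<partial>(\<Pi>\<^sub>M i\<in>I. \<nu>))"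
    using assms by (intro nn_integral_distr m measurable_restrict_subset) auto
  finally show ?thesis by simp
qed

text \<open>
  The energy of a configuration with values in \<open>[0, \<infinity>]\<close>; it is infinite when two points coincide.
\<close>

definition conf_energy_enn :: "real \<Rightarrow> nat \<Rightarrow> (nat \<Rightarrow> complex) \<Rightarrow> ennreal" where
  "conf_energy_enn \<alpha> n w =
     (\<Sum>i<n. (\<Sum>j\<in>{..<n}-{i}. pos_kernel \<alpha> (w i) (w j)) + ennreal (norm (w i) powr \<alpha> + 4))"

lemma conf_energy_enn_inj:
  assumes "\<alpha> \<ge> 1" "inj_on w {..<n}"
  shows "conf_energy_enn \<alpha> n w = ennreal (conf_energy \<alpha> n w)"
proof -
  let ?g = "\<lambda>i j. - ln (norm (w i - w j)) + (norm (w i) powr \<alpha> + norm (w j) powr \<alpha>) / 2 + 4"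
  have *: "pos_kernel \<alpha> (w i) (w j) = ennreal (?g i j)" "?g i j \<ge> 0"
    if "i \<in> {..<n}" "j \<in> {..<n}-{i}" for i j
  proof -
    have "w i \<noteq> w j" using that assms by (auto simp: inj_on_def)
    then show "pos_kernel \<alpha> (w i) (w j) = ennreal (?g i j)" by (simp add: pos_kernel_def)
    show "?g i j \<ge> 0"
      using \<open>w i \<noteq> w j\<close> by (intro order_trans[OF _ pos_kernel_real_ge[OF assms(1)]]) auto
  qed
  have "conf_energy_enn \<alpha> n w =
    (\<Sum>i<n. ennreal (\<Sum>j\<in>{..<n}-{i}. ?g i j) + ennreal (norm (w i) powr \<alpha> + 4))"
    unfolding conf_energy_enn_def
  proof (intro sum.cong refl arg_cong2[where f="(+)"])
    fix i assume i: "i \<in> {..<n}"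
    have "(\<Sum>j\<in>{..<n}-{i}. pos_kernel \<alpha> (w i) (w j)) = (\<Sum>j\<in>{..<n}-{i}. ennreal (?g i j))"
      using *(1)[OF i] by (intro sum.cong refl)
    also have "\<dots> = ennreal (\<Sum>j\<in>{..<n}-{i}. ?g i j)"
      using *(2)[OF i] by (intro sum_ennreal)
    finally show "(\<Sum>j\<in>{..<n}-{i}. pos_kernel \<alpha> (w i) (w j)) = ennreal (\<Sum>j\<in>{..<n}-{i}. ?g i j)" .
  qed
  also have "\<dots> = (\<Sum>i<n. ennreal ((\<Sum>j\<in>{..<n}-{i}. ?g i j) + (norm (w i) powr \<alpha> + 4)))"
    by (intro sum.cong refl ennreal_plus[symmetric] sum_nonneg *(2)) simp_all
  also have "\<dots> = ennreal (\<Sum>i<n. (\<Sum>j\<in>{..<n}-{i}. ?g i j) + (norm (w i) powr \<alpha> + 4))"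
    by (intro sum_ennreal add_nonneg_nonneg sum_nonneg *(2)) simp_all
  finally show ?thesis unfolding conf_energy_def .
qed

lemma conf_energy_enn_not_inj:
  assumes "\<not> inj_on w {..<n}"
  shows "conf_energy_enn \<alpha> n w = \<infinity>"
proof -
  from assms obtain i j where ij: "i < n" "j < n" "i \<noteq> j" "w i = w j"
    unfolding inj_on_def by auto
  then have "(\<Sum>j\<in>{..<n}-{i}. pos_kernel \<alpha> (w i) (w j)) = \<infinity>"
    by (subst sum.remove[of _ j]) (auto simp: pos_kernel_def)
  then show ?thesis
    unfolding conf_energy_enn_def using ij by (subst sum.remove[of _ i]) auto
qed

lemma nn_integral_conf_energy_enn:
  assumes "prob_space \<nu>" and [measurable_cong, simp]: "sets \<nu> = sets borel"
  shows "(\<integral>\<^sup>+w. conf_energy_enn \<alpha> n w \<partial>(\<Pi>\<^sub>M i\<in>{..<n}. \<nu>)) =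
    of_nat (n * (n - 1)) * pos_energy \<alpha> \<nu> + of_nat n * (\<integral>\<^sup>+z. ennreal (norm z powr \<alpha> + 4) \<partial>\<nu>)"
proof -
  let ?P = "\<Pi>\<^sub>M i\<in>{..<n}. \<nu>"
  have c: "(\<lambda>w. w i) \<in> borel_measurable ?P" if "i < n" for i
    using that measurable_component_singleton[of i "{..<n}" "\<lambda>_. \<nu>"]
      measurable_cong_sets[OF refl assms(2)] by auto
  have 1: "(\<lambda>w. pos_kernel \<alpha> (w i) (w j)) \<in> borel_measurable ?P" if "i < n" "j < n" for i j
    using c[OF that(1), measurable] c[OF that(2), measurable] by measurable
  have 2: "(\<lambda>w. ennreal (norm (w i) powr \<alpha> + 4)) \<in> borel_measurable ?P" if "i < n" for i
    using c[OF that, measurable] by measurable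
  have "(\<integral>\<^sup>+w. conf_energy_enn \<alpha> n w \<partial>?P) =
    (\<Sum>i<n. (\<Sum>j\<in>{..<n}-{i}. \<integral>\<^sup>+w. pos_kernel \<alpha> (w i) (w j) \<partial>?P) + (\<integral>\<^sup>+w. ennreal (norm (w i) powr \<alpha> + 4) \<partial>?P))"
    unfolding conf_energy_enn_def
  proof (subst nn_integral_sum)
    fix i assume i: "i \<in> {..<n}"
    show "(\<lambda>w. (\<Sum>j\<in>{..<n}-{i}. pos_kernel \<alpha> (w i) (w j)) + ennreal (norm (w i) powr \<alpha> + 4)) \<in> borel_measurable ?P"
      using 1 2 i by (intro borel_measurable_add borel_measurable_sum) auto
  next
    show "(\<Sum>i<n. \<integral>\<^sup>+w. (\<Sum>j\<in>{..<n}-{i}. pos_kernel \<alpha> (w i) (w j)) + ennreal (norm (w i) powr \<alpha> + 4) \<partial>?P) =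
      (\<Sum>i<n. (\<Sum>j\<in>{..<n}-{i}. \<integral>\<^sup>+w. pos_kernel \<alpha> (w i) (w j) \<partial>?P) + (\<integral>\<^sup>+w. ennreal (norm (w i) powr \<alpha> + 4) \<partial>?P))"
    proof (intro sum.cong refl)
      fix i assume i: "i \<in> {..<n}"
      have "(\<integral>\<^sup>+w. (\<Sum>j\<in>{..<n}-{i}. pos_kernel \<alpha> (w i) (w j)) + ennreal (norm (w i) powr \<alpha> + 4) \<partial>?P) =
        (\<integral>\<^sup>+w. (\<Sum>j\<in>{..<n}-{i}. pos_kernel \<alpha> (w i) (w j)) \<partial>?P) + (\<integral>\<^sup>+w. ennreal (norm (w i) powr \<alpha> + 4) \<partial>?P)"
        using 1 2 i by (intro nn_integral_add borel_measurable_sum) auto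
      also have "(\<integral>\<^sup>+w. (\<Sum>j\<in>{..<n}-{i}. pos_kernel \<alpha> (w i) (w j)) \<partial>?P) =
        (\<Sum>j\<in>{..<n}-{i}. \<integral>\<^sup>+w. pos_kernel \<alpha> (w i) (w j) \<partial>?P)"
        using 1 i by (intro nn_integral_sum) auto
      finally show "(\<integral>\<^sup>+w. (\<Sum>j\<in>{..<n}-{i}. pos_kernel \<alpha> (w i) (w j)) + ennreal (norm (w i) powr \<alpha> + 4) \<partial>?P) =
        (\<Sum>j\<in>{..<n}-{i}. \<integral>\<^sup>+w. pos_kernel \<alpha> (w i) (w j) \<partial>?P) + (\<integral>\<^sup>+w. ennreal (norm (w i) powr \<alpha> + 4) \<partial>?P)" .
    qed
  qed
  also have "\<dots> = (\<Sum>i<n. (\<Sum>j\<in>{..<n}-{i}. pos_energy \<alpha> \<nu>) + (\<integral>\<^sup>+z. ennreal (norm z powr \<alpha> + 4) \<partial>\<nu>))"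
    unfolding pos_energy_def using assms
    by (intro sum.cong refl arg_cong2[where f="(+)"] nn_integral_PiM_two_components nn_integral_PiM_component) auto
  also have "\<dots> = of_nat (n * (n - 1)) * pos_energy \<alpha> \<nu> + of_nat n * (\<integral>\<^sup>+z. ennreal (norm z powr \<alpha> + 4) \<partial>\<nu>)"
    by (simp add: sum.distrib mult.assoc distrib_left)
  finally show ?thesis .
qed

text \<open>
  Jensen's inequality for the exponential function, in the form of the tangent inequality
  \<open>e^(-x) + e^(-a) x \<ge> e^(-a) (1 + a)\<close>, which also holds for \<open>x = \<infinity>\<close>.
\<close>

lemma partfun_ge:
  assumes "\<alpha> \<ge> 1" "open U" "\<nu> \<in> compact_probs (- U)" "pos_energy \<alpha> \<nu> \<le> ennreal e" "e \<ge> 0" "D > 0"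
    and D: "\<And>f. f \<in> borel_measurable borel \<Longrightarrow> (\<integral>\<^sup>+x. f x \<partial>\<nu>) \<le> ennreal D * (\<integral>\<^sup>+x. f x \<partial>lborel)"
  obtains q where "\<And>n. n \<ge> 1 \<Longrightarrow>
    partfun \<alpha> n U \<ge> ennreal (exp (4 * (real n)\<^sup>2 - (real n)\<^sup>2 * e - real n * q))"
proof -
  obtain \<rho> where \<rho>: "\<rho> > 0" "prob_space \<nu>" "sets \<nu> = sets borel" "AE z in \<nu>. z \<in> - U" "AE z in \<nu>. norm z \<le> \<rho>"
    using compact_probsE[OF assms(3)] .
  note [measurable_cong, simp] = \<rho>(3)
  interpret N: prob_space \<nu> by fact
  define q where "q = \<rho> powr \<alpha> + 4"
  have "(\<integral>\<^sup>+z. ennreal (norm z powr \<alpha> + 4) \<partial>\<nu>) \<le> (\<integral>\<^sup>+z. ennreal q \<partial>\<nu>)"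
    using \<rho>(5) assms(1) by (intro nn_integral_mono_AE)
      (auto elim!: eventually_mono intro!: ennreal_leI powr_mono2 simp: q_def)
  also have "\<dots> = ennreal q" by (simp add: N.emeasure_space_1)
  finally have q: "(\<integral>\<^sup>+z. ennreal (norm z powr \<alpha> + 4) \<partial>\<nu>) \<le> ennreal q" .
  show ?thesis
  proof (rule that[of "q + ln D"])
    fix n :: nat assume n: "n \<ge> 1"
    let ?P = "\<Pi>\<^sub>M i\<in>{..<n}. \<nu>"
    interpret P: product_prob_space "\<lambda>_. \<nu>" "{..<n}" ..
    have prob: "emeasure ?P (space ?P) = 1" by (rule P.emeasure_space_1)
    let ?F = "{..<n} \<rightarrow>\<^sub>E - U"
    define a where "a = (real n)\<^sup>2 * e + real n * q"
    have "q \<ge> 0" by (simp add: q_def)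
    then have "a \<ge> 0" using assms by (simp add: a_def)
    have "(\<integral>\<^sup>+w. conf_energy_enn \<alpha> n w \<partial>?P) \<le> of_nat (n * n) * ennreal e + of_nat n * ennreal q"
      unfolding nn_integral_conf_energy_enn[OF \<rho>(2,3)] using assms(4) q
      by (intro add_mono mult_mono of_nat_mono mult_le_mono) auto
    also have "\<dots> = ennreal a"
      using assms(5) \<open>q \<ge> 0\<close> unfolding a_def
      by (simp add: ennreal_of_nat_eq_real_of_nat[symmetric] ennreal_mult power2_eq_square)
    finally have S: "(\<integral>\<^sup>+w. conf_energy_enn \<alpha> n w \<partial>?P) \<le> ennreal a" .
    define W where "W w = ennreal (exp (- 4 * (real n)\<^sup>2)) * (ennreal (weight \<alpha> n w) * indicator ?F w)" for w
    have Fs: "?F \<in> sets (\<Pi>\<^sub>M i\<in>{..<n}. borel)"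
      using assms(2) by (intro sets_PiM_I_finite) auto
    have [measurable]: "(\<lambda>w. ennreal (weight \<alpha> n w) * indicator ?F w) \<in> borel_measurable (\<Pi>\<^sub>M i\<in>{..<n}. borel)"
      using Fs by measurable
    have sP: "sets ?P = sets (\<Pi>\<^sub>M i\<in>{..<n}. borel)" by (intro sets_PiM_cong) auto
    have [measurable]: "W \<in> borel_measurable ?P"
      unfolding W_def measurable_cong_sets[OF sP refl] by measurable
    have [measurable]: "conf_energy_enn \<alpha> n \<in> borel_measurable ?P"
      unfolding conf_energy_enn_def by measurable
    have "AE w in ?P. \<forall>i\<in>{..<n}. w i \<in> - U"
      using \<rho> by (intro AE_finite_allI AE_PiM_component) auto
    then have AE: "AE w in ?P. w \<in> ?F"
      using AE_space[of ?P] by eventually_elim (auto simp: space_PiM PiE_iff)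
    have "ennreal (exp (- a) * (1 + a)) = (\<integral>\<^sup>+w. ennreal (exp (- a) * (1 + a)) \<partial>?P)"
      by (simp add: prob)
    also have "\<dots> \<le> (\<integral>\<^sup>+w. W w + ennreal (exp (- a)) * conf_energy_enn \<alpha> n w \<partial>?P)"
      using AE
    proof (intro nn_integral_mono_AE, eventually_elim)
      case (elim w)
      show ?case
      proof (cases "inj_on w {..<n}")
        case True
        let ?S = "conf_energy \<alpha> n w"
        have W: "W w = ennreal (exp (- ?S))"
          unfolding W_def using True elim
          by (simp add: ennreal_mult[symmetric] exp_add[symmetric] weight_eq_exp)
        have "0 \<le> real n / 2 * (\<Sum>i<n. norm (w i) powr \<alpha>)"
          by (intro mult_nonneg_nonneg sum_nonneg) auto
        then have "0 \<le> ?S" using conf_energy_ge[OF assms(1) True] by linarith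
        have "1 + (a - ?S) \<le> exp (a - ?S)" by (rule exp_ge_add_one_self)
        then have "exp (- a) * (1 + (a - ?S)) \<le> exp (- a) * exp (a - ?S)" by (intro mult_left_mono) auto
        then have "exp (- a) * (1 + a) \<le> exp (- ?S) + exp (- a) * ?S"
          by (simp add: exp_add[symmetric] algebra_simps)
        then have "ennreal (exp (- a) * (1 + a)) \<le> ennreal (exp (- ?S) + exp (- a) * ?S)"
          by (rule ennreal_leI)
        also have "\<dots> = W w + ennreal (exp (- a)) * conf_energy_enn \<alpha> n w"
          unfolding W conf_energy_enn_inj[OF assms(1) True]
          using \<open>0 \<le> ?S\<close> by (simp add: ennreal_mult ennreal_plus)
        finally show ?thesis .
      next
        case False
        then show ?thesis by (simp add: conf_energy_enn_not_inj ennreal_mult_top)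
      qed
    qed
    also have "\<dots> = (\<integral>\<^sup>+w. W w \<partial>?P) + ennreal (exp (- a)) * (\<integral>\<^sup>+w. conf_energy_enn \<alpha> n w \<partial>?P)"
      by (simp add: nn_integral_add nn_integral_cmult)
    also have "\<dots> \<le> (\<integral>\<^sup>+w. W w \<partial>?P) + ennreal (exp (- a)) * ennreal a"
      by (intro add_mono mult_left_mono S) auto
    finally have "ennreal (exp (- a)) + ennreal (exp (- a)) * ennreal a
        \<le> (\<integral>\<^sup>+w. W w \<partial>?P) + ennreal (exp (- a)) * ennreal a"
      using \<open>a \<ge> 0\<close> by (simp add: ennreal_mult[symmetric] ennreal_plus[symmetric] algebra_simps del: ennreal_plus)
    then have "ennreal (exp (- a)) \<le> (\<integral>\<^sup>+w. W w \<partial>?P)"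
      using \<open>a \<ge> 0\<close> by (simp add: ennreal_mult[symmetric] add.commute[of _ "ennreal (_ * _)"])
    also have "\<dots> \<le> ennreal D ^ card {..<n} * (\<integral>\<^sup>+w. W w \<partial>(\<Pi>\<^sub>M i\<in>{..<n}. lborel))"
    proof (rule nn_integral_PiM_le)
      show "sigma_finite_measure \<nu>" ..
      show "sigma_finite_measure (lborel :: complex measure)" ..
      have sP': "sets (\<Pi>\<^sub>M i\<in>{..<n}. (lborel :: complex measure)) = sets (\<Pi>\<^sub>M i\<in>{..<n}. borel)"
        by (intro sets_PiM_cong) auto
      show "W \<in> borel_measurable (\<Pi>\<^sub>M i\<in>{..<n}. lborel)"
        unfolding W_def measurable_cong_sets[OF sP' refl] by measurable
    qed (use D in auto)
    also have "(\<integral>\<^sup>+w. W w \<partial>(\<Pi>\<^sub>M i\<in>{..<n}. lborel)) = ennreal (exp (- 4 * (real n)\<^sup>2)) * partfun \<alpha> n U"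
      unfolding W_def partfun_def
    proof (rule nn_integral_cmult)
      have sP': "sets (\<Pi>\<^sub>M i\<in>{..<n}. (lborel :: complex measure)) = sets (\<Pi>\<^sub>M i\<in>{..<n}. borel)"
        by (intro sets_PiM_cong) auto
      show "(\<lambda>w. ennreal (weight \<alpha> n w) * indicator ?F w) \<in> borel_measurable (\<Pi>\<^sub>M i\<in>{..<n}. lborel)"
        unfolding measurable_cong_sets[OF sP' refl] by measurable
    qed
    finally have *: "ennreal (exp (- a)) \<le> ennreal (D ^ n * exp (- 4 * (real n)\<^sup>2)) * partfun \<alpha> n U"
      using assms(6) by (simp add: ennreal_power ennreal_mult mult.assoc)
    define c where "c = D ^ n * exp (- 4 * (real n)\<^sup>2)"
    have "c > 0" using assms(6) by (simp add: c_def)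
    have lnD: "D ^ n = exp (real n * ln D)" using assms(6) by (simp add: exp_of_nat_mult)
    have "exp (4 * (real n)\<^sup>2 - (real n)\<^sup>2 * e - real n * (q + ln D)) = 1 / c * exp (- a)"
      unfolding c_def a_def lnD
      by (simp add: exp_add[symmetric] exp_minus[symmetric] divide_inverse algebra_simps)
    then have "ennreal (exp (4 * (real n)\<^sup>2 - (real n)\<^sup>2 * e - real n * (q + ln D))) = ennreal (1 / c) * ennreal (exp (- a))"
      using \<open>c > 0\<close> by (simp add: ennreal_mult[symmetric])
    also have "\<dots> \<le> ennreal (1 / c) * (ennreal c * partfun \<alpha> n U)"
      using * by (intro mult_left_mono) (auto simp: c_def)
    also have "\<dots> = partfun \<alpha> n U"
      using \<open>c > 0\<close> by (simp add: mult.assoc[symmetric] ennreal_mult[symmetric])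
    finally show "ennreal (exp (4 * (real n)\<^sup>2 - (real n)\<^sup>2 * e - real n * (q + ln D))) \<le> partfun \<alpha> n U" .
  qed
qed

section \<open>The minimal energy and the limit of the partition functions\<close>

text \<open>
  For a compactly supported measure the negative part of the logarithmic kernel and the potential have
  finite integrals, so the shifted energy splits into the terms that define the energy.
\<close>

lemma energy_eq_pos_energy:
  assumes "\<alpha> \<ge> 1" "\<mu> \<in> compact_probs F"
  shows "energy \<alpha> \<mu> = enn2ereal (pos_energy \<alpha> \<mu>) - 4"
proof -
  obtain \<rho> where \<rho>: "\<rho> > 0" "prob_space \<mu>" "sets \<mu> = sets borel" "AE z in \<mu>. norm z \<le> \<rho>"
    using compact_probsE[OF assms(2)] by metis
  note [measurable_cong, simp] = \<rho>(3)
  interpret M: prob_space \<mu> by fact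
  interpret MM: pair_prob_space \<mu> \<mu> ..
  define r where "r x = norm (fst x - snd x)" for x :: "complex \<times> complex"
  define P where "P = (\<integral>\<^sup>+x. e2ennreal (- elog (r x)) \<partial>(\<mu> \<Otimes>\<^sub>M \<mu>))"
  define N where "N = (\<integral>\<^sup>+x. e2ennreal (elog (r x)) \<partial>(\<mu> \<Otimes>\<^sub>M \<mu>))"
  define h where "h = (\<integral>\<^sup>+z. ennreal (norm z powr \<alpha> / 2) \<partial>\<mu>)"
  have [measurable]: "r \<in> borel_measurable (\<mu> \<Otimes>\<^sub>M \<mu>)" unfolding r_def by measurable
  have [measurable]: "elog \<in> borel_measurable borel" unfolding elog_def by measurable
  have AE2: "AE x in \<mu> \<Otimes>\<^sub>M \<mu>. r x \<le> 2 * \<rho>"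
  proof -
    have "AE z in \<mu>. AE w in \<mu>. r (z, w) \<le> 2 * \<rho>"
      using \<rho>(4)
    proof eventually_elim
      case (elim z)
      from \<rho>(4) show ?case
      proof eventually_elim
        case (elim w)
        then show ?case using norm_triangle_ineq4[of z w] \<open>norm z \<le> \<rho>\<close> by (simp add: r_def)
      qed
    qed
    moreover have "{x \<in> space (\<mu> \<Otimes>\<^sub>M \<mu>). r x \<le> 2 * \<rho>} \<in> sets (\<mu> \<Otimes>\<^sub>M \<mu>)" by measurable
    ultimately show ?thesis using MM.AE_pair_iff[of "\<lambda>z w. r (z, w) \<le> 2 * \<rho>"] by simp
  qed
  have "N \<le> (\<integral>\<^sup>+x. ennreal (2 * \<rho>) \<partial>(\<mu> \<Otimes>\<^sub>M \<mu>))"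
    unfolding N_def using AE2
  proof (intro nn_integral_mono_AE, eventually_elim)
    case (elim x)
    show ?case
    proof (cases "r x \<le> 0")
      case False
      then have "ln (r x) \<le> 2 * \<rho>" using ln_le_minus_one[of "r x"] elim by simp
      then show ?thesis using False by (simp add: elog_def e2ennreal_ereal ennreal_leI)
    qed (simp add: elog_def e2ennreal_neg)
  qed
  also have "\<dots> = ennreal (2 * \<rho>)" by (simp add: MM.emeasure_space_1)
  finally have N: "N < \<infinity>" by (simp add: le_less_trans)
  have "h \<le> (\<integral>\<^sup>+z. ennreal (\<rho> powr \<alpha>) \<partial>\<mu>)"
    unfolding h_def using \<rho>(4)
  proof (intro nn_integral_mono_AE, eventually_elim)
    case (elim z)
    have "norm z powr \<alpha> \<le> \<rho> powr \<alpha>" using elim assms by (intro powr_mono2) auto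
    moreover have "norm z powr \<alpha> / 2 \<le> norm z powr \<alpha>" by simp
    ultimately show ?case by (intro ennreal_leI) linarith
  qed
  also have "\<dots> = ennreal (\<rho> powr \<alpha>)" by (simp add: M.emeasure_space_1)
  finally have h: "h < \<infinity>" by (simp add: le_less_trans)
  have q: "(\<integral>\<^sup>+z. ennreal (norm z powr \<alpha>) \<partial>\<mu>) = h + h"
  proof -
    have "(\<integral>\<^sup>+z. ennreal (norm z powr \<alpha>) \<partial>\<mu>) = (\<integral>\<^sup>+z. ennreal (norm z powr \<alpha> / 2) + ennreal (norm z powr \<alpha> / 2) \<partial>\<mu>)"
      by (intro nn_integral_cong) (simp add: ennreal_plus[symmetric] del: ennreal_plus)
    also have "\<dots> = h + h" unfolding h_def by (intro nn_integral_add) measurable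
    finally show ?thesis .
  qed
  \<comment> \<open>the negative part is moved to the left, so that the identity holds in \<open>[0, \<infinity>]\<close>\<close>
  have pt: "pos_kernel \<alpha> (fst x) (snd x) + e2ennreal (elog (r x)) =
    e2ennreal (- elog (r x)) + (ennreal (norm (fst x) powr \<alpha> / 2) + ennreal (norm (snd x) powr \<alpha> / 2) + 4)" for x
  proof (cases "fst x = snd x")
    case True
    then show ?thesis by (simp add: r_def pos_kernel_def elog_def e2ennreal_infty)
  next
    case False
    define c where "c = (norm (fst x) powr \<alpha> + norm (snd x) powr \<alpha>) / 2 + 4"
    have "c \<ge> 0" by (simp add: c_def)
    have "r x > 0" using False by (simp add: r_def)
    have rc: "- ln (r x) + c \<ge> 0"
      using pos_kernel_real_ge[OF assms(1) False] unfolding c_def r_def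
      by (intro order_trans[OF _ pos_kernel_real_ge[OF assms(1) False, unfolded add.assoc]]) auto
    have "ennreal (norm (fst x) powr \<alpha> / 2) + ennreal (norm (snd x) powr \<alpha> / 2) + 4 = ennreal c"
      unfolding c_def
      by (simp add: add_divide_distrib)
    moreover have "pos_kernel \<alpha> (fst x) (snd x) = ennreal (- ln (r x) + c)"
      using False by (simp add: pos_kernel_def r_def c_def algebra_simps)
    moreover have "ennreal (- ln (r x) + c) + ennreal (ln (r x)) = ennreal (- ln (r x)) + ennreal c"
    proof (cases "ln (r x) \<ge> 0")
      case True
      then have "ennreal (- ln (r x) + c) + ennreal (ln (r x)) = ennreal c"
        using rc by (simp add: ennreal_plus[symmetric] del: ennreal_plus)
      then show ?thesis using True by (simp add: ennreal_neg)
    next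
      case False
      then show ?thesis using \<open>c \<ge> 0\<close> by (simp add: ennreal_neg ennreal_plus[symmetric] del: ennreal_plus)
    qed
    ultimately show ?thesis using \<open>r x > 0\<close> by (simp add: elog_def e2ennreal_ereal)
  qed
  have pos_energy: "pos_energy \<alpha> \<mu> = (\<integral>\<^sup>+x. pos_kernel \<alpha> (fst x) (snd x) \<partial>(\<mu> \<Otimes>\<^sub>M \<mu>))"
    unfolding pos_energy_def by (subst M.nn_integral_fst[symmetric]) simp_all
  have "pos_energy \<alpha> \<mu> + N = (\<integral>\<^sup>+x. pos_kernel \<alpha> (fst x) (snd x) + e2ennreal (elog (r x)) \<partial>(\<mu> \<Otimes>\<^sub>M \<mu>))"
    unfolding pos_energy N_def by (intro nn_integral_add[symmetric]) measurable
  also have "\<dots> = P + (\<integral>\<^sup>+x. ennreal (norm (fst x) powr \<alpha> / 2) + ennreal (norm (snd x) powr \<alpha> / 2) + 4 \<partial>(\<mu> \<Otimes>\<^sub>M \<mu>))"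
    unfolding pt P_def by (intro nn_integral_add) measurable
  also have "(\<integral>\<^sup>+x. ennreal (norm (fst x) powr \<alpha> / 2) + ennreal (norm (snd x) powr \<alpha> / 2) + 4 \<partial>(\<mu> \<Otimes>\<^sub>M \<mu>))
     = (\<integral>\<^sup>+z. \<integral>\<^sup>+w. ennreal (norm z powr \<alpha> / 2) + ennreal (norm w powr \<alpha> / 2) + 4 \<partial>\<mu> \<partial>\<mu>)"
    by (subst M.nn_integral_fst[symmetric]) simp_all
  also have "\<dots> = h + h + 4"
    unfolding h_def by (simp add: nn_integral_add M.emeasure_space_1)
  finally have eq: "pos_energy \<alpha> \<mu> + N = P + (h + h + 4)" .
  have "energy \<alpha> \<mu> = (enn2ereal P - enn2ereal N) + enn2ereal (h + h)"
  proof -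
    have "ereal_integral (\<mu> \<Otimes>\<^sub>M \<mu>) (\<lambda>(z, w). - elog (norm (z - w))) = enn2ereal P - enn2ereal N"
      unfolding ereal_integral_def P_def N_def r_def by (simp add: case_prod_beta)
    moreover have "ereal_integral \<mu> (\<lambda>z. ereal (norm z powr \<alpha>)) = enn2ereal (h + h)"
      unfolding ereal_integral_def q[symmetric] by (simp add: e2ennreal_ereal ennreal_neg zero_ennreal.rep_eq)
    ultimately show ?thesis unfolding energy_def by simp
  qed
  also have "\<dots> = enn2ereal (pos_energy \<alpha> \<mu>) - 4"
  proof -
    have four: "(4::ennreal) = ennreal 4" by simp
    obtain n' where n': "N = ennreal n'" "n' \<ge> 0" using N by (cases N) auto
    obtain h' where h': "h = ennreal h'" "h' \<ge> 0" using h by (cases h) auto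
    show ?thesis
    proof (cases P)
      case (real p)
      have "pos_energy \<alpha> \<mu> + ennreal n' = ennreal (p + (h' + h' + 4))"
        using eq real n' h' unfolding four by (simp add: ennreal_plus[symmetric] del: ennreal_plus ennreal_numeral)
      then obtain g where g: "pos_energy \<alpha> \<mu> = ennreal g" "g \<ge> 0"
        by (cases "pos_energy \<alpha> \<mu>") auto
      then have "ennreal (g + n') = ennreal (p + (h' + h' + 4))"
        using \<open>pos_energy \<alpha> \<mu> + ennreal n' = ennreal (p + (h' + h' + 4))\<close> n' by simp
      then have "g + n' = p + (h' + h' + 4)"
        using g n' h' real by (subst (asm) ennreal_inj) auto
      then show ?thesis
        using g n' h' real
        by (simp add: enn2ereal_ennreal ennreal_plus[symmetric] numeral_eq_ereal del: ennreal_plus)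
    next
      case top
      then have "pos_energy \<alpha> \<mu> = \<infinity>" using eq n' by (cases "pos_energy \<alpha> \<mu>") (auto simp: ennreal_plus[symmetric] simp del: ennreal_plus)
      then show ?thesis using top n' h'
        by (simp add: enn2ereal_ennreal ennreal_plus[symmetric] numeral_eq_ereal del: ennreal_plus)
    qed
  qed
  finally show ?thesis .
qed

text \<open>
  A smoothed point mass has finite energy.
\<close>

lemma exists_finite_pos_energy:
  assumes "\<alpha> \<ge> 1" "open U" "exterior_ball_condition U" "z0 \<notin> U"
  shows "\<exists>\<nu> \<in> compact_probs (- U). pos_energy \<alpha> \<nu> < \<infinity>"
proof -
  have one: "0 < (1::real)" by simp
  obtain \<delta> D :: real where \<delta>: "0 < \<delta>" "\<delta> \<le> 1"
    and sm: "\<And>\<mu> \<rho>. prob_space \<mu> \<Longrightarrow> sets \<mu> = sets borel \<Longrightarrow> AE z in \<mu>. z \<in> - U \<Longrightarrow> AE z in \<mu>. norm z \<le> \<rho> \<Longrightarrow>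
       \<exists>\<nu> \<in> compact_probs (- U).
         pos_energy \<alpha> \<nu> \<le> ennreal (1 + 1) * (\<integral>\<^sup>+z. \<integral>\<^sup>+w. ennreal (trunc_kernel \<alpha> \<delta> z w) \<partial>\<mu> \<partial>\<mu>) + ennreal 1 \<and>
         (\<forall>f\<in>borel_measurable borel. (\<integral>\<^sup>+x. f x \<partial>\<nu>) \<le> ennreal D * (\<integral>\<^sup>+x. f x \<partial>lborel))"
    using smoothing[OF assms(1-3) one] by metis
  let ?\<mu> = "return borel z0"
  have "\<exists>\<nu> \<in> compact_probs (- U).
         pos_energy \<alpha> \<nu> \<le> ennreal (1 + 1) * (\<integral>\<^sup>+z. \<integral>\<^sup>+w. ennreal (trunc_kernel \<alpha> \<delta> z w) \<partial>?\<mu> \<partial>?\<mu>) + ennreal 1 \<and>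
         (\<forall>f\<in>borel_measurable borel. (\<integral>\<^sup>+x. f x \<partial>\<nu>) \<le> ennreal D * (\<integral>\<^sup>+x. f x \<partial>lborel))"
    using assms by (intro sm[of _ "norm z0"] prob_space_return) (auto simp: AE_return Compl_eq[symmetric] pred_def)
  then obtain \<nu> where \<nu>: "\<nu> \<in> compact_probs (- U)"
    "pos_energy \<alpha> \<nu> \<le> ennreal (1 + 1) * (\<integral>\<^sup>+z. \<integral>\<^sup>+w. ennreal (trunc_kernel \<alpha> \<delta> z w) \<partial>?\<mu> \<partial>?\<mu>) + ennreal 1" by blast
  have "(\<integral>\<^sup>+z. \<integral>\<^sup>+w. ennreal (trunc_kernel \<alpha> \<delta> z w) \<partial>?\<mu> \<partial>?\<mu>) = ennreal (trunc_kernel \<alpha> \<delta> z0 z0)"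
    by (simp add: nn_integral_return)
  then have "pos_energy \<alpha> \<nu> < \<infinity>" using \<nu>(2) by (auto intro!: le_less_trans[OF \<nu>(2)] simp: ennreal_mult_less_top)
  then show ?thesis using \<nu>(1) by blast
qed

lemma min_energy_real:
  assumes "\<alpha> \<ge> 1" "open U" "exterior_ball_condition U" "z0 \<notin> U"
  obtains g where "g \<ge> 0" "min_energy \<alpha> U = ereal (g - 4)"
    "\<And>\<nu>. \<nu> \<in> compact_probs (- U) \<Longrightarrow> ennreal g \<le> pos_energy \<alpha> \<nu>"
    "\<And>\<kappa>. \<kappa> > 0 \<Longrightarrow> \<exists>\<nu> \<in> compact_probs (- U). pos_energy \<alpha> \<nu> \<le> ennreal (g + \<kappa>)"
proof -
  define \<gamma> where "\<gamma> = (INF \<nu> \<in> compact_probs (- U). pos_energy \<alpha> \<nu>)"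
  have "\<gamma> < \<infinity>" unfolding \<gamma>_def INF_less_iff by (rule exists_finite_pos_energy[OF assms])
  then obtain g where g: "\<gamma> = ennreal g" "g \<ge> 0" by (cases \<gamma>) auto
  have 1: "ennreal g \<le> pos_energy \<alpha> \<nu>" if "\<nu> \<in> compact_probs (- U)" for \<nu>
    unfolding g(1)[symmetric] \<gamma>_def using that by (rule INF_lower)
  have 2: "\<exists>\<nu> \<in> compact_probs (- U). pos_energy \<alpha> \<nu> \<le> ennreal (g + \<kappa>)" if "\<kappa> > 0" for \<kappa>
  proof -
    have "\<gamma> < ennreal (g + \<kappa>)" using that g by (simp add: ennreal_lessI)
    then show ?thesis unfolding \<gamma>_def INF_less_iff by (auto intro: less_imp_le)
  qed
  have "min_energy \<alpha> U = ereal (g - 4)"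
  proof (rule antisym)
    show "min_energy \<alpha> U \<le> ereal (g - 4)"
    proof (rule ereal_le_epsilon2)
      fix \<kappa> :: real assume "0 < \<kappa>"
      from 2[OF this] obtain \<nu> where \<nu>: "\<nu> \<in> compact_probs (- U)" "pos_energy \<alpha> \<nu> \<le> ennreal (g + \<kappa>)" by blast
      then obtain e where e: "pos_energy \<alpha> \<nu> = ennreal e" "e \<ge> 0" by (cases "pos_energy \<alpha> \<nu>") (auto simp: top_unique)
      then have "e \<le> g + \<kappa>" using \<nu>(2) g \<open>0 < \<kappa>\<close> by (simp del: ennreal_plus)
      have "min_energy \<alpha> U \<le> energy \<alpha> \<nu>" unfolding min_energy_def by (rule INF_lower) fact
      also have "\<dots> = ereal (e - 4)"
        using energy_eq_pos_energy[OF assms(1) \<nu>(1)] e by (simp add: enn2ereal_ennreal numeral_eq_ereal)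
      also have "\<dots> \<le> ereal (g - 4) + ereal \<kappa>" using \<open>e \<le> g + \<kappa>\<close> by simp
      finally show "min_energy \<alpha> U \<le> ereal (g - 4) + ereal \<kappa>" .
    qed
    show "ereal (g - 4) \<le> min_energy \<alpha> U"
      unfolding min_energy_def
    proof (rule INF_greatest)
      fix \<nu> assume \<nu>: "\<nu> \<in> compact_probs (- U)"
      have "ereal g = enn2ereal (ennreal g)" using g by (simp add: enn2ereal_ennreal)
      also have "\<dots> \<le> enn2ereal (pos_energy \<alpha> \<nu>)" using 1[OF \<nu>] by (simp add: less_eq_ennreal.rep_eq)
      finally have "ereal g - 4 \<le> enn2ereal (pos_energy \<alpha> \<nu>) - 4" by (intro ereal_minus_mono) auto
      then show "ereal (g - 4) \<le> energy \<alpha> \<nu>"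
        unfolding energy_eq_pos_energy[OF assms(1) \<nu>] by (simp add: numeral_eq_ereal)
    qed
  qed
  with that g 1 2 show ?thesis by blast
qed

lemma partfun_lower_bound:
  assumes "\<alpha> \<ge> 1" "open U" "exterior_ball_condition U" "0 \<le> g" "g < e"
    and ex: "\<And>\<kappa>. \<kappa> > 0 \<Longrightarrow> \<exists>\<nu> \<in> compact_probs (- U). pos_energy \<alpha> \<nu> \<le> ennreal (g + \<kappa>)"
  obtains q where "\<And>n. n \<ge> 1 \<Longrightarrow>
    partfun \<alpha> n U \<ge> ennreal (exp (4 * (real n)\<^sup>2 - (real n)\<^sup>2 * e - real n * q))"
proof -
  have "\<forall>\<^sub>F \<kappa> in at_right 0. (1 + \<kappa>) * (g + \<kappa>) + \<kappa> < e"
  proof (rule order_tendstoD)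
    show "((\<lambda>\<kappa>. (1 + \<kappa>) * (g + \<kappa>) + \<kappa>) \<longlongrightarrow> g) (at_right 0)" by real_asymp
  qed fact
  moreover have "\<forall>\<^sub>F \<kappa> in at_right 0. (0::real) < \<kappa>" by (rule eventually_at_right_less)
  ultimately have "\<forall>\<^sub>F \<kappa> in at_right 0. (0::real) < \<kappa> \<and> (1 + \<kappa>) * (g + \<kappa>) + \<kappa> < e"
    by eventually_elim simp
  then obtain \<kappa> :: real where \<kappa>: "\<kappa> > 0" "(1 + \<kappa>) * (g + \<kappa>) + \<kappa> < e"
    using eventually_happens'[OF trivial_limit_at_right_real] by blast
  obtain \<delta> D :: real where \<delta>: "0 < \<delta>" "\<delta> \<le> 1" "0 < D"
    and sm: "\<And>\<mu> \<rho>. prob_space \<mu> \<Longrightarrow> sets \<mu> = sets borel \<Longrightarrow> AE z in \<mu>. z \<in> - U \<Longrightarrow> AE z in \<mu>. norm z \<le> \<rho> \<Longrightarrow>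
       \<exists>\<nu> \<in> compact_probs (- U).
         pos_energy \<alpha> \<nu> \<le> ennreal (1 + \<kappa>) * (\<integral>\<^sup>+z. \<integral>\<^sup>+w. ennreal (trunc_kernel \<alpha> \<delta> z w) \<partial>\<mu> \<partial>\<mu>) + ennreal \<kappa> \<and>
         (\<forall>f\<in>borel_measurable borel. (\<integral>\<^sup>+x. f x \<partial>\<nu>) \<le> ennreal D * (\<integral>\<^sup>+x. f x \<partial>lborel))"
    using smoothing[OF assms(1-3) \<kappa>(1)] by metis
  obtain \<mu> where \<mu>: "\<mu> \<in> compact_probs (- U)" "pos_energy \<alpha> \<mu> \<le> ennreal (g + \<kappa>)" using ex[OF \<kappa>(1)] by blast
  obtain \<rho> where \<rho>: "prob_space \<mu>" "sets \<mu> = sets borel" "AE z in \<mu>. z \<in> - U" "AE z in \<mu>. norm z \<le> \<rho>"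
    using compact_probsE[OF \<mu>(1)] by metis
  obtain \<nu> where \<nu>: "\<nu> \<in> compact_probs (- U)"
    "pos_energy \<alpha> \<nu> \<le> ennreal (1 + \<kappa>) * (\<integral>\<^sup>+z. \<integral>\<^sup>+w. ennreal (trunc_kernel \<alpha> \<delta> z w) \<partial>\<mu> \<partial>\<mu>) + ennreal \<kappa>"
    "\<And>f. f \<in> borel_measurable borel \<Longrightarrow> (\<integral>\<^sup>+x. f x \<partial>\<nu>) \<le> ennreal D * (\<integral>\<^sup>+x. f x \<partial>lborel)"
    using sm[OF \<rho>] by blast
  have "(\<integral>\<^sup>+z. \<integral>\<^sup>+w. ennreal (trunc_kernel \<alpha> \<delta> z w) \<partial>\<mu> \<partial>\<mu>) \<le> pos_energy \<alpha> \<mu>"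
    unfolding pos_energy_def using \<delta> by (intro nn_integral_mono trunc_kernel_le_pos_kernel)
  also note \<mu>(2)
  finally have "pos_energy \<alpha> \<nu> \<le> ennreal (1 + \<kappa>) * ennreal (g + \<kappa>) + ennreal \<kappa>"
    by (intro order_trans[OF \<nu>(2)] add_mono mult_left_mono) auto
  also have "\<dots> = ennreal ((1 + \<kappa>) * (g + \<kappa>) + \<kappa>)"
    using \<kappa> assms(4) by (subst ennreal_plus) (auto simp: ennreal_mult)
  also have "\<dots> \<le> ennreal e" using \<kappa> by (intro ennreal_leI) auto
  finally have "pos_energy \<alpha> \<nu> \<le> ennreal e" .
  moreover have "e \<ge> 0" using assms by simp
  ultimately show ?thesis
    using partfun_ge[OF assms(1,2) \<nu>(1) _ _ \<delta>(3) \<nu>(3)] that by blast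
qed

lemma partfun_limit:
  assumes "\<alpha> \<ge> 1" "open U" "exterior_ball_condition U" "z0 \<notin> U"
    and A: "(\<integral>\<^sup>+z. ennreal (exp (- (norm (z::complex) powr \<alpha>))) \<partial>lborel) < \<infinity>"
  obtains l where "min_energy \<alpha> U = ereal (- l)"
    "(\<lambda>n. ln (enn2real (partfun \<alpha> n U)) / (real n)\<^sup>2) \<longlonglongrightarrow> l"
    "\<And>n. n \<ge> 2 \<Longrightarrow> 0 < partfun \<alpha> n U \<and> partfun \<alpha> n U < \<infinity>"
proof -
  obtain g where g: "g \<ge> 0" "min_energy \<alpha> U = ereal (g - 4)"
    "\<And>\<nu>. \<nu> \<in> compact_probs (- U) \<Longrightarrow> ennreal g \<le> pos_energy \<alpha> \<nu>"
    "\<And>\<kappa>. \<kappa> > 0 \<Longrightarrow> \<exists>\<nu> \<in> compact_probs (- U). pos_energy \<alpha> \<nu> \<le> ennreal (g + \<kappa>)"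
    using min_energy_real[OF assms(1-4)] by metis
  define Z where "Z n = enn2real (partfun \<alpha> n U)" for n
  obtain a where a: "a > 0" "(\<integral>\<^sup>+z. ennreal (exp (- (norm (z::complex) powr \<alpha>))) \<partial>lborel) \<le> ennreal a"
  proof -
    obtain a' where "a' \<ge> 0" "(\<integral>\<^sup>+z. ennreal (exp (- (norm (z::complex) powr \<alpha>))) \<partial>lborel) = ennreal a'"
      using A by (cases "\<integral>\<^sup>+z. ennreal (exp (- (norm (z::complex) powr \<alpha>))) \<partial>lborel") auto
    then show ?thesis by (intro that[of "a' + 1"]) (auto intro!: ennreal_leI simp del: ennreal_plus)
  qed
  have up: "\<exists>L. \<forall>n\<ge>2. partfun \<alpha> n U \<le>
      ennreal (exp (4 * (real n)\<^sup>2 - (1 - 2 / real n) * ((real n)\<^sup>2 * ((g - \<kappa>) / (1 + \<kappa>)) - real n * L) + real n * ln a))"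
    if \<kappa>: "\<kappa> > 0" for \<kappa>
  proof -
    obtain L where L: "\<And>n w. n \<ge> 1 \<Longrightarrow> w ` {..<n} \<subseteq> - U \<Longrightarrow> inj_on w {..<n} \<Longrightarrow>
      conf_energy \<alpha> n w \<ge> (real n)\<^sup>2 * ((g - \<kappa>) / (1 + \<kappa>)) - real n * L"
      using conf_energy_lower_bound[OF assms(1-3) \<kappa> g(3)] by metis
    show ?thesis
    proof (intro exI[of _ L] allI impI)
      fix n :: nat assume n: "2 \<le> n"
      let ?X = "(real n)\<^sup>2 * ((g - \<kappa>) / (1 + \<kappa>)) - real n * L"
      have "partfun \<alpha> n U \<le> ennreal (exp (4 * (real n)\<^sup>2 - (1 - 2 / real n) * ?X)) *
        (\<integral>\<^sup>+z. ennreal (exp (- (norm (z::complex) powr \<alpha>))) \<partial>lborel) ^ n"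
        using n by (intro partfun_le assms L) auto
      also have "\<dots> \<le> ennreal (exp (4 * (real n)\<^sup>2 - (1 - 2 / real n) * ?X)) * ennreal a ^ n"
        by (intro mult_left_mono power_mono a) auto
      also have "\<dots> = ennreal (exp (4 * (real n)\<^sup>2 - (1 - 2 / real n) * ?X) * exp (real n * ln a))"
        using a(1) by (simp add: ennreal_power ennreal_mult exp_of_nat_mult)
      also have "\<dots> = ennreal (exp (4 * (real n)\<^sup>2 - (1 - 2 / real n) * ?X + real n * ln a))"
        by (simp only: exp_add)
      finally show "partfun \<alpha> n U \<le> ennreal (exp (4 * (real n)\<^sup>2 - (1 - 2 / real n) * ?X + real n * ln a))" .
    qed
  qed
  have low: "\<exists>q. \<forall>n\<ge>1. ennreal (exp (4 * (real n)\<^sup>2 - (real n)\<^sup>2 * e - real n * q)) \<le> partfun \<alpha> n U"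
    if "g < e" for e
    using partfun_lower_bound[OF assms(1-3) g(1) that g(4)] by metis
  have one: "0 < (1::real)" by simp
  have pos: "0 < partfun \<alpha> n U \<and> partfun \<alpha> n U < \<infinity>" if "n \<ge> 2" for n
  proof
    obtain q where "\<forall>n\<ge>1. ennreal (exp (4 * (real n)\<^sup>2 - (real n)\<^sup>2 * (g + 1) - real n * q)) \<le> partfun \<alpha> n U"
      using low[of "g + 1"] by auto
    from this[rule_format, of n] that
    have "ennreal (exp (4 * (real n)\<^sup>2 - (real n)\<^sup>2 * (g + 1) - real n * q)) \<le> partfun \<alpha> n U" by simp
    moreover have "0 < ennreal (exp (4 * (real n)\<^sup>2 - (real n)\<^sup>2 * (g + 1) - real n * q))" by simp
    ultimately show "0 < partfun \<alpha> n U" by (rule less_le_trans[rotated])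
    from up[OF one] obtain L where "\<forall>n\<ge>2. partfun \<alpha> n U \<le>
      ennreal (exp (4 * (real n)\<^sup>2 - (1 - 2 / real n) * ((real n)\<^sup>2 * ((g - 1) / (1 + 1)) - real n * L) + real n * ln a))"
      by (elim exE)
    from le_less_trans[OF this[rule_format, OF that] ennreal_less_top]
    show "partfun \<alpha> n U < \<infinity>" by simp
  qed
  have Z: "partfun \<alpha> n U = ennreal (Z n)" "Z n > 0" if "n \<ge> 2" for n
    using pos[OF that] by (auto simp: Z_def enn2real_positive_iff)
  have "(\<lambda>n. ln (Z n) / (real n)\<^sup>2) \<longlonglongrightarrow> 4 - g"
  proof (rule order_tendstoI)
    fix b assume b: "4 - g < b"
    have "\<forall>\<^sub>F \<kappa> in at_right 0. 4 - (g - \<kappa>) / (1 + \<kappa>) < b"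
    proof (rule order_tendstoD)
      show "((\<lambda>\<kappa>. 4 - (g - \<kappa>) / (1 + \<kappa>)) \<longlongrightarrow> 4 - g) (at_right 0)" by real_asymp
    qed fact
    moreover have "\<forall>\<^sub>F \<kappa> in at_right 0. (0::real) < \<kappa>" by (rule eventually_at_right_less)
    ultimately have "\<forall>\<^sub>F \<kappa> in at_right 0. (0::real) < \<kappa> \<and> 4 - (g - \<kappa>) / (1 + \<kappa>) < b"
      by eventually_elim simp
    then obtain \<kappa> :: real where \<kappa>: "\<kappa> > 0" "4 - (g - \<kappa>) / (1 + \<kappa>) < b"
      using eventually_happens'[OF trivial_limit_at_right_real] by blast
    define s where "s = (g - \<kappa>) / (1 + \<kappa>)"
    obtain L where L: "\<And>n. n \<ge> 2 \<Longrightarrow> partfun \<alpha> n U \<le>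
      ennreal (exp (4 * (real n)\<^sup>2 - (1 - 2 / real n) * ((real n)\<^sup>2 * s - real n * L) + real n * ln a))"
      using up[OF \<kappa>(1)] unfolding s_def by blast
    have "\<forall>\<^sub>F n in sequentially. (4 * (real n)\<^sup>2 - (1 - 2 / real n) * ((real n)\<^sup>2 * s - real n * L) + real n * ln a) / (real n)\<^sup>2 < b"
    proof (rule order_tendstoD)
      show "(\<lambda>n. (4 * (real n)\<^sup>2 - (1 - 2 / real n) * ((real n)\<^sup>2 * s - real n * L) + real n * ln a) / (real n)\<^sup>2) \<longlonglongrightarrow> 4 - s"
        by real_asymp
    qed (use \<kappa> in \<open>simp add: s_def\<close>)
    then show "\<forall>\<^sub>F n in sequentially. ln (Z n) / (real n)\<^sup>2 < b"
      using eventually_ge_at_top[of 2]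
    proof eventually_elim
      case (elim n)
      let ?E = "4 * (real n)\<^sup>2 - (1 - 2 / real n) * ((real n)\<^sup>2 * s - real n * L) + real n * ln a"
      have "Z n \<le> exp ?E" using L[OF elim(2)] Z[OF elim(2)] by simp
      then have "ln (Z n) \<le> ?E" using ln_mono[of "Z n" "exp ?E"] Z(2)[OF elim(2)] by simp
      then have "ln (Z n) / (real n)\<^sup>2 \<le> ?E / (real n)\<^sup>2" by (intro divide_right_mono) auto
      with elim(1) show ?case by (rule le_less_trans[rotated])
    qed
  next
    fix b assume b: "b < 4 - g"
    define e where "e = (g + (4 - b)) / 2"
    have e: "g < e" "b < 4 - e" using b by (auto simp: e_def field_simps)
    obtain q where q: "\<And>n. n \<ge> 1 \<Longrightarrow> ennreal (exp (4 * (real n)\<^sup>2 - (real n)\<^sup>2 * e - real n * q)) \<le> partfun \<alpha> n U"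
      using low[OF e(1)] by blast
    have "\<forall>\<^sub>F n in sequentially. b < (4 * (real n)\<^sup>2 - (real n)\<^sup>2 * e - real n * q) / (real n)\<^sup>2"
    proof (rule order_tendstoD)
      show "(\<lambda>n. (4 * (real n)\<^sup>2 - (real n)\<^sup>2 * e - real n * q) / (real n)\<^sup>2) \<longlonglongrightarrow> 4 - e"
        by real_asymp
    qed fact
    then show "\<forall>\<^sub>F n in sequentially. b < ln (Z n) / (real n)\<^sup>2"
      using eventually_ge_at_top[of 2]
    proof eventually_elim
      case (elim n)
      let ?E = "4 * (real n)\<^sup>2 - (real n)\<^sup>2 * e - real n * q"
      have "exp ?E \<le> Z n" using q[of n] Z[OF elim(2)] elim by simp
      then have "?E \<le> ln (Z n)" using Z(2)[OF elim(2)] by (simp add: ln_ge_iff)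
      then have "?E / (real n)\<^sup>2 \<le> ln (Z n) / (real n)\<^sup>2" by (intro divide_right_mono) auto
      with elim(1) show ?case by (rule less_le_trans)
    qed
  qed
  then show ?thesis
    using g(2) pos unfolding Z_def by (intro that[of "4 - g"]) auto
qed

section \<open>The determinantal density\<close>

text \<open>\<open>det\<close> without a prefix may denote the determinant of a matrix indexed by finite types.\<close>

abbreviation "mdet \<equiv> Determinant.det"

text \<open>
  A unipotent column operation replaces the last column by the values of the monic polynomial that
  vanishes at all points but the last.
\<close>

lemma det_vandermonde:
  fixes x :: "nat \<Rightarrow> 'a :: field"
  shows "mdet (Matrix.mat n n (\<lambda>(i, j). x i ^ j)) = (\<Prod>i<n. \<Prod>j<i. x i - x j)"
proof (induction n)
  case 0
  show ?case by (subst det_dim_zero[of _]) auto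
next
  case (Suc n)
  define q where "q = (\<Prod>j<n. [:- x j, 1:])"
  have deg: "degree q = n"
    unfolding q_def by (subst degree_prod_eq_sum_degree) auto
  have lead: "coeff q n = 1"
    using lead_coeff_prod[of "\<lambda>j. [:- x j, 1:]" "{..<n}"] deg by (simp add: q_def)
  have pq: "poly q y = (\<Prod>j<n. y - x j)" for y
    by (simp add: q_def poly_prod)
  define V where "V = Matrix.mat (Suc n) (Suc n) (\<lambda>(i, j). x i ^ j)"
  define T where "T = Matrix.mat (Suc n) (Suc n) (\<lambda>(k, j). if j < n then (if k = j then 1 else 0) else coeff q k)"
  define W where "W = Matrix.mat (Suc n) (Suc n) (\<lambda>(i, j). if j < n then x i ^ j else poly q (x i))"
  have carrier: "V \<in> carrier_mat (Suc n) (Suc n)" "T \<in> carrier_mat (Suc n) (Suc n)" "W \<in> carrier_mat (Suc n) (Suc n)"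
    by (auto simp: V_def T_def W_def)
  have "mdet T = 1"
  proof -
    have "upper_triangular T" unfolding upper_triangular_def by (auto simp: T_def)
    then have "mdet T = prod_list (diag_mat T)" using carrier(2) by (rule det_upper_triangular)
    also have "\<dots> = (\<Prod>i\<in>{0..<Suc n}. T $$ (i, i))" using carrier(2) by (simp add: prod_list_diag_prod)
    also have "\<dots> = 1" using lead by (intro prod.neutral) (auto simp: T_def less_Suc_eq)
    finally show ?thesis .
  qed
  moreover have "V * T = W"
  proof (rule eq_matI)
    fix i j assume "i < dim_row W" "j < dim_col W"
    then have ij: "i < Suc n" "j < Suc n" by (auto simp: W_def)
    have "(V * T) $$ (i, j) = (\<Sum>k\<in>{0..<Suc n}. x i ^ k * (if j < n then (if k = j then 1 else 0) else coeff q k))"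
      using ij by (simp add: V_def T_def scalar_prod_def)
    also have "\<dots> = W $$ (i, j)"
    proof (cases "j < n")
      case True
      then have "(\<Sum>k\<in>{0..<Suc n}. x i ^ k * (if j < n then (if k = j then 1 else 0) else coeff q k)) =
        (\<Sum>k\<in>{0..<Suc n}. if k = j then x i ^ k else 0)" by (intro sum.cong) auto
      also have "\<dots> = x i ^ j" using ij by simp
      finally show ?thesis using True ij by (simp add: W_def)
    next
      case False
      then have "(\<Sum>k\<in>{0..<Suc n}. x i ^ k * (if j < n then (if k = j then 1 else 0) else coeff q k)) =
        (\<Sum>k\<le>degree q. coeff q k * x i ^ k)" by (intro sum.cong) (auto simp: deg)
      also have "\<dots> = poly q (x i)" by (simp add: poly_altdef)
      finally show ?thesis using False ij by (simp add: W_def)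
    qed
    finally show "(V * T) $$ (i, j) = W $$ (i, j)" .
  qed (auto simp: V_def T_def W_def)
  ultimately have "mdet V = mdet W" using det_mult[OF carrier(1,2)] by simp
  also have "\<dots> = (\<Sum>i<Suc n. W $$ (i, n) * cofactor W i n)"
    by (rule laplace_expansion_column[OF carrier(3)]) simp
  also have "\<dots> = (\<Sum>i<n. W $$ (i, n) * cofactor W i n) + W $$ (n, n) * cofactor W n n" by simp
  also have "(\<Sum>i<n. W $$ (i, n) * cofactor W i n) = 0"
    by (intro sum.neutral) (auto simp: W_def pq)
  also have "cofactor W n n = mdet (Matrix.mat n n (\<lambda>(i, j). x i ^ j))"
  proof -
    have "mat_delete W n n = Matrix.mat n n (\<lambda>(i, j). x i ^ j)"
      unfolding mat_delete_def by (rule eq_matI) (auto simp: W_def)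
    moreover have "even (n + n)" by simp
    ultimately show ?thesis unfolding cofactor_def by simp
  qed
  finally show ?case unfolding V_def[symmetric] by (simp add: Suc.IH W_def pq mult.commute)
qed

lemma det_scale_rows_columns:
  fixes a b :: "nat \<Rightarrow> 'a :: comm_ring_1"
  shows "mdet (Matrix.mat n n (\<lambda>(i, j). a i * f i j * b j)) =
    (\<Prod>i<n. a i) * (\<Prod>i<n. b i) * mdet (Matrix.mat n n (\<lambda>(i, j). f i j))"
proof -
  have "signof p * (\<Prod>i = 0..<n. Matrix.mat n n (\<lambda>(i, j). a i * f i j * b j) $$ (i, p i)) =
     (\<Prod>i<n. a i) * (\<Prod>i<n. b i) * (signof p * (\<Prod>i = 0..<n. Matrix.mat n n (\<lambda>(i, j). f i j) $$ (i, p i)))"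
    if p: "p permutes {0..<n}" for p
  proof -
    have pi: "p i < n" if "i < n" for i using permutes_in_image[OF p, of i] that by simp
    have "(\<Prod>i = 0..<n. Matrix.mat n n (\<lambda>(i, j). a i * f i j * b j) $$ (i, p i)) =
      (\<Prod>i = 0..<n. a i * b (p i) * f i (p i))"
      using pi by (intro prod.cong) (auto simp: mult_ac)
    also have "\<dots> = (\<Prod>i = 0..<n. a i) * (\<Prod>i = 0..<n. b (p i)) * (\<Prod>i = 0..<n. f i (p i))"
      by (simp add: prod.distrib)
    also have "(\<Prod>i = 0..<n. b (p i)) = (\<Prod>i = 0..<n. b i)"
      using prod.permute[OF p, of b] by (simp add: comp_def)
    also have "(\<Prod>i = 0..<n. f i (p i)) = (\<Prod>i = 0..<n. Matrix.mat n n (\<lambda>(i, j). f i j) $$ (i, p i))"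
      using pi by (intro prod.cong) auto
    finally show ?thesis by (simp add: atLeast0LessThan mult_ac)
  qed
  then show ?thesis
    by (subst (1 2) det_def'[of _ n]) (auto simp: sum_distrib_left intro!: sum.cong)
qed

text \<open>
  Up to scaling of rows and columns the kernel matrix is the product of a Vandermonde matrix and its
  conjugate transpose.
\<close>

lemma det_kernel_alpha:
  fixes z :: "nat \<Rightarrow> complex"
  shows "mdet (Matrix.mat n n (\<lambda>(i, j). kernel_alpha \<alpha> n (z i) (z j))) =
    of_real ((\<Prod>k<n. \<alpha> / (2 * pi) / Gamma (2 / \<alpha> * (real k + 1))) *
      ((\<Prod>i<n. \<Prod>j<i. (norm (z i - z j))\<^sup>2) * exp (- (\<Sum>i<n. norm (z i) powr \<alpha>))))"
proof -
  define e where "e i = complex_of_real (exp (- (norm (z i) powr \<alpha>) / 2))" for i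
  define c where "c k = complex_of_real (\<alpha> / (2 * pi) / Gamma (2 / \<alpha> * (real k + 1)))" for k
  define V where "V = Matrix.mat n n (\<lambda>(i, k). z i ^ k)"
  define V' where "V' = Matrix.mat n n (\<lambda>(k, j). c k * cnj (z j) ^ k * 1)"
  have carrier: "V \<in> carrier_mat n n" "V' \<in> carrier_mat n n" by (auto simp: V_def V'_def)
  have "Matrix.mat n n (\<lambda>(i, j). kernel_alpha \<alpha> n (z i) (z j)) =
    Matrix.mat n n (\<lambda>(i, j). e i * (\<Sum>k<n. c k * (z i * cnj (z j)) ^ k) * e j)"
  proof (rule cong_mat[OF refl refl], clarsimp)
    fix i j
    have "exp (- (norm (z i) powr \<alpha>) / 2 - norm (z j) powr \<alpha> / 2) =
       exp (- (norm (z i) powr \<alpha>) / 2) * exp (- (norm (z j) powr \<alpha>) / 2)"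
      by (simp add: exp_add[symmetric])
    then show "kernel_alpha \<alpha> n (z i) (z j) = e i * (\<Sum>k<n. c k * (z i * cnj (z j)) ^ k) * e j"
      by (simp add: kernel_alpha_def e_def c_def sum_distrib_left sum_distrib_right mult_ac)
  qed
  also have "mdet \<dots> = (\<Prod>i<n. e i) * (\<Prod>i<n. e i) *
     mdet (Matrix.mat n n (\<lambda>(i, j). \<Sum>k<n. c k * (z i * cnj (z j)) ^ k))"
    by (rule det_scale_rows_columns)
  also have "Matrix.mat n n (\<lambda>(i, j). \<Sum>k<n. c k * (z i * cnj (z j)) ^ k) = V * V'"
    by (rule eq_matI) (auto simp: V_def V'_def scalar_prod_def power_mult_distrib atLeast0LessThan mult_ac intro!: sum.cong)
  also have "mdet (V * V') = mdet V * mdet V'" by (rule det_mult[OF carrier])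
  also have "mdet V = (\<Prod>i<n. \<Prod>j<i. z i - z j)" unfolding V_def by (rule det_vandermonde)
  also have "mdet V' = (\<Prod>k<n. c k) * (\<Prod>k<n. 1) * mdet (Matrix.mat n n (\<lambda>(k, j). cnj (z j) ^ k))"
    unfolding V'_def by (rule det_scale_rows_columns)
  also have "Matrix.mat n n (\<lambda>(k, j). cnj (z j) ^ k) = transpose_mat (Matrix.mat n n (\<lambda>(i, j). cnj (z i) ^ j))"
    by (rule eq_matI) auto
  also have "mdet \<dots> = mdet (Matrix.mat n n (\<lambda>(i, j). cnj (z i) ^ j))"
    by (rule det_transpose[of _ n]) auto
  also have "\<dots> = (\<Prod>i<n. \<Prod>j<i. cnj (z i) - cnj (z j))" by (rule det_vandermonde)
  finally have "mdet (Matrix.mat n n (\<lambda>(i, j). kernel_alpha \<alpha> n (z i) (z j))) =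
     (\<Prod>k<n. c k) * ((\<Prod>i<n. \<Prod>j<i. (z i - z j) * cnj (z i - z j)) * (\<Prod>i<n. e i * e i))"
    by (simp add: prod.distrib mult_ac)
  moreover have "(z i - z j) * cnj (z i - z j) = of_real ((norm (z i - z j))\<^sup>2)" for i j
    by (rule complex_norm_square[symmetric])
  moreover have "(\<Prod>i<n. e i * e i) = of_real (exp (- (\<Sum>i<n. norm (z i) powr \<alpha>)))"
  proof -
    have "e i * e i = of_real (exp (- (norm (z i) powr \<alpha>)))" for i
      by (simp add: e_def of_real_mult[symmetric] exp_add[symmetric] del: of_real_mult of_real_exp)
    then show ?thesis by (simp add: exp_sum[symmetric] sum_negf of_real_prod[symmetric] del: of_real_prod of_real_exp)
  qed
  ultimately show ?thesis by (simp add: c_def del: complex_cnj_diff)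
qed

section \<open>Void probabilities\<close>

lemma nn_integral_PiM_lborel_scale:
  fixes f :: "(nat \<Rightarrow> complex) \<Rightarrow> ennreal"
  assumes "c > 0" and f: "f \<in> borel_measurable (\<Pi>\<^sub>M i\<in>{..<n}. lborel)"
  shows "(\<integral>\<^sup>+z. f z \<partial>(\<Pi>\<^sub>M i\<in>{..<n}. lborel)) =
    ennreal (c ^ (2 * n)) * (\<integral>\<^sup>+w. f (\<lambda>i\<in>{..<n}. of_real c * w i) \<partial>(\<Pi>\<^sub>M i\<in>{..<n}. lborel))"
proof -
  interpret product_sigma_finite "\<lambda>_::nat. lborel :: complex measure" ..
  let ?P = "\<Pi>\<^sub>M i\<in>{..<n}. (lborel :: complex measure)"
  let ?T = "\<lambda>w. \<lambda>i\<in>{..<n}. complex_of_real c * w i"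
  have T [measurable]: "?T \<in> measurable ?P ?P"
    by (rule measurable_restrict) measurable
  have sc: "emeasure lborel A = ennreal (c\<^sup>2) * emeasure lborel ((\<lambda>z. complex_of_real c * z) -` A)"
    if [measurable]: "A \<in> sets borel" for A
  proof -
    have "emeasure lborel A = emeasure (density (distr lborel borel (\<lambda>x. 0 + c *\<^sub>R x)) (\<lambda>_. ennreal (\<bar>c\<bar> ^ DIM(complex)))) A"
      using assms by (subst lborel_affine[of c 0]) auto
    also have "\<dots> = ennreal (c\<^sup>2) * emeasure (distr lborel borel (\<lambda>x::complex. c *\<^sub>R x)) A"
      using assms by (subst emeasure_density_const) auto
    also have "emeasure (distr lborel borel (\<lambda>x::complex. c *\<^sub>R x)) A = emeasure lborel ((\<lambda>z. complex_of_real c * z) -` A)"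
      by (subst emeasure_distr) (auto simp: scaleR_conv_of_real[abs_def])
    finally show ?thesis .
  qed
  have "scale_measure (ennreal (c ^ (2 * n))) (distr ?P ?P ?T) = ?P"
  proof (rule PiM_eqI)
    fix A :: "nat \<Rightarrow> complex set" assume A: "\<And>i. i \<in> {..<n} \<Longrightarrow> A i \<in> sets lborel"
    have m: "(\<lambda>z. complex_of_real c * z) -` A i \<in> sets borel" if "i < n" for i
      using measurable_sets[of "\<lambda>z. complex_of_real c * z" borel borel "A i"] A[of i] that by simp
    have "emeasure (scale_measure (ennreal (c ^ (2 * n))) (distr ?P ?P ?T)) (Pi\<^sub>E {..<n} A) =
      ennreal (c ^ (2 * n)) * emeasure ?P (?T -` Pi\<^sub>E {..<n} A \<inter> space ?P)"
      using A by (simp add: emeasure_distr sets_PiM_I_finite)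
    also have "?T -` Pi\<^sub>E {..<n} A \<inter> space ?P = Pi\<^sub>E {..<n} (\<lambda>i. (\<lambda>z. complex_of_real c * z) -` A i)"
      by (auto simp: space_PiM PiE_iff)
    also have "emeasure ?P \<dots> = (\<Prod>i<n. emeasure lborel ((\<lambda>z. complex_of_real c * z) -` A i))"
      using m by (intro emeasure_PiM) auto
    also have "ennreal (c ^ (2 * n)) * \<dots> = (\<Prod>i<n. ennreal (c\<^sup>2) * emeasure lborel ((\<lambda>z. complex_of_real c * z) -` A i))"
      using assms by (simp add: prod.distrib power_mult ennreal_power)
    also have "\<dots> = (\<Prod>i<n. emeasure lborel (A i))"
      using A by (intro prod.cong refl sc[symmetric]) auto
    finally show "emeasure (scale_measure (ennreal (c ^ (2 * n))) (distr ?P ?P ?T)) (Pi\<^sub>E {..<n} A)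
      = (\<Prod>i<n. emeasure lborel (A i))" .
  qed auto
  then have "(\<integral>\<^sup>+z. f z \<partial>?P) = (\<integral>\<^sup>+z. f z \<partial>scale_measure (ennreal (c ^ (2 * n))) (distr ?P ?P ?T))"
    by simp
  also have "\<dots> = ennreal (c ^ (2 * n)) * (\<integral>\<^sup>+z. f z \<partial>distr ?P ?P ?T)"
  proof (rule nn_integral_scale_measure)
    show "f \<in> borel_measurable (distr ?P ?P ?T)"
      by (subst measurable_distr_eq1) (rule f)
  qed
  also have "(\<integral>\<^sup>+z. f z \<partial>distr ?P ?P ?T) = (\<integral>\<^sup>+w. f (?T w) \<partial>?P)"
    by (rule nn_integral_distr[OF T]) (subst measurable_distr_eq1, rule f)
  finally show ?thesis .
qed

text \<open>
  The normalizing constant of the determinantal density times the powers of \<open>n^(1/\<alpha>)\<close> that the rescaling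
  of the Vandermonde product and of Lebesgue measure produces. It cancels in the end.
\<close>

definition norm_const :: "real \<Rightarrow> nat \<Rightarrow> real" where
  "norm_const \<alpha> n = (\<Prod>k<n. \<alpha> / (2 * pi) / Gamma (2 / \<alpha> * (real k + 1))) *
     (real n powr (1 / \<alpha>)) ^ (n * (n - 1) + 2 * n)"

lemma norm_const_pos:
  assumes "\<alpha> > 0" "n \<ge> 1"
  shows "norm_const \<alpha> n > 0"
  unfolding norm_const_def using assms
  by (intro mult_pos_pos prod_pos zero_less_power divide_pos_pos ballI Gamma_real_pos) auto

lemma prod_lower_triangle_const:
  fixes c :: "'a :: comm_monoid_mult"
  shows "(\<Prod>i<n. \<Prod>j<i. c * c) = c ^ (n * (n - 1))"
  by (simp only: prod_lower_triangle_square) (simp add: power_mult[symmetric] mult.commute)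

lemma count_injections_avoiding:
  assumes "finite S" "card S = n"
  shows "emeasure (count_space UNIV) {x \<in> {..<n} \<rightarrow>\<^sub>E - V. inj_on x {..<n} \<and> x ` {..<n} \<subseteq> S} =
    (if S \<inter> V = {} then ennreal (fact n) else 0)"
proof (cases "S \<inter> V = {}")
  case True
  then have "{x \<in> {..<n} \<rightarrow>\<^sub>E - V. inj_on x {..<n} \<and> x ` {..<n} \<subseteq> S} = {x \<in> {..<n} \<rightarrow>\<^sub>E S. inj_on x {..<n}}"
    by (auto simp: PiE_iff image_subset_iff disjoint_iff)
  moreover have "finite {x \<in> {..<n} \<rightarrow>\<^sub>E S. inj_on x {..<n}}"
    using assms by (intro finite_subset[OF _ finite_PiE[of "{..<n}" "\<lambda>_. S"]]) auto
  moreover have "card {x \<in> {..<n} \<rightarrow>\<^sub>E S. inj_on x {..<n}} = fact n"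
    using assms by (subst card_inj_on_subset_funcset) (auto simp: fact_prod_rev atLeast0LessThan)
  ultimately show ?thesis using True by (simp add: ennreal_of_nat_eq_real_of_nat)
next
  case False
  have empty: "{x \<in> {..<n} \<rightarrow>\<^sub>E - V. inj_on x {..<n} \<and> x ` {..<n} \<subseteq> S} = {}"
  proof (rule ccontr)
    assume "\<not> ?thesis"
    then obtain x where x: "x \<in> {..<n} \<rightarrow>\<^sub>E - V" "inj_on x {..<n}" "x ` {..<n} \<subseteq> S" by auto
    have "x ` {..<n} = S"
      using assms x by (intro card_subset_eq) (auto simp: card_image)
    moreover have "x ` {..<n} \<subseteq> - V" using x(1) by (auto simp: PiE_iff)
    ultimately show False using False by auto
  qed
  show ?thesis unfolding empty using False by simp
qed

text \<open>
  The \<open>n\<close>-th joint intensity, integrated over all \<open>n\<close>-tuples outside \<open>V\<close>, gives \<open>n!\<close> times the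
  probability that \<open>V\<close> contains no point: when there are \<open>n\<close> points in all, a tuple of \<open>n\<close> distinct
  points lists all of them.
\<close>

lemma void_probability:
  assumes "\<alpha> > 0" "n \<ge> 1" "open U" "bounded U" and P: "alpha_process \<alpha> n M X"
  defines "V \<equiv> (\<lambda>z. of_real (real n powr (1 / \<alpha>)) * z) ` U"
  shows "ennreal (fact n) * emeasure M {\<omega> \<in> space M. num_points X V \<omega> = 0} =
    ennreal (norm_const \<alpha> n) * partfun \<alpha> n U"
proof -
  let ?c = "real n powr (1 / \<alpha>)" and ?L = "\<Pi>\<^sub>M i\<in>{..<n}. (lborel :: complex measure)"
  define c where "c = ?c"
  have "c > 0" using assms by (simp add: c_def)
  have cpow: "c powr \<alpha> = real n" using assms by (simp add: c_def powr_powr)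
  have mem: "of_real c * z \<in> V \<longleftrightarrow> z \<in> U" for z
    using \<open>c > 0\<close> by (auto simp: V_def c_def)
  have "open V"
    using open_scaling[of c U] \<open>c > 0\<close> \<open>open U\<close>
    by (simp add: V_def c_def scaleR_conv_of_real)
  have "bounded V"
    using bounded_linear_image[OF \<open>bounded U\<close> bounded_linear_mult_right[of "of_real ?c :: complex"]]
    by (simp add: V_def)
  have Vb: "V \<in> sets borel" using \<open>open V\<close> by simp
  from P obtain \<rho> where
    pp: "point_process M X"
    and ji: "joint_intensity M X n (\<rho> n)"
    and \<rho>: "\<And>x. x \<in> {..<n} \<rightarrow>\<^sub>E UNIV \<Longrightarrow> complex_of_real (\<rho> n x) =
       mdet (Matrix.mat n n (\<lambda>(i, j). kernel_alpha \<alpha> n (x i) (x j)))"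
    and AE: "AE \<omega> in M. finite (X \<omega>) \<and> card (X \<omega>) = n"
    unfolding alpha_process_def determinantal_process_def by blast
  define E where "E = {\<omega> \<in> space M. num_points X V \<omega> = 0}"
  have fin: "finite (X \<omega> \<inter> V)" if "\<omega> \<in> space M" for \<omega>
    using pp Vb \<open>bounded V\<close> that unfolding point_process_def by blast
  have "num_points X V \<in> measurable M (count_space UNIV)"
    using pp Vb \<open>bounded V\<close> unfolding point_process_def by blast
  then have E [measurable]: "E \<in> sets M" unfolding E_def by measurable
  have A: "({..<n} \<rightarrow>\<^sub>E - V) \<in> sets ?L" using Vb by (intro sets_PiM_I_finite) auto
  define C where "C = (\<Prod>k<n. \<alpha> / (2 * pi) / Gamma (2 / \<alpha> * (real k + 1)))"
  define g where "g z = (\<Prod>i<n. \<Prod>j<i. (norm (z i - z j))\<^sup>2) * exp (- (\<Sum>i<n. norm (z i :: complex) powr \<alpha>))" for z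
  have \<rho>': "\<rho> n x = C * g x" if "x \<in> {..<n} \<rightarrow>\<^sub>E UNIV" for x
    using \<rho>[OF that] unfolding det_kernel_alpha C_def g_def of_real_eq_iff .
  have "C > 0" unfolding C_def using assms
    by (intro prod_pos ballI divide_pos_pos Gamma_real_pos) auto
  have [measurable]: "\<rho> n \<in> borel_measurable ?L" using ji unfolding joint_intensity_def by blast
  have "ennreal (fact n) * emeasure M E = (\<integral>\<^sup>+\<omega>. ennreal (fact n) * indicator E \<omega> \<partial>M)"
    by (simp add: nn_integral_cmult_indicator)
  also have "\<dots> = (\<integral>\<^sup>+\<omega>. emeasure (count_space UNIV)
      {x \<in> {..<n} \<rightarrow>\<^sub>E - V. inj_on x {..<n} \<and> x ` {..<n} \<subseteq> X \<omega>} \<partial>M)"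
  proof (rule nn_integral_cong_AE)
    from AE AE_space[of M]
    show "AE \<omega> in M. ennreal (fact n) * indicator E \<omega> = emeasure (count_space UNIV)
      {x \<in> {..<n} \<rightarrow>\<^sub>E - V. inj_on x {..<n} \<and> x ` {..<n} \<subseteq> X \<omega>}"
    proof eventually_elim
      case (elim \<omega>)
      then have "\<omega> \<in> E \<longleftrightarrow> X \<omega> \<inter> V = {}"
        using fin[of \<omega>] by (auto simp: E_def num_points_def card_eq_0_iff)
      then show ?case
        using elim by (subst count_injections_avoiding) (auto simp: indicator_def)
    qed
  qed
  also have "\<dots> = (\<integral>\<^sup>+x\<in>({..<n} \<rightarrow>\<^sub>E - V). ennreal (\<rho> n x) \<partial>?L)"
    using ji A unfolding joint_intensity_def by blast
  also have "\<dots> = ennreal (c ^ (2 * n)) *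
      (\<integral>\<^sup>+w. (ennreal (\<rho> n (\<lambda>i\<in>{..<n}. of_real c * w i)) *
         indicator ({..<n} \<rightarrow>\<^sub>E - V) (\<lambda>i\<in>{..<n}. of_real c * w i)) \<partial>?L)"
    by (intro nn_integral_PiM_lborel_scale \<open>c > 0\<close> borel_measurable_times_ennreal
      borel_measurable_indicator A) measurable
  also have "(\<integral>\<^sup>+w. (ennreal (\<rho> n (\<lambda>i\<in>{..<n}. of_real c * w i)) *
         indicator ({..<n} \<rightarrow>\<^sub>E - V) (\<lambda>i\<in>{..<n}. of_real c * w i)) \<partial>?L) =
      (\<integral>\<^sup>+w. ennreal (C * c ^ (n * (n - 1))) * (ennreal (weight \<alpha> n w) * indicator ({..<n} \<rightarrow>\<^sub>E - U) w) \<partial>?L)"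
  proof (rule nn_integral_cong)
    fix w assume w: "w \<in> space ?L"
    let ?w = "\<lambda>i\<in>{..<n}. of_real c * w i"
    have ind: "indicator ({..<n} \<rightarrow>\<^sub>E - V) ?w = (indicator ({..<n} \<rightarrow>\<^sub>E - U) w :: ennreal)"
      using w mem by (auto simp: indicator_def space_PiM PiE_iff)
    have "\<rho> n ?w = C * g ?w" by (rule \<rho>') auto
    also have "g ?w = c ^ (n * (n - 1)) * weight \<alpha> n w"
    proof -
      have "(\<Prod>i<n. \<Prod>j<i. (norm (?w i - ?w j))\<^sup>2) = (\<Prod>i<n. \<Prod>j<i. (c * c) * (norm (w i - w j))\<^sup>2)"
        using \<open>c > 0\<close> by (intro prod.cong refl)
          (simp add: right_diff_distrib[symmetric] norm_mult power_mult_distrib power2_eq_square)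
      also have "\<dots> = c ^ (n * (n - 1)) * (\<Prod>i<n. \<Prod>j<i. (norm (w i - w j))\<^sup>2)"
        by (simp only: prod.distrib[of "\<lambda>_. c * c"] prod.distrib[of "\<lambda>i. \<Prod>j<i. c * c"]
          prod_lower_triangle_const)
      finally have 1: "(\<Prod>i<n. \<Prod>j<i. (norm (?w i - ?w j))\<^sup>2) = c ^ (n * (n - 1)) * (\<Prod>i<n. \<Prod>j<i. (norm (w i - w j))\<^sup>2)" .
      have "(\<Sum>i<n. norm (?w i) powr \<alpha>) = (\<Sum>i<n. real n * norm (w i) powr \<alpha>)"
        using \<open>c > 0\<close> by (intro sum.cong refl) (simp add: norm_mult powr_mult cpow)
      then show ?thesis unfolding g_def weight_def 1 by (simp add: sum_distrib_left)
    qed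
    finally have \<rho>w: "\<rho> n ?w = C * (c ^ (n * (n - 1)) * weight \<alpha> n w)" .
    have "ennreal (\<rho> n ?w) = ennreal (C * c ^ (n * (n - 1))) * ennreal (weight \<alpha> n w)"
      unfolding \<rho>w using \<open>C > 0\<close> \<open>c > 0\<close> weight_nonneg
      by (simp add: ennreal_mult[symmetric] mult.assoc)
    then show "ennreal (\<rho> n ?w) * indicator ({..<n} \<rightarrow>\<^sub>E - V) ?w =
       ennreal (C * c ^ (n * (n - 1))) * (ennreal (weight \<alpha> n w) * indicator ({..<n} \<rightarrow>\<^sub>E - U) w)"
      unfolding ind by (simp add: mult.assoc)
  qed
  also have "\<dots> = ennreal (C * c ^ (n * (n - 1))) * partfun \<alpha> n U"
    unfolding partfun_def
  proof (rule nn_integral_cmult)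
    have "sets ?L = sets (\<Pi>\<^sub>M i\<in>{..<n}. borel)" by (intro sets_PiM_cong) auto
    then have [measurable]: "weight \<alpha> n \<in> borel_measurable ?L"
      using measurable_weight measurable_cong_sets by blast
    have "({..<n} \<rightarrow>\<^sub>E - U) \<in> sets ?L" using \<open>open U\<close> by (intro sets_PiM_I_finite) auto
    then show "(\<lambda>w. ennreal (weight \<alpha> n w) * indicator ({..<n} \<rightarrow>\<^sub>E - U) w) \<in> borel_measurable ?L"
      by measurable
  qed
  also have "ennreal (c ^ (2 * n)) * (ennreal (C * c ^ (n * (n - 1))) * partfun \<alpha> n U) =
      ennreal (norm_const \<alpha> n) * partfun \<alpha> n U"
  proof -
    have "norm_const \<alpha> n = c ^ (2 * n) * (C * c ^ (n * (n - 1)))"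
      unfolding norm_const_def C_def c_def power_add by (simp only: mult_ac)
    moreover have "0 \<le> c ^ (2 * n)" "0 \<le> C * c ^ (n * (n - 1))" using \<open>C > 0\<close> \<open>c > 0\<close> by simp_all
    ultimately show ?thesis by (simp only: ennreal_mult mult.assoc)
  qed
  finally show ?thesis unfolding E_def .
qed

theorem theorem3p13:
  fixes \<alpha> :: real and U :: "complex set"
    and M :: "nat \<Rightarrow> 'a measure" and X :: "nat \<Rightarrow> 'a \<Rightarrow> complex set"
  assumes "\<alpha> \<ge> 1"
    and "open U"
    and "U \<subseteq> ball 0 ((2 / \<alpha>) powr (1 / \<alpha>))"
    and "exterior_ball_condition U"
    and "\<And>n. n \<ge> 1 \<Longrightarrow> alpha_process \<alpha> n (M n) (X n)"
  shows "(\<lambda>n. elog (measure (M n) {\<omega> \<in> space (M n).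
              num_points (X n) ((\<lambda>z. of_real (real n powr (1 / \<alpha>)) * z) ` U) \<omega> = 0})
            / ereal ((real n)\<^sup>2))
         \<longlonglongrightarrow> min_energy \<alpha> {} - min_energy \<alpha> U"
proof -
  have bd: "bounded U" using assms(3) bounded_ball bounded_subset by blast
  \<comment> \<open>a point of the circle around the open disk that contains \<open>U\<close>\<close>
  define z0 where "z0 = complex_of_real ((2 / \<alpha>) powr (1 / \<alpha>))"
  have z0: "z0 \<notin> U" using assms(1,3) by (auto simp: z0_def)
  have \<alpha>: "\<alpha> > 0" using assms(1) by simp
  have empty: "open ({} :: complex set)" "bounded ({} :: complex set)" "exterior_ball_condition {}" "z0 \<notin> {}"
    by (auto simp: exterior_ball_condition_def intro: exI[of _ 1])
  define V where "V n = (\<lambda>z. of_real (real n powr (1 / \<alpha>)) * z) ` U" for n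
  define p where "p n = measure (M n) {\<omega> \<in> space (M n). num_points (X n) (V n) \<omega> = 0}" for n
  have prob: "prob_space (M n)" if "n \<ge> 1" for n
    using assms(5)[OF that] unfolding alpha_process_def determinantal_process_def point_process_def by blast
  have void: "ennreal (fact n) * ennreal (p n) = ennreal (norm_const \<alpha> n) * partfun \<alpha> n U" if n: "n \<ge> 1" for n
  proof -
    interpret prob_space "M n" using n by (rule prob)
    show ?thesis
      using void_probability[OF \<alpha> n assms(2) bd assms(5)[OF n]]
      unfolding p_def V_def emeasure_eq_measure .
  qed
  have total: "ennreal (fact n) = ennreal (norm_const \<alpha> n) * partfun \<alpha> n {}" if n: "n \<ge> 1" for n
  proof -
    interpret prob_space "M n" using n by (rule prob)
    show ?thesis
      using void_probability[OF \<alpha> n empty(1,2) assms(5)[OF n]]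
      by (simp add: num_points_def emeasure_space_1)
  qed
  \<comment> \<open>for one point the partition function with \<open>U = \<emptyset>\<close> is the total mass of \<open>e^(-\<bar>z\<bar>^\<alpha>)\<close>\<close>
  have A: "(\<integral>\<^sup>+z. ennreal (exp (- (norm (z::complex) powr \<alpha>))) \<partial>lborel) < \<infinity>"
  proof -
    interpret product_sigma_finite "\<lambda>_::nat. lborel :: complex measure" ..
    have one: "{..<1} = {0::nat}" by auto
    have "partfun \<alpha> 1 {} = (\<integral>\<^sup>+w. ennreal (exp (- (norm (w 0 :: complex) powr \<alpha>))) \<partial>(\<Pi>\<^sub>M i\<in>{0::nat}. lborel))"
      unfolding partfun_def one
      by (intro nn_integral_cong) (auto simp: weight_def space_PiM one indicator_def)
    also have "\<dots> = (\<integral>\<^sup>+z. ennreal (exp (- (norm (z::complex) powr \<alpha>))) \<partial>lborel)"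
      by (rule product_nn_integral_singleton) measurable
    finally have "ennreal (norm_const \<alpha> 1) * (\<integral>\<^sup>+z. ennreal (exp (- (norm (z::complex) powr \<alpha>))) \<partial>lborel) = 1"
      using total[of 1] by simp
    then show ?thesis
      using norm_const_pos[OF \<alpha>, of 1]
      by (cases "\<integral>\<^sup>+z. ennreal (exp (- (norm (z::complex) powr \<alpha>))) \<partial>lborel") (auto simp: ennreal_mult_top)
  qed
  obtain l where l: "min_energy \<alpha> U = ereal (- l)"
    "(\<lambda>n. ln (enn2real (partfun \<alpha> n U)) / (real n)\<^sup>2) \<longlonglongrightarrow> l"
    "\<And>n. n \<ge> 2 \<Longrightarrow> 0 < partfun \<alpha> n U \<and> partfun \<alpha> n U < \<infinity>"
    by (rule partfun_limit[OF assms(1,2,4) z0 A]) (rule that)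
  obtain l0 where l0: "min_energy \<alpha> {} = ereal (- l0)"
    "(\<lambda>n. ln (enn2real (partfun \<alpha> n {})) / (real n)\<^sup>2) \<longlonglongrightarrow> l0"
    "\<And>n. n \<ge> 2 \<Longrightarrow> 0 < partfun \<alpha> n {} \<and> partfun \<alpha> n {} < \<infinity>"
    by (rule partfun_limit[OF assms(1) empty(1,3,4) A]) (rule that)
  let ?Z = "\<lambda>n. enn2real (partfun \<alpha> n U)" and ?W = "\<lambda>n. enn2real (partfun \<alpha> n {})"
  \<comment> \<open>for \<open>n \<ge> 2\<close> both partition functions are positive and finite\<close>
  have eq: "elog (p n) / ereal ((real n)\<^sup>2) = ereal (ln (?Z n) / (real n)\<^sup>2 - ln (?W n) / (real n)\<^sup>2)"
    if n: "n \<ge> 2" for n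
  proof -
    define z where "z = ?Z n"
    define w where "w = ?W n"
    have Z: "partfun \<alpha> n U = ennreal z" "z > 0"
      using l(3)[OF n] by (auto simp: z_def enn2real_positive_iff)
    have W: "partfun \<alpha> n {} = ennreal w" "w > 0"
      using l0(3)[OF n] by (auto simp: w_def enn2real_positive_iff)
    have K: "norm_const \<alpha> n > 0" using n by (intro norm_const_pos \<alpha>) auto
    have "p n \<ge> 0" by (simp add: p_def)
    have "ennreal (fact n * p n) = ennreal (norm_const \<alpha> n * z)"
      using void[of n] n K Z(2) \<open>p n \<ge> 0\<close> unfolding Z(1) by (simp add: ennreal_mult)
    then have 1: "fact n * p n = norm_const \<alpha> n * z"
      using K Z(2) \<open>p n \<ge> 0\<close> by (subst (asm) ennreal_inj) auto
    have "ennreal (fact n) = ennreal (norm_const \<alpha> n * w)"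
      using total[of n] n K W(2) unfolding W(1) by (simp add: ennreal_mult)
    then have 2: "fact n = norm_const \<alpha> n * w"
      using K W(2) by (subst (asm) ennreal_inj) auto
    from 1 have "norm_const \<alpha> n * (w * p n) = norm_const \<alpha> n * z" unfolding 2 by (simp add: mult.assoc)
    then have "w * p n = z" using K by simp
    then have p: "p n = z / w" using W(2) by (simp add: field_simps)
    then have "p n > 0" using Z(2) W(2) by simp
    then have "elog (p n) = ereal (ln z - ln w)"
      using \<open>p n > 0\<close> Z(2) W(2) by (simp add: elog_def p ln_div not_le)
    then show ?thesis using n by (simp add: z_def w_def diff_divide_distrib)
  qed
  have "(\<lambda>n. ereal (ln (?Z n) / (real n)\<^sup>2 - ln (?W n) / (real n)\<^sup>2)) \<longlonglongrightarrow> ereal (l - l0)"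
    by (intro tendsto_intros l(2) l0(2))
  moreover have "min_energy \<alpha> {} - min_energy \<alpha> U = ereal (l - l0)" by (simp add: l(1) l0(1))
  ultimately have "(\<lambda>n. elog (p n) / ereal ((real n)\<^sup>2)) \<longlonglongrightarrow> min_energy \<alpha> {} - min_energy \<alpha> U"
    by (simp only:) (rule Lim_transform_eventually, assumption,
      rule eventually_mono[OF eventually_ge_at_top[of 2]], rule eq[symmetric])
  then show ?thesis unfolding p_def V_def .
qed

end
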